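(* Let $1<\alpha<2$ and let $X_t$ be a stable Lévy process on $\mathbb{R}$ of index $\alpha$ with parameters $a\in\mathbb{R}$ and $b,c\ge 0$ not both zero (generator as in the context). Let $\Omega=(\ell,R)$ with real $\ell<R$, and let $L_\Omega$ be the generator of the killed semigroup $P^\Omega_t$ on $C_0(\Omega)$. Then the function $u(x,t)=\mathbb{E}^x[f(X_t)I\{\tau_\Omega>t\}]$ is the unique solution to the space-fractional Dirichlet problem $$\begin{aligned}\partial_tu(x,t)&=-a\,\partial_xu(x,t)+b\,\mathbb{D}^\alpha_{[\ell,x]}u(x,t)+c\,\mathbb{D}^\alpha_{[x,R]}u(x,t) && \forall x\in\Omega,\ t>0,\\ u(x,0)&=f(x) && \forall x\in\Omega,\\ u(x,t)&=0 && \forall x\notin\Omega,\ t\ge 0\end{aligned}$$ for any $f\in\mathcal{D}(L_\Omega)$, and the unique mild solution for any $f\in C_0(\Omega)$. Moreover, if $u_1,u_2$ are the solutions corresponding to initial functions $f_1,f_2$, then $\|u_2(t)-u_1(t)\|\le\|f_2-f_1\|$ in the supremum norm for all $t\ge 0$; hence the Dirichlet problem is well posed.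
   Context: The generator of $X_t$ is $$Lf(x)=-af'(x)+\int_{y\ne 0}\bigl[f(x-y)-f(x)+yf'(x)\bigr]\,\phi(dy),$$ with $\phi(dy)=b\frac{\alpha(\alpha-1)}{\Gamma(2-\alpha)}y^{-\alpha-1}dy$ for $y>0$ and $\phi(dy)=c\frac{\alpha(\alpha-1)}{\Gamma(2-\alpha)}|y|^{-\alpha-1}dy$ for $y<0$. $C_0(\Omega)$ is the Banach space (supremum norm) of continuous real functions on $\Omega$ tending to zero at the boundary; its elements are extended by $0$ outside $\Omega$. $\tau_\Omega=\inf\{t>0:X_t\notin\Omega\}$; $X_t^\Omega=X_t$ for $t<\tau_\Omega$ and $X^\Omega_t=\partial$ (cemetery point, where functions are taken to be $0$) for $t\ge\tau_\Omega$. $P^\Omega_tf(x)=\mathbb{E}^x[f(X_t^\Omega)]$ is a Feller semigroup on $C_0(\Omega)$, with generator $L_\Omega f=\lim_{t\searrow 0}(P_t^\Omega f-f)/t$ in $C_0(\Omega)$ and domain $\mathcal{D}(L_\Omega)$. Convention: the spatial operator $-a\partial_x+b\,\mathbb{D}^\alpha_{[\ell,x]}+c\,\mathbb{D}^\alpha_{[x,R]}$ in the equation denotes $L_\Omega$ on $\mathcal{D}(L_\Omega)$, which is the unique continuous extension of the formula with Riemann–Liouville derivatives $$\mathbb{D}^\alpha_{[\ell,x]}f(x)=\frac{1}{\Gamma(2-\alpha)}\frac{d^2}{dx^2}\int_\ell^xf(y)(x-y)^{1-\alpha}dy,\qquad \mathbb{D}^\alpha_{[x,R]}f(x)=\frac{1}{\Gamma(2-\alpha)}\frac{d^2}{dx^2}\int_x^Rf(y)(y-x)^{1-\alpha}dy$$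 (it agrees with this formula for $f\in C_0(\Omega)$ that are twice continuously differentiable in $\Omega$ and for which the formula yields an element of $C_0(\Omega)$). Solution: a function $u\in C^1([0,\infty);C_0(\Omega))$ with $u(t)\in\mathcal{D}(L_\Omega)$ and $\partial_tu(t)=L_\Omega u(t)$, $u(0)=f$. Mild solution: a function $u\in C([0,\infty);C_0(\Omega))$ with $\int_0^tu(s)\,ds\in\mathcal{D}(L_\Omega)$ and $u(t)=f+L_\Omega\int_0^tu(s)\,ds$ for all $t\ge 0$. *)

theory Defs
  imports "HOL-Probability.Probability"
begin

section \<open>Function spaces and generators\<close>

text \<open>
  For an open set \<open>\<Omega>\<close>, extension by zero embeds the Banach space of continuous functions on \<open>\<Omega>\<close>
  that tend to zero at the boundary (and at infinity) isometrically into the bounded continuous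
  functions on the real line. \<open>C0 \<Omega>\<close> is its image; the norm of \<open>bcontfun\<close> is the supremum norm.
\<close>

definition C0 :: "real set \<Rightarrow> (real, real) bcontfun set" where
  "C0 \<Omega> = {f. (\<forall>x. x \<notin> \<Omega> \<longrightarrow> apply_bcontfun f x = 0) \<and>
     (\<forall>e>0. \<exists>K. compact K \<and> K \<subseteq> \<Omega> \<and> (\<forall>x\<in>\<Omega> - K. \<bar>apply_bcontfun f x\<bar> < e))}"

text \<open>
  \<open>has_generator T \<Omega> f g\<close>: the difference quotients of the operator family \<open>T\<close> at \<open>f\<close>
  converge to \<open>g\<close> in \<open>C0 \<Omega>\<close> as \<open>t\<close> decreases to \<open>0\<close>.
\<close>

definition has_generator ::
  "(real \<Rightarrow> (real \<Rightarrow> real) \<Rightarrow> real \<Rightarrow> real) \<Rightarrow> real set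
    \<Rightarrow> (real, real) bcontfun \<Rightarrow> (real, real) bcontfun \<Rightarrow> bool" where
  "has_generator T \<Omega> f g \<longleftrightarrow> f \<in> C0 \<Omega> \<and> g \<in> C0 \<Omega> \<and>
     uniform_limit UNIV (\<lambda>t x. (T t (apply_bcontfun f) x - apply_bcontfun f x) / t)
       (apply_bcontfun g) (at_right 0)"

definition generator_dom ::
  "(real \<Rightarrow> (real \<Rightarrow> real) \<Rightarrow> real \<Rightarrow> real) \<Rightarrow> real set \<Rightarrow> (real, real) bcontfun set" where
  "generator_dom T \<Omega> = {f. \<exists>g. has_generator T \<Omega> f g}"

definition generator ::
  "(real \<Rightarrow> (real \<Rightarrow> real) \<Rightarrow> real \<Rightarrow> real) \<Rightarrow> real set
    \<Rightarrow> (real, real) bcontfun \<Rightarrow> (real, real) bcontfun" where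
  "generator T \<Omega> f = (THE g. has_generator T \<Omega> f g)"


section \<open>Stable Levy processes\<close>

text \<open>
  A Levy process started at \<open>0\<close>, with time parameter in \<open>[0, \<infinity>)\<close> (values at negative times are
  irrelevant). The process started at \<open>x\<close> is \<open>x + Z\<close>, so an expectation under \<open>P\<^sup>x\<close> of a
  functional of \<open>X\<close> is the expectation under \<open>M\<close> of the same functional of \<open>x + Z\<close>.
\<close>

definition levy_process :: "'w measure \<Rightarrow> (real \<Rightarrow> 'w \<Rightarrow> real) \<Rightarrow> bool" where
  "levy_process M Z \<longleftrightarrow>
     prob_space M \<and>
     (\<forall>t\<ge>0. Z t \<in> borel_measurable M) \<and>
     (AE \<omega> in M. Z 0 \<omega> = 0) \<and>
     (\<forall>(n::nat) (s::nat \<Rightarrow> real). 0 \<le> s 0 \<longrightarrow> (\<forall>i<n. s i < s (Suc i)) \<longrightarrow>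
        prob_space.indep_vars M (\<lambda>_. borel) (\<lambda>i \<omega>. Z (s (Suc i)) \<omega> - Z (s i) \<omega>) {..<n}) \<and>
     (\<forall>s\<ge>0. \<forall>h\<ge>0. distr M borel (\<lambda>\<omega>. Z (s + h) \<omega> - Z s \<omega>) = distr M borel (Z h)) \<and>
     (AE \<omega> in M. (\<forall>t\<ge>0. continuous (at_right t) (\<lambda>s. Z s \<omega>)) \<and>
        (\<forall>t>0. \<exists>y. ((\<lambda>s. Z s \<omega>) \<longlongrightarrow> y) (at_left t)))"

definition levy_semigroup ::
  "'w measure \<Rightarrow> (real \<Rightarrow> 'w \<Rightarrow> real) \<Rightarrow> real \<Rightarrow> (real \<Rightarrow> real) \<Rightarrow> real \<Rightarrow> real" where
  "levy_semigroup M Z t f x = (LINT \<omega>|M. f (x + Z t \<omega>))"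

definition stable_jump_measure :: "real \<Rightarrow> real \<Rightarrow> real \<Rightarrow> real measure" where
  "stable_jump_measure \<alpha> b c = density lborel (\<lambda>y. ennreal (
     if y > 0 then b * (\<alpha> * (\<alpha> - 1) / Gamma (2 - \<alpha>)) * y powr (- \<alpha> - 1)
     else if y < 0 then c * (\<alpha> * (\<alpha> - 1) / Gamma (2 - \<alpha>)) * \<bar>y\<bar> powr (- \<alpha> - 1)
     else 0))"

text \<open>
  The jump term is \<open>f (x - y)\<close>, so mass at \<open>y\<close> stands for a jump of size \<open>- y\<close>: the parameter \<open>b\<close>
  governs the downward jumps of the process and \<open>c\<close> the upward ones.
\<close>

definition stable_operator :: "real \<Rightarrow> real \<Rightarrow> real \<Rightarrow> real \<Rightarrow> (real \<Rightarrow> real) \<Rightarrow> real \<Rightarrow> real" where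
  "stable_operator \<alpha> a b c f x = - a * deriv f x +
     (LINT y|stable_jump_measure \<alpha> b c. f (x - y) - f x + y * deriv f x)"

text \<open>
  The formula for the generator is required on the functions that vanish at infinity together with
  their first two derivatives, which form a core of the generator on \<open>C0 UNIV\<close>.
\<close>

definition stable_levy_process ::
  "'w measure \<Rightarrow> (real \<Rightarrow> 'w \<Rightarrow> real) \<Rightarrow> real \<Rightarrow> real \<Rightarrow> real \<Rightarrow> real \<Rightarrow> bool" where
  "stable_levy_process M Z \<alpha> a b c \<longleftrightarrow>
     levy_process M Z \<and>
     (\<forall>f f' f''. f \<in> C0 UNIV \<and> f' \<in> C0 UNIV \<and> f'' \<in> C0 UNIV \<and>
        (\<forall>x. (apply_bcontfun f has_real_derivative apply_bcontfun f' x) (at x)) \<and>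
        (\<forall>x. (apply_bcontfun f' has_real_derivative apply_bcontfun f'' x) (at x)) \<longrightarrow>
        (\<exists>g. has_generator (levy_semigroup M Z) UNIV f g \<and>
             (\<forall>x. apply_bcontfun g x = stable_operator \<alpha> a b c (apply_bcontfun f) x)))"


section \<open>The process killed on leaving a domain\<close>

definition exit_time :: "(real \<Rightarrow> 'w \<Rightarrow> real) \<Rightarrow> real set \<Rightarrow> real \<Rightarrow> 'w \<Rightarrow> ereal" where
  "exit_time Z \<Omega> x \<omega> = Inf (ereal ` {t. t > 0 \<and> x + Z t \<omega> \<notin> \<Omega>})"

text \<open>
  \<open>E\<^sup>x[f (X\<^sub>t) I{\<tau> > t}]\<close>, which is also \<open>E\<^sup>x[f (X\<^sub>t\<^sup>\<Omega>)]\<close> with \<open>f\<close> zero at the cemetery. The event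
  \<open>\<tau> > t\<close> concerns uncountably many times and in general belongs only to the completed
  sigma-algebra, hence the completion.
\<close>

definition killed_semigroup ::
  "'w measure \<Rightarrow> (real \<Rightarrow> 'w \<Rightarrow> real) \<Rightarrow> real set
    \<Rightarrow> real \<Rightarrow> (real \<Rightarrow> real) \<Rightarrow> real \<Rightarrow> real" where
  "killed_semigroup M Z \<Omega> t f x =
     (LINT \<omega>|completion M. (if exit_time Z \<Omega> x \<omega> > ereal t then f (x + Z t \<omega>) else 0))"


section \<open>The Dirichlet problem\<close>

text \<open>
  In the fractional Dirichlet problem the spatial operator
  \<open>- a \<partial>\<^sub>x + b D\<^bsub>[l,x]\<^esub> + c D\<^bsub>[x,R]\<^esub>\<close> (Riemann-Liouville derivatives of order \<open>\<alpha>\<close>) denotes, by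
  convention, the generator of the killed semigroup on its domain; this is the unique continuous
  extension of the pointwise formula. Membership of \<open>u t\<close> in \<open>C0 \<Omega>\<close> encodes the
  condition that \<open>u\<close> vanishes outside \<open>\<Omega>\<close>.
\<close>

definition dirichlet_dom ::
  "'w measure \<Rightarrow> (real \<Rightarrow> 'w \<Rightarrow> real) \<Rightarrow> real set \<Rightarrow> (real, real) bcontfun set" where
  "dirichlet_dom M Z \<Omega> = generator_dom (killed_semigroup M Z \<Omega>) \<Omega>"

definition dirichlet_op ::
  "'w measure \<Rightarrow> (real \<Rightarrow> 'w \<Rightarrow> real) \<Rightarrow> real set
    \<Rightarrow> (real, real) bcontfun \<Rightarrow> (real, real) bcontfun" where
  "dirichlet_op M Z \<Omega> = generator (killed_semigroup M Z \<Omega>) \<Omega>"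

definition is_solution ::
  "'w measure \<Rightarrow> (real \<Rightarrow> 'w \<Rightarrow> real) \<Rightarrow> real set
    \<Rightarrow> (real, real) bcontfun \<Rightarrow> (real \<Rightarrow> (real, real) bcontfun) \<Rightarrow> bool" where
  "is_solution M Z \<Omega> f u \<longleftrightarrow>
     (\<forall>t\<ge>0. u t \<in> C0 \<Omega>) \<and>
     (\<exists>u'. continuous_on {0..} u' \<and>
        (\<forall>t\<ge>0. (u has_vector_derivative u' t) (at t within {0..})) \<and>
        (\<forall>t\<ge>0. u t \<in> dirichlet_dom M Z \<Omega> \<and> u' t = dirichlet_op M Z \<Omega> (u t))) \<and>
     u 0 = f"

definition is_mild_solution ::
  "'w measure \<Rightarrow> (real \<Rightarrow> 'w \<Rightarrow> real) \<Rightarrow> real set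
    \<Rightarrow> (real, real) bcontfun \<Rightarrow> (real \<Rightarrow> (real, real) bcontfun) \<Rightarrow> bool" where
  "is_mild_solution M Z \<Omega> f u \<longleftrightarrow>
     (\<forall>t\<ge>0. u t \<in> C0 \<Omega>) \<and>
     continuous_on {0..} u \<and>
     (\<forall>t\<ge>0. integral {0..t} u \<in> dirichlet_dom M Z \<Omega> \<and>
        u t = f + dirichlet_op M Z \<Omega> (integral {0..t} u))"

text \<open>Existence, uniqueness and continuous dependence on the initial function.\<close>

definition dirichlet_well_posed ::
  "'w measure \<Rightarrow> (real \<Rightarrow> 'w \<Rightarrow> real) \<Rightarrow> real set \<Rightarrow> bool" where
  "dirichlet_well_posed M Z \<Omega> \<longleftrightarrow>
     (\<forall>f\<in>dirichlet_dom M Z \<Omega>. \<exists>u. is_solution M Z \<Omega> f u) \<and>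
     (\<forall>f u v. is_solution M Z \<Omega> f u \<longrightarrow> is_solution M Z \<Omega> f v \<longrightarrow> (\<forall>t\<ge>0. v t = u t)) \<and>
     (\<forall>f\<in>C0 \<Omega>. \<exists>u. is_mild_solution M Z \<Omega> f u) \<and>
     (\<forall>f u v. is_mild_solution M Z \<Omega> f u \<longrightarrow> is_mild_solution M Z \<Omega> f v \<longrightarrow>
        (\<forall>t\<ge>0. v t = u t)) \<and>
     (\<forall>f\<in>C0 \<Omega>. \<forall>u. is_mild_solution M Z \<Omega> f u \<longrightarrow>
        (\<forall>e>0. \<exists>d>0. \<forall>g\<in>C0 \<Omega>. \<forall>v. is_mild_solution M Z \<Omega> g v \<longrightarrow> norm (g - f) < d \<longrightarrow>
           (\<forall>t\<ge>0. norm (v t - u t) < e))) \<and>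
     (\<forall>f\<in>dirichlet_dom M Z \<Omega>. \<forall>u. is_solution M Z \<Omega> f u \<longrightarrow>
        (\<forall>e>0. \<exists>d>0. \<forall>g\<in>dirichlet_dom M Z \<Omega>. \<forall>v. is_solution M Z \<Omega> g v \<longrightarrow> norm (g - f) < d \<longrightarrow>
           (\<forall>t\<ge>0. norm (v t - u t) < e)))"

end

theory Submission
  imports Defs
begin

text \<open>
  The Dirichlet operator is by definition the generator of the killed semigroup. Once this family is
  known to be a strongly continuous contraction semigroup on \<open>C0 {l<..<R}\<close> (\<open>feller_killed\<close>),
  well-posedness is abstract: the orbit \<open>S t f\<close> of the semigroup is a solution, respectively a mild
  one, and every solution \<open>u\<close> is an orbit because \<open>S (t - s) (u s)\<close> is constant in \<open>s\<close>
  (\<open>solution_eq_orbit\<close>). Contractivity of \<open>S t\<close> is the stability estimate.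

  The work is in the Feller property. Up to null sets the path started at \<open>x\<close> stays in the interval
  until \<open>t\<close> iff \<open>x + inf Z > l\<close> and \<open>x + sup Z < R\<close>, with running extrema over \<open>{0..t}\<close>. If these have
  no atoms at any \<open>t > 0\<close>, then the killed expectation is continuous in \<open>x\<close> on the whole line by
  dominated convergence, and it vanishes off the interval since \<open>inf Z \<le> 0 \<le> sup Z\<close>; so continuity in
  the interior and regularity of the boundary come from the same fact. The semigroup law is obtained
  from the Markov chain that looks at the path on a finite grid only; again because the extrema have
  no atoms, a refined grid decides in the limit whether the path has left the interval.

  The absence of atoms rests on two properties of the law of \<open>Z t\<close>. First, its characteristic function
  vanishes at infinity, hence \<open>Z t\<close> plus any independent variable has no atoms. As the infimum up to
  \<open>t\<close> is the minimum of the infimum up to \<open>s\<close> and of \<open>Z s\<close> plus an independent variable, an atom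
  persists as \<open>s\<close> decreases to \<open>0\<close>, so it can only sit at \<open>0\<close> (\<open>infimum_no_atom_off_0\<close>). Second,
  \<open>P (Z s < 0)\<close> and \<open>P (Z s > 0)\<close> do not tend to \<open>0\<close> with \<open>s\<close>, which excludes an atom at \<open>0\<close> by a
  zero-one argument (\<open>infimum_negative\<close>). Both properties are read off from the characteristic function
  \<open>exp (t * \<eta> \<xi>)\<close> (\<open>char_Z\<close>), which follows from the generator on damped cosines: its centred part is
  homogeneous of degree \<open>\<alpha> > 1\<close>, so that the rescaled centred process has a fixed law, and this law
  is neither trivial nor carried by a half-line.
\<close>

section \<open>Contraction semigroups on a closed subspace of a Banach space\<close>

lemma has_vector_derivative_withinE:
  fixes f :: "real \<Rightarrow> 'a::real_normed_vector"
  assumes "(f has_vector_derivative D) (at s within T)" "0 < e"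
  obtains d where "0 < d"
    "\<And>y. y \<in> T \<Longrightarrow> \<bar>y - s\<bar> < d \<Longrightarrow> norm (f y - f s - (y - s) *\<^sub>R D) \<le> e * \<bar>y - s\<bar>"
proof -
  have "\<exists>d>0. \<forall>y\<in>T. norm (y - s) < d \<longrightarrow> norm (f y - f s - (y - s) *\<^sub>R D) \<le> e * norm (y - s)"
    using assms unfolding has_vector_derivative_def has_derivative_within_alt by (elim conjE allE impE)
  then show ?thesis using that by (auto simp: real_norm_def)
qed

lemma has_integral_riemannE:
  fixes u :: "real \<Rightarrow> 'a::real_normed_vector"
  assumes "(u has_integral y) {a..b}" "0 < e"
  obtains \<gamma> where "gauge \<gamma>" "\<And>D. D tagged_division_of {a..b} \<Longrightarrow> \<gamma> fine D \<Longrightarrow>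
    norm ((\<Sum>p\<in>D. measure lborel (snd p) *\<^sub>R u (fst p)) - y) < e"
proof -
  have "\<exists>\<gamma>. gauge \<gamma> \<and> (\<forall>D. D tagged_division_of {a..b} \<and> \<gamma> fine D \<longrightarrow>
      norm ((\<Sum>(x,k)\<in>D. measure lborel k *\<^sub>R u x) - y) < e)"
    by (rule mp[OF spec[OF assms(1)[unfolded has_integral_real]] assms(2)])
  then obtain \<gamma> where \<gamma>: "gauge \<gamma>" "\<forall>D. D tagged_division_of {a..b} \<and> \<gamma> fine D \<longrightarrow>
      norm ((\<Sum>(x,k)\<in>D. measure lborel k *\<^sub>R u x) - y) < e" by (elim exE conjE)
  show ?thesis
    by (rule that[OF \<gamma>(1)]) (use \<gamma>(2) in \<open>simp add: case_prod_unfold\<close>)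
qed

locale contraction_semigroup =
  fixes V :: "'a::banach set" and S :: "real \<Rightarrow> 'a \<Rightarrow> 'a"
  assumes subspace_V: "subspace V"
    and closed_V: "closed V"
    and S_in_V: "\<And>t f. 0 \<le> t \<Longrightarrow> f \<in> V \<Longrightarrow> S t f \<in> V"
    and S_add: "\<And>t f g. 0 \<le> t \<Longrightarrow> f \<in> V \<Longrightarrow> g \<in> V \<Longrightarrow> S t (f + g) = S t f + S t g"
    and S_scaleR: "\<And>t f c. 0 \<le> t \<Longrightarrow> f \<in> V \<Longrightarrow> S t (c *\<^sub>R f) = c *\<^sub>R S t f"
    and norm_S: "\<And>t f. 0 \<le> t \<Longrightarrow> f \<in> V \<Longrightarrow> norm (S t f) \<le> norm f"
    and S_0: "\<And>f. f \<in> V \<Longrightarrow> S 0 f = f"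
    and S_plus: "\<And>s t f. 0 \<le> s \<Longrightarrow> 0 \<le> t \<Longrightarrow> f \<in> V \<Longrightarrow> S (s + t) f = S s (S t f)"
    and S_tendsto: "\<And>f. f \<in> V \<Longrightarrow> ((\<lambda>t. S t f) \<longlongrightarrow> f) (at_right 0)"
begin

definition gen :: "'a \<Rightarrow> 'a \<Rightarrow> bool" where
  "gen f g \<longleftrightarrow> f \<in> V \<and> g \<in> V \<and> ((\<lambda>t. (S t f - f) /\<^sub>R t) \<longlongrightarrow> g) (at_right 0)"

lemma V_add: "f \<in> V \<Longrightarrow> g \<in> V \<Longrightarrow> f + g \<in> V"
  and V_scaleR: "f \<in> V \<Longrightarrow> c *\<^sub>R f \<in> V"
  and V_diff: "f \<in> V \<Longrightarrow> g \<in> V \<Longrightarrow> f - g \<in> V"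
  and V_0: "0 \<in> V"
  using subspace_V by (simp_all add: subspace_add subspace_scale subspace_diff subspace_0)

lemma S_zero: "0 \<le> t \<Longrightarrow> S t 0 = 0"
  using S_scaleR[of t 0 0] V_0 by simp

lemma S_diff: "0 \<le> t \<Longrightarrow> f \<in> V \<Longrightarrow> g \<in> V \<Longrightarrow> S t (f - g) = S t f - S t g"
  using S_add[of t "f - g" g] V_diff[of f g] by (simp add: algebra_simps)

lemma gen_in_V: "gen f g \<Longrightarrow> f \<in> V" "gen f g \<Longrightarrow> g \<in> V"
  by (auto simp: gen_def)

lemma gen_unique: "gen f g \<Longrightarrow> gen f h \<Longrightarrow> g = h"
  unfolding gen_def using tendsto_unique[of "at_right (0::real)"] by auto

lemma gen_0: "gen 0 0"
proof -
  have "((\<lambda>t. (S t 0 - 0) /\<^sub>R t) \<longlongrightarrow> 0) (at_right 0)"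
    by (rule tendsto_eventually, rule eventually_at_rightI[of 0 1]) (auto simp: S_zero)
  then show ?thesis by (simp add: gen_def V_0)
qed

lemma gen_diff: assumes "gen f g" "gen f' g'" shows "gen (f - f') (g - g')"
proof -
  have *: "((\<lambda>t. (S t f - f) /\<^sub>R t - (S t f' - f') /\<^sub>R t) \<longlongrightarrow> g - g') (at_right 0)"
    using assms by (intro tendsto_diff) (auto simp: gen_def)
  have "((\<lambda>t. (S t (f - f') - (f - f')) /\<^sub>R t) \<longlongrightarrow> g - g') (at_right 0)"
    by (rule Lim_transform_eventually[OF *], rule eventually_at_rightI[of 0 1])
      (use assms in \<open>auto simp: S_diff gen_def algebra_simps\<close>)
  then show ?thesis using assms by (auto simp: gen_def V_diff)
qed

lemma orbit_near:
  assumes "f \<in> V" "0 < e"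
  obtains d where "0 < d" "\<And>h. 0 \<le> h \<Longrightarrow> h < d \<Longrightarrow> norm (S h f - f) \<le> e"
proof -
  have "\<forall>\<^sub>F h in at_right 0. dist (S h f) f < e"
    using S_tendsto[OF assms(1)] assms(2) by (rule tendstoD)
  then obtain d where d: "d > 0" "\<And>h. 0 < h \<Longrightarrow> h < d \<Longrightarrow> dist (S h f) f < e"
    unfolding eventually_at_right_field by auto
  show ?thesis
  proof (rule that[OF d(1)])
    fix h :: real assume "0 \<le> h" "h < d"
    then show "norm (S h f - f) \<le> e"
      using d(2)[of h] assms S_0 by (cases "h = 0") (auto simp: dist_norm)
  qed
qed

lemma orbit_increment:
  assumes "f \<in> V" "0 \<le> s" "s \<le> t"
  shows "norm (S t f - S s f) \<le> norm (S (t - s) f - f)"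
proof -
  have "S t f = S s (S (t - s) f)" using S_plus[of s "t - s" f] assms by simp
  then have "S t f - S s f = S s (S (t - s) f - f)"
    using assms by (simp add: S_diff S_in_V)
  then show ?thesis using norm_S[of s "S (t - s) f - f"] assms by (simp add: V_diff S_in_V)
qed

lemma orbit_uniform:
  assumes "f \<in> V" "0 < e"
  obtains d where "0 < d" "\<And>s t. 0 \<le> s \<Longrightarrow> 0 \<le> t \<Longrightarrow> \<bar>t - s\<bar> < d \<Longrightarrow> norm (S t f - S s f) \<le> e"
proof -
  obtain d where d: "0 < d" "\<And>h. 0 \<le> h \<Longrightarrow> h < d \<Longrightarrow> norm (S h f - f) \<le> e"
    using orbit_near[OF assms] by blast
  show ?thesis
  proof (rule that[OF d(1)])
    fix s t :: real assume *: "0 \<le> s" "0 \<le> t" "\<bar>t - s\<bar> < d"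
    show "norm (S t f - S s f) \<le> e"
    proof (cases "s \<le> t")
      case True
      then show ?thesis using orbit_increment[of f s t] d(2)[of "t - s"] * assms by auto
    next
      case False
      then show ?thesis using orbit_increment[of f t s] d(2)[of "s - t"] * assms
        by (auto simp: norm_minus_commute)
    qed
  qed
qed

lemma continuous_on_orbit: assumes "f \<in> V" shows "continuous_on {0..} (\<lambda>t. S t f)"
  unfolding continuous_on_iff
proof (intro ballI allI impI)
  fix s e :: real assume "s \<in> {0..}" "0 < e"
  then have "0 \<le> s" by simp
  obtain d where d: "0 < d" "\<And>s t. 0 \<le> s \<Longrightarrow> 0 \<le> t \<Longrightarrow> \<bar>t - s\<bar> < d \<Longrightarrow> norm (S t f - S s f) \<le> e / 2"
    using orbit_uniform[OF assms, of "e / 2"] \<open>0 < e\<close> by auto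
  show "\<exists>d>0. \<forall>x'\<in>{0..}. dist x' s < d \<longrightarrow> dist (S x' f) (S s f) < e"
  proof (intro exI[of _ d] conjI ballI impI d(1))
    fix r :: real assume "r \<in> {0..}" "dist r s < d"
    then have "norm (S r f - S s f) \<le> e / 2" using d(2)[of s r] \<open>0 \<le> s\<close> by (simp add: dist_norm)
    then show "dist (S r f) (S s f) < e" using \<open>0 < e\<close> by (simp add: dist_norm)
  qed
qed

lemma gen_near:
  assumes "gen f g" "0 < e"
  obtains d where "0 < d" "\<And>h. 0 \<le> h \<Longrightarrow> h < d \<Longrightarrow> norm (S h f - f - h *\<^sub>R g) \<le> e * h"
proof -
  have "\<forall>\<^sub>F h in at_right 0. dist ((S h f - f) /\<^sub>R h) g < e"
    using assms by (auto simp: gen_def dest: tendstoD)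
  then obtain d where d: "d > 0" "\<And>h. 0 < h \<Longrightarrow> h < d \<Longrightarrow> dist ((S h f - f) /\<^sub>R h) g < e"
    unfolding eventually_at_right_field by auto
  show ?thesis
  proof (rule that[OF d(1)])
    fix h :: real assume h: "0 \<le> h" "h < d"
    show "norm (S h f - f - h *\<^sub>R g) \<le> e * h"
    proof (cases "h = 0")
      case True then show ?thesis using S_0 assms by (simp add: gen_in_V)
    next
      case False
      then have "S h f - f - h *\<^sub>R g = h *\<^sub>R ((S h f - f) /\<^sub>R h - g)"
        using h by (simp add: scaleR_diff_right)
      then have "norm (S h f - f - h *\<^sub>R g) = h * dist ((S h f - f) /\<^sub>R h) g"
        using h by (simp add: dist_norm)
      also have "\<dots> \<le> h * e" using d(2)[of h] h False by (intro mult_left_mono) auto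
      finally show ?thesis by (simp add: mult.commute)
    qed
  qed
qed

text \<open>
  The derivative is two-sided: from the left,
  \<open>S t f - S (t - h) f = S (t - h) (S h f - f)\<close>, and contractivity carries the difference
  quotient at \<open>0\<close> to \<open>t - h\<close> without loss.
\<close>

lemma has_vector_derivative_orbit:
  assumes "gen f g" "0 \<le> t"
  shows "((\<lambda>s. S s f) has_vector_derivative S t g) (at t within {0..})"
  unfolding has_vector_derivative_def has_derivative_within_alt
proof (intro conjI allI impI)
  show "bounded_linear (\<lambda>x. x *\<^sub>R S t g)" by (rule bounded_linear_scaleR_left)
  fix e :: real assume "0 < e"
  note fg = gen_in_V[OF assms(1)]
  obtain d1 where d1: "0 < d1" "\<And>h. 0 \<le> h \<Longrightarrow> h < d1 \<Longrightarrow> norm (S h f - f - h *\<^sub>R g) \<le> (e / 2) * h"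
    using gen_near[OF assms(1), of "e / 2"] \<open>0 < e\<close> by (metis half_gt_zero)
  obtain d2 where d2: "0 < d2"
      "\<And>s t. 0 \<le> s \<Longrightarrow> 0 \<le> t \<Longrightarrow> \<bar>t - s\<bar> < d2 \<Longrightarrow> norm (S t g - S s g) \<le> e / 2"
    using orbit_uniform[OF fg(2), of "e / 2"] \<open>0 < e\<close> by auto
  have step: "norm (S r (S h f - f - h *\<^sub>R g)) \<le> (e / 2) * h" if "0 \<le> r" "0 \<le> h" "h < d1" for r h
    using norm_S[of r "S h f - f - h *\<^sub>R g"] d1(2)[of h] that fg
    by (simp add: V_diff S_in_V V_scaleR)
  have expand: "S r (S h f - f - h *\<^sub>R g) = S (r + h) f - S r f - h *\<^sub>R S r g"
    if "0 \<le> r" "0 \<le> h" for r h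
    using that fg by (simp add: S_diff S_scaleR V_diff S_in_V V_scaleR S_plus)
  show "\<exists>d>0. \<forall>y\<in>{0..}. norm (y - t) < d \<longrightarrow>
      norm (S y f - S t f - (y - t) *\<^sub>R S t g) \<le> e * norm (y - t)"
  proof (intro exI[of _ "min d1 d2"] conjI ballI impI)
    show "0 < min d1 d2" using d1 d2 by simp
    fix y :: real assume y: "y \<in> {0..}" "norm (y - t) < min d1 d2"
    show "norm (S y f - S t f - (y - t) *\<^sub>R S t g) \<le> e * norm (y - t)"
    proof (cases "t \<le> y")
      case True
      have "norm (S y f - S t f - (y - t) *\<^sub>R S t g) \<le> (e / 2) * (y - t)"
        using step[of t "y - t"] expand[of t "y - t"] True assms y by auto
      also have "\<dots> \<le> e * (y - t)" using True \<open>0 < e\<close> by (intro mult_right_mono) auto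
      finally show ?thesis using True by simp
    next
      case False
      have eq: "S y f - S t f - (y - t) *\<^sub>R S t g =
          - (S y (S (t - y) f - f - (t - y) *\<^sub>R g)) + (t - y) *\<^sub>R (S t g - S y g)"
        using expand[of y "t - y"] False y by (simp add: algebra_simps)
      have "norm (S y f - S t f - (y - t) *\<^sub>R S t g) \<le> (e / 2) * (t - y) + (t - y) * (e / 2)"
        unfolding eq
        by (rule order.trans[OF norm_triangle_ineq], rule add_mono)
          (use step[of y "t - y"] d2(2)[of y t] False y assms
            in \<open>auto intro!: mult_left_mono\<close>)
      then show ?thesis using False by (simp add: field_simps)
    qed
  qed
qed

lemma has_integral_orbit:
  assumes "gen f g" "0 \<le> t"
  shows "((\<lambda>s. S s g) has_integral (S t f - f)) {0..t}"
proof -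
  have "((\<lambda>s. S s g) has_integral (S t f - S 0 f)) {0..t}"
    using assms by (intro fundamental_theorem_of_calculus)
      (auto intro: has_vector_derivative_within_subset[OF has_vector_derivative_orbit])
  then show ?thesis using S_0 gen_in_V[OF assms(1)] by simp
qed

lemma gen_orbit: assumes "gen f g" "0 \<le> t" shows "gen (S t f) (S t g)"
proof -
  note fg = gen_in_V[OF assms(1)]
  have "((\<lambda>h. (S h (S t f) - S t f) /\<^sub>R h) \<longlongrightarrow> S t g) (at_right 0)"
  proof (rule tendstoI)
    fix e :: real assume "0 < e"
    obtain d where d: "0 < d" "\<And>h. 0 \<le> h \<Longrightarrow> h < d \<Longrightarrow> norm (S h f - f - h *\<^sub>R g) \<le> (e / 2) * h"
      using gen_near[OF assms(1), of "e / 2"] \<open>0 < e\<close> by (metis half_gt_zero)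
    show "\<forall>\<^sub>F h in at_right 0. dist ((S h (S t f) - S t f) /\<^sub>R h) (S t g) < e"
    proof (rule eventually_at_rightI[OF _ d(1)])
      fix h :: real assume h: "h \<in> {0<..<d}"
      have "S h (S t f) = S t (S h f)" using S_plus[of h t f] S_plus[of t h f] h assms fg
        by (simp add: add.commute)
      moreover have "S t (S h f - f - h *\<^sub>R g) = S t (S h f) - S t f - h *\<^sub>R S t g"
        using h fg assms by (simp add: S_diff S_scaleR V_diff S_in_V V_scaleR)
      ultimately have "(S h (S t f) - S t f) /\<^sub>R h - S t g = (1 / h) *\<^sub>R S t (S h f - f - h *\<^sub>R g)"
        using h by (simp add: scaleR_diff_right divide_inverse)
      then have "dist ((S h (S t f) - S t f) /\<^sub>R h) (S t g) = (1 / h) * norm (S t (S h f - f - h *\<^sub>R g))"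
        using h by (simp add: dist_norm)
      also have "\<dots> \<le> (1 / h) * ((e / 2) * h)"
        using norm_S[of t "S h f - f - h *\<^sub>R g"] d(2)[of h] h fg assms
        by (intro mult_left_mono) (auto simp: V_diff S_in_V V_scaleR)
      also have "\<dots> < e" using h \<open>0 < e\<close> by simp
      finally show "dist ((S h (S t f) - S t f) /\<^sub>R h) (S t g) < e" .
    qed
  qed
  then show ?thesis using fg assms by (auto simp: gen_def S_in_V)
qed

text \<open>
  Integrals of \<open>V\<close>-valued functions are handled through Riemann sums: these stay in \<open>V\<close> and commute
  with any contraction that is linear on \<open>V\<close> only.
\<close>

lemma integral_in_V:
  fixes a b :: real
  assumes u: "(u has_integral y) {a..b}" and uV: "\<And>s. s \<in> {a..b} \<Longrightarrow> u s \<in> V"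
  shows "y \<in> V"
proof -
  have "\<exists>z\<in>V. dist z y < e" if e: "0 < e" for e
  proof -
    obtain \<gamma> where \<gamma>: "gauge \<gamma>" "\<And>D. D tagged_division_of {a..b} \<Longrightarrow> \<gamma> fine D \<Longrightarrow>
        norm ((\<Sum>p\<in>D. measure lborel (snd p) *\<^sub>R u (fst p)) - y) < e"
    using has_integral_riemannE[OF u e] by blast
    obtain D where D: "D tagged_division_of {a..b}" "\<gamma> fine D"
      using fine_division_exists_real[OF \<gamma>(1)] by blast
    have "(\<Sum>p\<in>D. measure lborel (snd p) *\<^sub>R u (fst p)) \<in> V"
      using tag_in_interval[OF D(1)] uV
      by (intro subspace_sum[OF subspace_V]) (auto intro!: V_scaleR)
    then show ?thesis using \<gamma>(2)[OF D] by (auto simp: dist_norm)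
  qed
  then have "y \<in> closure V" by (auto simp: closure_approachable)
  then show ?thesis using closed_V by simp
qed

lemma has_integral_S:
  fixes a b :: real
  assumes u: "(u has_integral y) {a..b}" and uV: "\<And>s. s \<in> {a..b} \<Longrightarrow> u s \<in> V" and t: "0 \<le> t"
  shows "((\<lambda>s. S t (u s)) has_integral S t y) {a..b}"
proof (rule has_integral_real[THEN iffD2], intro allI impI)
  fix e :: real assume e: "0 < e"
  obtain \<gamma> where \<gamma>: "gauge \<gamma>" "\<And>D. D tagged_division_of {a..b} \<Longrightarrow> \<gamma> fine D \<Longrightarrow>
      norm ((\<Sum>p\<in>D. measure lborel (snd p) *\<^sub>R u (fst p)) - y) < e"
    using has_integral_riemannE[OF u e] by blast
  have y: "y \<in> V" by (rule integral_in_V[OF u uV])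
  have sums: "(\<Sum>i\<in>I. c i *\<^sub>R v i) \<in> V \<and> S t (\<Sum>i\<in>I. c i *\<^sub>R v i) = (\<Sum>i\<in>I. c i *\<^sub>R S t (v i))"
    if "finite I" "\<And>i. i \<in> I \<Longrightarrow> v i \<in> V" for I :: "(real \<times> real set) set" and c v
    using that by (induction I) (auto simp: V_0 S_zero t V_add V_scaleR S_add S_scaleR)
  show "\<exists>\<gamma>. gauge \<gamma> \<and> (\<forall>D. D tagged_division_of {a..b} \<and> \<gamma> fine D \<longrightarrow>
      norm ((\<Sum>(x,k)\<in>D. measure lborel k *\<^sub>R S t (u x)) - S t y) < e)"
  proof (intro exI[of _ \<gamma>] conjI allI impI \<gamma>(1), elim conjE)
    fix D assume D: "D tagged_division_of {a..b}" "\<gamma> fine D"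
    let ?s = "\<Sum>p\<in>D. measure lborel (snd p) *\<^sub>R u (fst p)"
    have s: "?s \<in> V \<and> S t ?s = (\<Sum>p\<in>D. measure lborel (snd p) *\<^sub>R S t (u (fst p)))"
      using tag_in_interval[OF D(1)] uV D
      by (intro sums) auto
    then have "norm (S t ?s - S t y) \<le> norm (?s - y)"
      using norm_S[of t "?s - y"] y t by (simp add: S_diff V_diff)
    also have "\<dots> < e" using \<gamma>(2)[OF D] .
    finally show "norm ((\<Sum>(x,k)\<in>D. measure lborel k *\<^sub>R S t (u x)) - S t y) < e"
      using s by (simp add: case_prod_unfold)
  qed
qed

text \<open>
  With \<open>I t\<close> the integral up to \<open>t\<close>, the shift identity \<open>S h (I t) = I (t + h) - I h\<close> turns the
  difference quotient of the semigroup at \<open>I t\<close> into difference quotients of \<open>I\<close> at \<open>t\<close> and at \<open>0\<close>.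
\<close>

lemma gen_integral_orbit:
  assumes f: "f \<in> V" and t: "0 \<le> t"
  shows "gen (integral {0..t} (\<lambda>s. S s f)) (S t f - f)"
proof -
  define I where "I r = integral {0..r} (\<lambda>s. S s f)" for r
  have cont: "continuous_on {a..b} (\<lambda>s. S s f)" if "0 \<le> a" for a b
    by (rule continuous_on_subset[OF continuous_on_orbit[OF f]]) (use that in auto)
  have hI: "((\<lambda>s. S s f) has_integral I r) {0..r}" if "0 \<le> r" for r
    unfolding I_def using integrable_continuous_real[OF cont[of 0 r]] by (simp add: has_integral_integral)
  have dI: "(I has_vector_derivative S r f) (at r within {0..b})" if "0 \<le> r" "r \<le> b" for r b
    unfolding I_def using integral_has_vector_derivative[OF cont[of 0 b], of r] that by simp
  have quot: "((\<lambda>h. (I (r + h) - I r) /\<^sub>R h) \<longlongrightarrow> S r f) (at_right 0)" if r: "0 \<le> r" for r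
  proof -
    show ?thesis
    proof (rule tendstoI)
      fix e :: real assume e: "0 < e"
      then obtain d where d: "0 < d" "\<And>y. r \<le> y \<Longrightarrow> y \<le> r + 1 \<Longrightarrow> \<bar>y - r\<bar> < d \<Longrightarrow>
          norm (I y - I r - (y - r) *\<^sub>R S r f) \<le> e / 2 * \<bar>y - r\<bar>"
        using has_vector_derivative_withinE[OF dI[of r "r + 1"], of "e / 2"] r half_gt_zero[OF e]
        by (metis atLeastAtMost_iff order.trans le_add_same_cancel1 zero_le_one)
      show "\<forall>\<^sub>F h in at_right 0. dist ((I (r + h) - I r) /\<^sub>R h) (S r f) < e"
      proof (rule eventually_at_rightI[of 0 "min d 1"])
        fix h assume h: "h \<in> {0<..<min d 1}"
        have "(I (r + h) - I r) /\<^sub>R h - S r f = (1 / h) *\<^sub>R (I (r + h) - I r - h *\<^sub>R S r f)"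
          using h by (simp add: algebra_simps divide_inverse)
        then have "dist ((I (r + h) - I r) /\<^sub>R h) (S r f) = (1 / h) * norm (I (r + h) - I r - h *\<^sub>R S r f)"
          using h by (simp add: dist_norm)
        also have "\<dots> \<le> (1 / h) * (e / 2 * h)"
          using d(2)[of "r + h"] h by (intro mult_left_mono) auto
        finally show "dist ((I (r + h) - I r) /\<^sub>R h) (S r f) < e" using h e by simp
      qed (use d in auto)
    qed
  qed
  have shift: "S h (I t) - I t = (I (t + h) - I t) - I h" if h: "0 < h" for h
  proof -
    have 1: "((\<lambda>s. S h (S s f)) has_integral S h (I t)) {0..t}"
      by (rule has_integral_S[OF hI[OF t]]) (use h f in \<open>auto simp: S_in_V\<close>)
    have "((\<lambda>s. S s f) has_integral S h (I t)) {h..t + h}"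
    proof -
      have "((\<lambda>s. S (s + h) f) has_integral S h (I t)) {0..t}"
        by (rule has_integral_eq[OF _ 1]) (use h f in \<open>auto simp: S_plus[symmetric] add.commute\<close>)
      from has_integral_affinity'[OF this[folded cbox_interval], of 1 "- h"]
      show ?thesis by (simp add: add.commute)
    qed
    then have "((\<lambda>s. S s f) has_integral (I h + S h (I t))) {0..t + h}"
      using hI[of h] h t by (intro has_integral_combine[of 0 h "t + h"]) auto
    then have "I (t + h) = I h + S h (I t)"
      using hI[of "t + h"] h t by (auto dest: has_integral_unique)
    then show ?thesis by (simp add: algebra_simps)
  qed
  have "((\<lambda>h. (I (t + h) - I t) /\<^sub>R h - (I (0 + h) - I 0) /\<^sub>R h) \<longlongrightarrow> S t f - S 0 f) (at_right 0)"
    by (intro tendsto_diff quot t order.refl)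
  moreover have "I 0 = 0" by (simp add: I_def)
  ultimately have *: "((\<lambda>h. (I (t + h) - I t) /\<^sub>R h - I h /\<^sub>R h) \<longlongrightarrow> S t f - f) (at_right 0)"
    using f by (simp add: S_0)
  have "((\<lambda>h. (S h (I t) - I t) /\<^sub>R h) \<longlongrightarrow> S t f - f) (at_right 0)"
    by (rule Lim_transform_eventually[OF *], rule eventually_at_rightI[of 0 1])
      (auto simp: shift scaleR_diff_right)
  moreover have "I t \<in> V"
    by (rule integral_in_V[OF hI[OF t]]) (use f in \<open>auto simp: S_in_V\<close>)
  ultimately show ?thesis using f t unfolding gen_def I_def by (auto simp: S_in_V V_diff)
qed

text \<open>
  A solution is the orbit of its initial value because \<open>S (t - s) (u s)\<close> does not depend on \<open>s\<close>:
  its derivative is \<open>S (t - s) (u' s - A (u s)) = 0\<close>.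
\<close>

lemma solution_eq_orbit:
  assumes u: "\<And>s. 0 \<le> s \<Longrightarrow> (u has_vector_derivative u' s) (at s within {0..})"
    and gen: "\<And>s. 0 \<le> s \<Longrightarrow> gen (u s) (u' s)" and t: "0 \<le> t"
  shows "u t = S t (u 0)"
proof -
  have V: "u s \<in> V" "u' s \<in> V" if "0 \<le> s" for s using gen[OF that] by (auto dest: gen_in_V)
  have "((\<lambda>s. S (t - s) (u s)) has_vector_derivative 0) (at s within {0..t})" if s: "s \<in> {0..t}" for s
    unfolding has_vector_derivative_def has_derivative_within_alt
  proof (intro conjI allI impI)
    show "bounded_linear (\<lambda>x. x *\<^sub>R (0::'a))" by (rule bounded_linear_scaleR_left)
    fix e :: real assume e: "0 < e"
    then have e3: "0 < e / 3" by simp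
    obtain d1 where d1: "d1 > 0" "\<And>y. 0 \<le> y \<Longrightarrow> \<bar>y - s\<bar> < d1 \<Longrightarrow>
        norm (u y - u s - (y - s) *\<^sub>R u' s) \<le> e / 3 * \<bar>y - s\<bar>"
      using has_vector_derivative_withinE[OF u[of s] e3] s by (metis atLeastAtMost_iff atLeast_iff)
    have g: "((\<lambda>r. S r (u s)) has_vector_derivative S (t - s) (u' s)) (at (t - s) within {0..})"
      using s by (intro has_vector_derivative_orbit gen) auto
    obtain d2 where d2: "d2 > 0" "\<And>r. 0 \<le> r \<Longrightarrow> \<bar>r - (t - s)\<bar> < d2 \<Longrightarrow>
        norm (S r (u s) - S (t - s) (u s) - (r - (t - s)) *\<^sub>R S (t - s) (u' s)) \<le> e / 3 * \<bar>r - (t - s)\<bar>"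
      using has_vector_derivative_withinE[OF g e3] by (metis atLeast_iff)
    obtain d3 where d3: "d3 > 0" "\<And>p q. 0 \<le> p \<Longrightarrow> 0 \<le> q \<Longrightarrow> \<bar>q - p\<bar> < d3 \<Longrightarrow>
        norm (S q (u' s) - S p (u' s)) \<le> e / 3"
      using orbit_uniform[of "u' s" "e / 3"] e3 V s by auto
    show "\<exists>d>0. \<forall>y\<in>{0..t}. norm (y - s) < d \<longrightarrow>
        norm (S (t - y) (u y) - S (t - s) (u s) - (y - s) *\<^sub>R 0) \<le> e * norm (y - s)"
    proof (intro exI[of _ "min d1 (min d2 d3)"] conjI ballI impI)
      show "0 < min d1 (min d2 d3)" using d1 d2 d3 by simp
      fix y assume y: "y \<in> {0..t}" "norm (y - s) < min d1 (min d2 d3)"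
      let ?A = "S (t - y) (u y - u s - (y - s) *\<^sub>R u' s)"
      let ?B = "S (t - y) (u s) - S (t - s) (u s) - ((t - y) - (t - s)) *\<^sub>R S (t - s) (u' s)"
      let ?C = "(y - s) *\<^sub>R (S (t - y) (u' s) - S (t - s) (u' s))"
      have "?A = S (t - y) (u y) - S (t - y) (u s) - (y - s) *\<^sub>R S (t - y) (u' s)"
        using V[of s] V[of y] s y by (simp add: S_diff S_scaleR V_diff V_scaleR)
      then have eq: "S (t - y) (u y) - S (t - s) (u s) - (y - s) *\<^sub>R 0 = ?A + ?B + ?C"
        by (simp add: algebra_simps)
      moreover have "norm ?A \<le> e / 3 * \<bar>y - s\<bar>"
        using norm_S[of "t - y" "u y - u s - (y - s) *\<^sub>R u' s"] d1(2)[of y] V[of s] V[of y] s y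
        by (auto simp: V_diff V_scaleR)
      moreover have "norm ?B \<le> e / 3 * \<bar>y - s\<bar>"
        using d2(2)[of "t - y"] y by (auto simp: abs_minus_commute)
      moreover have "norm ?C \<le> \<bar>y - s\<bar> * (e / 3)"
        using mult_left_mono[OF d3(2)[of "t - s" "t - y"], of "\<bar>y - s\<bar>"] s y
        by (auto simp: abs_minus_commute)
      moreover have "e * \<bar>y - s\<bar> = e / 3 * \<bar>y - s\<bar> + e / 3 * \<bar>y - s\<bar> + \<bar>y - s\<bar> * (e / 3)"
        by (simp add: field_simps)
      ultimately show "norm (S (t - y) (u y) - S (t - s) (u s) - (y - s) *\<^sub>R 0) \<le> e * norm (y - s)"
        unfolding eq real_norm_def
        using norm_triangle_ineq[of "?A + ?B" ?C] norm_triangle_ineq[of ?A ?B] by linarith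
    qed
  qed
  then have "((\<lambda>s. 0) has_integral (S (t - t) (u t) - S (t - 0) (u 0))) {0..t}"
    using t by (intro fundamental_theorem_of_calculus) auto
  then have "S (t - t) (u t) - S (t - 0) (u 0) = 0"
    by (auto dest: has_integral_unique[OF has_integral_0])
  then show ?thesis using V[OF t] by (simp add: S_0)
qed

text \<open>
  The integrals of \<open>u\<close> and of the orbit differ by a function \<open>D\<close> with \<open>D' = A D\<close> and \<open>D 0 = 0\<close>, to
  which uniqueness of solutions applies.
\<close>

lemma mild_solution_eq_orbit:
  assumes f: "f \<in> V" and uc: "continuous_on {0..} u"
    and gen: "\<And>s. 0 \<le> s \<Longrightarrow> gen (integral {0..s} u) (u s - f)" and t: "0 \<le> t"
  shows "u t = S t f"
proof -
  define D where "D s = integral {0..s} u - integral {0..s} (\<lambda>r. S r f)" for s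
  have deriv: "((\<lambda>s. integral {0..s} v) has_vector_derivative v s) (at s within {0..})"
    if v: "continuous_on {0..} v" and s: "0 \<le> s" for v :: "real \<Rightarrow> 'a" and s
  proof -
    have "((\<lambda>s. integral {0..s} v) has_vector_derivative v s) (at s within {0..s + 1})"
      using s by (intro integral_has_vector_derivative continuous_on_subset[OF v]) auto
    moreover have "at s within {0..} = at s within {0..s + 1}"
      by (rule at_within_nhd[of s "{..<s + 1}"]) auto
    ultimately show ?thesis by simp
  qed
  have "(D has_vector_derivative (u s - S s f)) (at s within {0..})" if "0 \<le> s" for s
    unfolding D_def using that
    by (intro has_vector_derivative_diff deriv uc continuous_on_orbit f)
  note D' = this
  have "gen (D s) (u s - S s f)" if "0 \<le> s" for s
    using gen_diff[OF gen[OF that] gen_integral_orbit[OF f that]] by (simp add: D_def)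
  then have "D s = S s (D 0)" if "0 \<le> s" for s
    using that by (intro solution_eq_orbit[OF D']) auto
  then have D0: "D s = 0" if "0 \<le> s" for s using that S_zero by (simp add: D_def)
  have "((\<lambda>s. 0) has_vector_derivative (u t - S t f)) (at t within {0..})"
    by (rule has_vector_derivative_transform[OF _ _ D'[OF t]]) (use t D0 in auto)
  moreover have "at t within {0..} \<noteq> bot"
  proof -
    have "at_right t \<le> at t within {0..}" using t by (intro at_le) auto
    then show ?thesis using trivial_limit_at_right_real[of t] by (metis bot.extremum_uniqueI)
  qed
  ultimately have "u t - S t f = 0"
    using vector_derivative_unique_within[OF _ _ has_vector_derivative_const] by blast
  then show ?thesis by simp
qed

end

section \<open>Feller semigroups\<close>

instance bcontfun :: (metric_space, banach) banach ..

lemma C0_UNIV_iff: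
  "f \<in> C0 UNIV \<longleftrightarrow> (\<forall>e>0. \<exists>r. \<forall>x. r < \<bar>x\<bar> \<longrightarrow> \<bar>apply_bcontfun f x\<bar> < e)"
proof
  assume f: "f \<in> C0 UNIV"
  show "\<forall>e>0. \<exists>r. \<forall>x. r < \<bar>x\<bar> \<longrightarrow> \<bar>apply_bcontfun f x\<bar> < e"
  proof (intro allI impI)
    fix e :: real assume "0 < e"
    then obtain K where K: "compact K" "\<And>x. x \<notin> K \<Longrightarrow> \<bar>apply_bcontfun f x\<bar> < e"
      using f by (auto simp: C0_def)
    obtain r where "\<And>x. x \<in> K \<Longrightarrow> norm x \<le> r"
      using compact_imp_bounded[OF K(1)] unfolding bounded_iff by auto
    then have "\<forall>x. r < \<bar>x\<bar> \<longrightarrow> x \<notin> K" by force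
    then show "\<exists>r. \<forall>x. r < \<bar>x\<bar> \<longrightarrow> \<bar>apply_bcontfun f x\<bar> < e" using K(2) by blast
  qed
next
  assume *: "\<forall>e>0. \<exists>r. \<forall>x. r < \<bar>x\<bar> \<longrightarrow> \<bar>apply_bcontfun f x\<bar> < e"
  show "f \<in> C0 UNIV"
    unfolding C0_def
  proof (intro CollectI conjI allI impI)
    fix e :: real assume "0 < e"
    then obtain r where r: "\<And>x. r < \<bar>x\<bar> \<Longrightarrow> \<bar>apply_bcontfun f x\<bar> < e" using * by blast
    show "\<exists>K. compact K \<and> K \<subseteq> UNIV \<and> (\<forall>x\<in>UNIV - K. \<bar>apply_bcontfun f x\<bar> < e)"
      by (rule exI[of _ "{- r..r}"]) (auto intro!: r)
  qed simp
qed

lemma subspace_C0_UNIV: "subspace (C0 UNIV)"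
  unfolding subspace_def
proof (intro conjI ballI allI)
  show "0 \<in> C0 UNIV" by (simp add: C0_UNIV_iff)
  fix f assume f: "f \<in> C0 UNIV"
  { fix g assume g: "g \<in> C0 UNIV"
    show "f + g \<in> C0 UNIV" unfolding C0_UNIV_iff
    proof (intro allI impI)
      fix e :: real assume "0 < e"
      then obtain r1 r2 where "\<And>x. r1 < \<bar>x\<bar> \<Longrightarrow> \<bar>apply_bcontfun f x\<bar> < e / 2"
        "\<And>x. r2 < \<bar>x\<bar> \<Longrightarrow> \<bar>apply_bcontfun g x\<bar> < e / 2"
        using f[unfolded C0_UNIV_iff, rule_format, OF half_gt_zero[OF \<open>0 < e\<close>]]
          g[unfolded C0_UNIV_iff, rule_format, OF half_gt_zero[OF \<open>0 < e\<close>]] by auto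
      note r = this
      have "\<bar>apply_bcontfun (f + g) x\<bar> < e" if "max r1 r2 < \<bar>x\<bar>" for x
      proof -
        have "\<bar>apply_bcontfun f x\<bar> < e / 2" "\<bar>apply_bcontfun g x\<bar> < e / 2" using r that by auto
        then show ?thesis using abs_triangle_ineq[of "apply_bcontfun f x" "apply_bcontfun g x"]
          unfolding plus_bcontfun.rep_eq by linarith
      qed
      then show "\<exists>r. \<forall>x. r < \<bar>x\<bar> \<longrightarrow> \<bar>apply_bcontfun (f + g) x\<bar> < e" by blast
    qed }
  fix c :: real
  show "c *\<^sub>R f \<in> C0 UNIV"
  proof (cases "c = 0")
    case True then show ?thesis by (simp add: C0_UNIV_iff)
  next
    case False
    show ?thesis unfolding C0_UNIV_iff
    proof (intro allI impI)
      fix e :: real assume "0 < e"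
      then have "0 < e / \<bar>c\<bar>" using False by simp
      then obtain r where "\<And>x. r < \<bar>x\<bar> \<Longrightarrow> \<bar>apply_bcontfun f x\<bar> < e / \<bar>c\<bar>"
        using f unfolding C0_UNIV_iff by blast
      then show "\<exists>r. \<forall>x. r < \<bar>x\<bar> \<longrightarrow> \<bar>apply_bcontfun (c *\<^sub>R f) x\<bar> < e"
        using False by (intro exI[of _ r]) (auto simp: scaleR_bcontfun.rep_eq abs_mult field_simps)
    qed
  qed
qed

lemma abs_diff_le_norm_bcontfun:
  fixes f g :: "(real, real) bcontfun"
  shows "\<bar>apply_bcontfun f x - apply_bcontfun g x\<bar> \<le> norm (f - g)"
  using norm_bounded[of "f - g" x] by (simp add: minus_bcontfun.rep_eq)

lemma closed_C0_UNIV: "closed (C0 UNIV)"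
  unfolding closed_sequential_limits
proof (intro allI impI, elim conjE)
  fix F f assume F: "\<forall>n. F n \<in> C0 UNIV" "F \<longlonglongrightarrow> f"
  show "f \<in> C0 UNIV" unfolding C0_UNIV_iff
  proof (intro allI impI)
    fix e :: real assume e: "0 < e"
    obtain n where n: "dist (F n) f < e / 2"
      using F(2) half_gt_zero[OF e] unfolding lim_sequentially by blast
    obtain r where r: "\<And>x. r < \<bar>x\<bar> \<Longrightarrow> \<bar>apply_bcontfun (F n) x\<bar> < e / 2"
      using F(1) half_gt_zero[OF e] unfolding C0_UNIV_iff by blast
    have "\<bar>apply_bcontfun f x\<bar> < e" if "r < \<bar>x\<bar>" for x
      using r[OF that] n abs_diff_le_norm_bcontfun[of "F n" x f] by (simp add: dist_norm)
    then show "\<exists>r. \<forall>x. r < \<bar>x\<bar> \<longrightarrow> \<bar>apply_bcontfun f x\<bar> < e" by blast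
  qed
qed

text \<open>For a bounded interval continuity on the line already forces decay at the boundary.\<close>

lemma C0_interval: "C0 {l<..<R} = {f. \<forall>x. x \<notin> {l<..<R} \<longrightarrow> apply_bcontfun f x = 0}"
proof (intro equalityI subsetI)
  fix f :: "(real, real) bcontfun" assume f: "f \<in> {f. \<forall>x. x \<notin> {l<..<R} \<longrightarrow> apply_bcontfun f x = 0}"
  show "f \<in> C0 {l<..<R}" unfolding C0_def
  proof (intro CollectI conjI allI impI)
    fix e :: real assume e: "0 < e"
    let ?K = "{x. e \<le> \<bar>apply_bcontfun f x\<bar>}"
    have sub: "?K \<subseteq> {l<..<R}" using f e by force
    have "closed ?K" by (intro closed_Collect_le continuous_intros) auto
    moreover have "bounded ?K" by (rule bounded_subset[OF _ sub]) simp
    ultimately show "\<exists>K. compact K \<and> K \<subseteq> {l<..<R} \<and> (\<forall>x\<in>{l<..<R} - K. \<bar>apply_bcontfun f x\<bar> < e)"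
      using sub by (intro exI[of _ ?K]) (auto simp: compact_eq_bounded_closed)
  qed (use f in auto)
qed (simp add: C0_def)

lemma C0_interval_subset_C0_UNIV: "C0 {l<..<R} \<subseteq> C0 UNIV"
proof
  fix f assume f: "f \<in> C0 {l<..<R}"
  show "f \<in> C0 UNIV" unfolding C0_UNIV_iff
  proof (intro allI impI exI)
    fix e x :: real assume "0 < e" "max \<bar>l\<bar> \<bar>R\<bar> < \<bar>x\<bar>"
    then have "x \<notin> {l<..<R}" by auto
    then show "\<bar>apply_bcontfun f x\<bar> < e" using f \<open>0 < e\<close> unfolding C0_interval by simp
  qed
qed

lemma subspace_C0_interval: "subspace (C0 {l<..<R})"
  unfolding C0_interval subspace_def by (auto simp: plus_bcontfun.rep_eq scaleR_bcontfun.rep_eq)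

lemma closed_C0_interval: "closed (C0 {l<..<R})"
  unfolding closed_sequential_limits
proof (intro allI impI, elim conjE)
  fix F f assume F: "\<forall>n. F n \<in> C0 {l<..<R}" "F \<longlonglongrightarrow> f"
  have "apply_bcontfun f x = 0" if "x \<notin> {l<..<R}" for x
  proof -
    have "(\<lambda>n. apply_bcontfun (F n) x) \<longlonglongrightarrow> apply_bcontfun f x"
      by (rule tendsto_uniform_limitI[OF tendsto_bcontfun_uniform_limit[OF F(2)]]) simp
    moreover have "apply_bcontfun (F n) x = 0" for n using F(1) that by (auto simp: C0_interval)
    ultimately show ?thesis by (simp add: LIMSEQ_const_iff)
  qed
  then show "f \<in> C0 {l<..<R}" by (simp add: C0_interval)
qed

lemma C0_uniformly_continuous:
  assumes f: "f \<in> C0 UNIV" and e: "0 < e"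
  obtains d where "0 < d" "\<And>x y. \<bar>x - y\<bar> < d \<Longrightarrow> \<bar>apply_bcontfun f x - apply_bcontfun f y\<bar> < e"
proof -
  obtain r where r: "\<And>x. r < \<bar>x\<bar> \<Longrightarrow> \<bar>apply_bcontfun f x\<bar> < e / 2"
    using f half_gt_zero[OF e] unfolding C0_UNIV_iff by blast
  have "uniformly_continuous_on {- r - 1..r + 1} (apply_bcontfun f)"
    by (intro compact_uniformly_continuous) auto
  then obtain d where d: "0 < d" "\<And>x y. x \<in> {- r - 1..r + 1} \<Longrightarrow> y \<in> {- r - 1..r + 1} \<Longrightarrow>
      dist y x < d \<Longrightarrow> dist (apply_bcontfun f y) (apply_bcontfun f x) < e"
    using e unfolding uniformly_continuous_on_def by metis
  show ?thesis
  proof (rule that[of "min d 1"])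
    show "0 < min d 1" using d by simp
    fix x y assume xy: "\<bar>x - y\<bar> < min d 1"
    show "\<bar>apply_bcontfun f x - apply_bcontfun f y\<bar> < e"
    proof (cases "r < \<bar>x\<bar> \<and> r < \<bar>y\<bar>")
      case True
      then show ?thesis using r[of x] r[of y] by (auto simp: abs_if split: if_splits)
    next
      case False
      then have "x \<in> {- r - 1..r + 1}" "y \<in> {- r - 1..r + 1}" using xy by auto
      then show ?thesis using d(2)[of y x] xy by (simp add: dist_real_def)
    qed
  qed
qed

text \<open>
  The operators act on plain functions, so that transition semigroups fit without conversion; \<open>P\<close>
  below is the same family on the Banach space.
\<close>

locale feller_semigroup =
  fixes \<Omega> :: "real set" and T :: "real \<Rightarrow> (real \<Rightarrow> real) \<Rightarrow> real \<Rightarrow> real"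
  assumes subspace_C0: "subspace (C0 \<Omega>)" and closed_C0: "closed (C0 \<Omega>)"
    and T_cont: "\<And>t f. 0 \<le> t \<Longrightarrow> f \<in> C0 \<Omega> \<Longrightarrow> continuous_on UNIV (T t (apply_bcontfun f))"
    and T_bound: "\<And>t f x. 0 \<le> t \<Longrightarrow> f \<in> C0 \<Omega> \<Longrightarrow> \<bar>T t (apply_bcontfun f) x\<bar> \<le> norm f"
    and T_C0: "\<And>t f. 0 \<le> t \<Longrightarrow> f \<in> C0 \<Omega> \<Longrightarrow> Bcontfun (T t (apply_bcontfun f)) \<in> C0 \<Omega>"
    and T_add: "\<And>t f g x. 0 \<le> t \<Longrightarrow> f \<in> C0 \<Omega> \<Longrightarrow> g \<in> C0 \<Omega> \<Longrightarrow>
      T t (\<lambda>x. apply_bcontfun f x + apply_bcontfun g x) x = T t (apply_bcontfun f) x + T t (apply_bcontfun g) x"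
    and T_scale: "\<And>t f c x. 0 \<le> t \<Longrightarrow> f \<in> C0 \<Omega> \<Longrightarrow> T t (\<lambda>x. c * apply_bcontfun f x) x = c * T t (apply_bcontfun f) x"
    and T_0: "\<And>f x. f \<in> C0 \<Omega> \<Longrightarrow> T 0 (apply_bcontfun f) x = apply_bcontfun f x"
    and T_plus: "\<And>s t f x. 0 < s \<Longrightarrow> 0 < t \<Longrightarrow> f \<in> C0 \<Omega> \<Longrightarrow>
      T (s + t) (apply_bcontfun f) x = T s (T t (apply_bcontfun f)) x"
    and T_near: "\<And>f e. f \<in> C0 \<Omega> \<Longrightarrow> 0 < e \<Longrightarrow>
      \<forall>\<^sub>F t in at_right 0. \<forall>x. \<bar>T t (apply_bcontfun f) x - apply_bcontfun f x\<bar> \<le> e"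
begin

definition P :: "real \<Rightarrow> (real, real) bcontfun \<Rightarrow> (real, real) bcontfun" where
  "P t f = Bcontfun (T t (apply_bcontfun f))"

lemma apply_P: "0 \<le> t \<Longrightarrow> f \<in> C0 \<Omega> \<Longrightarrow> apply_bcontfun (P t f) x = T t (apply_bcontfun f) x"
  unfolding P_def using T_cont T_bound
  by (subst Bcontfun_inverse) (auto intro!: bcontfun_normI)

sublocale contraction_semigroup "C0 \<Omega>" P
proof
  show "subspace (C0 \<Omega>)" "closed (C0 \<Omega>)" by (fact subspace_C0 closed_C0)+
  note V = subspace_add[OF subspace_C0] subspace_scale[OF subspace_C0]
  show PV: "P t f \<in> C0 \<Omega>" if "0 \<le> t" "f \<in> C0 \<Omega>" for t f
    using T_C0[OF that] by (simp add: P_def)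
  show "P t (f + g) = P t f + P t g" if "0 \<le> t" "f \<in> C0 \<Omega>" "g \<in> C0 \<Omega>" for t f g
    using that T_add[OF that]
    by (intro bcontfun_eqI) (simp add: apply_P V plus_bcontfun.rep_eq)
  show "P t (c *\<^sub>R f) = c *\<^sub>R P t f" if "0 \<le> t" "f \<in> C0 \<Omega>" for t f c
    using that T_scale[OF that]
    by (intro bcontfun_eqI) (simp add: apply_P V scaleR_bcontfun.rep_eq)
  show "norm (P t f) \<le> norm f" if "0 \<le> t" "f \<in> C0 \<Omega>" for t f
    by (rule norm_bound) (use that T_bound in \<open>simp add: apply_P\<close>)
  show P0: "P 0 f = f" if "f \<in> C0 \<Omega>" for f
    by (rule bcontfun_eqI) (use that T_0 in \<open>simp add: apply_P\<close>)
  show "P (s + t) f = P s (P t f)" if "0 \<le> s" "0 \<le> t" "f \<in> C0 \<Omega>" for s t f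
  proof (cases "s = 0 \<or> t = 0")
    case True
    then show ?thesis using that P0 PV by auto
  next
    case False
    have "apply_bcontfun (P t f) = T t (apply_bcontfun f)" using that by (auto simp: apply_P)
    then show ?thesis
      using that False T_plus[of s t f] PV[of t f] by (intro bcontfun_eqI) (simp add: apply_P)
  qed
  show "((\<lambda>t. P t f) \<longlongrightarrow> f) (at_right 0)" if f: "f \<in> C0 \<Omega>" for f
  proof (rule tendstoI)
    fix e :: real assume "0 < e"
    then have "\<forall>\<^sub>F t in at_right 0. (\<forall>x. \<bar>T t (apply_bcontfun f) x - apply_bcontfun f x\<bar> \<le> e / 2) \<and> 0 < t"
      using T_near[OF f, of "e / 2"] eventually_at_right_less[of "0::real"] by (auto intro: eventually_conj)
    then show "\<forall>\<^sub>F t in at_right 0. dist (P t f) f < e"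
    proof eventually_elim
      case (elim t)
      then have "dist (P t f) f \<le> e / 2"
        using f by (intro dist_bound) (auto simp: apply_P dist_real_def)
      then show ?case using \<open>0 < e\<close> by simp
    qed
  qed
qed

lemma has_generator_iff: "has_generator T \<Omega> f g \<longleftrightarrow> gen f g"
proof -
  have "uniform_limit UNIV (\<lambda>t x. (T t (apply_bcontfun f) x - apply_bcontfun f x) / t) (apply_bcontfun g) (at_right 0)
     \<longleftrightarrow> ((\<lambda>t. (P t f - f) /\<^sub>R t) \<longlongrightarrow> g) (at_right 0)" if f: "f \<in> C0 \<Omega>"
  proof -
    have eq: "(T t (apply_bcontfun f) x - apply_bcontfun f x) / t = apply_bcontfun ((P t f - f) /\<^sub>R t) x"
      if "0 < t" for t x
      unfolding scaleR_bcontfun.rep_eq minus_bcontfun.rep_eq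
      using that f by (simp only: apply_P less_imp_le real_scaleR_def divide_inverse mult.commute)
    have "uniform_limit UNIV (\<lambda>t x. (T t (apply_bcontfun f) x - apply_bcontfun f x) / t) (apply_bcontfun g) (at_right 0)
      \<longleftrightarrow> uniform_limit UNIV (\<lambda>t. apply_bcontfun ((P t f - f) /\<^sub>R t)) (apply_bcontfun g) (at_right 0)"
    proof (rule uniform_limit_cong)
      show "\<forall>\<^sub>F t in at_right 0. \<forall>x\<in>UNIV. (T t (apply_bcontfun f) x - apply_bcontfun f x) / t
          = apply_bcontfun ((P t f - f) /\<^sub>R t) x"
        using eventually_at_right_less[of "0::real"] by eventually_elim (simp only: eq ball_UNIV simp_thms)
    qed simp
    also have "\<dots> \<longleftrightarrow> ((\<lambda>t. (P t f - f) /\<^sub>R t) \<longlongrightarrow> g) (at_right 0)"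
      by (rule iffI[OF uniform_limit_tendsto_bcontfun tendsto_bcontfun_uniform_limit])
    finally show ?thesis .
  qed
  then show ?thesis by (auto simp: has_generator_def gen_def)
qed

lemma generator_eq: "gen f g \<Longrightarrow> generator T \<Omega> f = g"
  unfolding generator_def has_generator_iff by (rule the_equality) (auto dest: gen_unique)

lemma generator_dom_iff: "f \<in> generator_dom T \<Omega> \<longleftrightarrow> gen f (generator T \<Omega> f)"
  unfolding generator_dom_def has_generator_iff using generator_eq by auto

end

section \<open>Running extrema of right-continuous paths with left limits\<close>

definition cadlag :: "(real \<Rightarrow> real) \<Rightarrow> bool" where
  "cadlag z \<longleftrightarrow> (\<forall>t\<ge>0. continuous (at_right t) z) \<and> (\<forall>t>0. \<exists>y. (z \<longlongrightarrow> y) (at_left t))"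

definition gmin :: "(real \<Rightarrow> real) \<Rightarrow> real \<Rightarrow> nat \<Rightarrow> real" where
  "gmin z t n = Min ((\<lambda>k. z (real k * t / real n)) ` {..n})"

text \<open>
  For a path that is right-continuous with left limits this is the infimum over \<open>{0..t}\<close>; the limit
  over finite grids makes it a random variable.
\<close>

definition rinf :: "(real \<Rightarrow> real) \<Rightarrow> real \<Rightarrow> real" where
  "rinf z t = lim (gmin z t)"

definition rsup :: "(real \<Rightarrow> real) \<Rightarrow> real \<Rightarrow> real" where
  "rsup z t = - rinf (\<lambda>s. - z s) t"

lemma cadlag_uminus: "cadlag z \<Longrightarrow> cadlag (\<lambda>s. - z s)"
  unfolding cadlag_def by (blast intro: continuous_minus tendsto_minus)

lemma cadlag_shift: assumes z: "cadlag z" and s: "0 \<le> s" shows "cadlag (\<lambda>r. z (s + r) - z s)"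
  unfolding cadlag_def
proof (intro conjI allI impI)
  fix t :: real assume t: "0 \<le> t"
  have "(z \<longlongrightarrow> z (s + t)) (at_right (s + t))"
    using z s t by (auto simp: cadlag_def continuous_within)
  then have "((\<lambda>r. z (r + s)) \<longlongrightarrow> z (s + t)) (at_right t)"
    by (simp add: filterlim_at_right_to_0[of _ _ "s + t"] filterlim_at_right_to_0[of _ _ t] add.assoc add.commute add.left_commute)
  then show "continuous (at_right t) (\<lambda>r. z (s + r) - z s)"
    by (auto simp: continuous_within add.commute intro!: tendsto_intros)
next
  fix t :: real assume t: "0 < t"
  then have "0 < s + t" using s by simp
  then obtain y where "(z \<longlongrightarrow> y) (at_left (s + t))"
    using z unfolding cadlag_def by blast
  then have "((\<lambda>r. z (s + r)) \<longlongrightarrow> y) (at_left t)"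
    unfolding filterlim_at_left_to_right filterlim_at_right_to_0[of _ _ "- (s + t)"]
      filterlim_at_right_to_0[of _ _ "- t"] by (simp add: algebra_simps)
  then show "\<exists>y. ((\<lambda>r. z (s + r) - z s) \<longlongrightarrow> y) (at_left t)"
    by (auto intro!: tendsto_intros)
qed

lemma cadlag_right:
  assumes "cadlag z" "0 \<le> t" "open U" "z t \<in> U"
  obtains d where "0 < d" "\<And>v. t \<le> v \<Longrightarrow> v < t + d \<Longrightarrow> z v \<in> U"
proof -
  have "(z \<longlongrightarrow> z t) (at_right t)" using assms by (auto simp: cadlag_def continuous_within)
  then have "\<forall>\<^sub>F v in at_right t. z v \<in> U" using assms by (intro topological_tendstoD)
  then obtain b where b: "t < b" "\<And>v. t < v \<Longrightarrow> v < b \<Longrightarrow> z v \<in> U"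
    unfolding eventually_at_right_field by auto
  show ?thesis
  proof (rule that[of "b - t"])
    fix v assume "t \<le> v" "v < t + (b - t)"
    then show "z v \<in> U" using b assms by (cases "v = t") auto
  qed (use b in auto)
qed

text \<open>
  Near a time \<open>x\<close> the path is bounded on the right by right-continuity and on the left by its left
  limit; compactness of \<open>{0..t}\<close> makes the bound global.
\<close>

lemma cadlag_bounded: assumes z: "cadlag z" and "0 \<le> t" shows "\<exists>B. \<forall>u\<in>{0..t}. \<bar>z u\<bar> \<le> B"
proof -
  have "(\<exists>B. \<forall>u\<in>{0..t} \<inter> {a..b}. \<bar>z u\<bar> \<le> B)" if "a \<le> b" for a b
    using that
  proof (induction a b rule: Bolzano)
    case (trans a b c)
    then obtain B C where BC: "\<forall>u\<in>{0..t} \<inter> {a..b}. \<bar>z u\<bar> \<le> B" "\<forall>u\<in>{0..t} \<inter> {b..c}. \<bar>z u\<bar> \<le> C" by blast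
    have "\<bar>z u\<bar> \<le> max B C" if "u \<in> {0..t} \<inter> {a..c}" for u
    proof (cases "u \<le> b")
      case True
      then have "\<bar>z u\<bar> \<le> B" using that BC(1) by auto
      then show ?thesis by simp
    next
      case False
      then have "\<bar>z u\<bar> \<le> C" using that BC(2) by auto
      then show ?thesis by simp
    qed
    then show ?case by blast
  next
    case (local x)
    have right: "\<exists>d>0. \<forall>v. 0 \<le> v \<longrightarrow> x \<le> v \<longrightarrow> v < x + d \<longrightarrow> \<bar>z v\<bar> \<le> \<bar>z x\<bar> + 1" if "0 \<le> x"
    proof -
      obtain d where d: "0 < d" "\<And>v. x \<le> v \<Longrightarrow> v < x + d \<Longrightarrow> z v \<in> {z x - 1<..<z x + 1}"
        using cadlag_right[OF z \<open>0 \<le> x\<close>, of "{z x - 1<..<z x + 1}"] by auto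
      have "\<bar>z v\<bar> \<le> \<bar>z x\<bar> + 1" if "x \<le> v" "v < x + d" for v using d(2)[OF that] by (simp add: abs_le_iff) linarith
      then show ?thesis using d(1) by blast
    qed
    have left: "\<exists>d>0. \<exists>B. \<forall>v. 0 \<le> v \<longrightarrow> v < x \<longrightarrow> x - d < v \<longrightarrow> \<bar>z v\<bar> \<le> B" if "0 < x"
    proof -
      obtain y where "(z \<longlongrightarrow> y) (at_left x)" using z \<open>0 < x\<close> unfolding cadlag_def by blast
      then have "\<forall>\<^sub>F v in at_left x. dist (z v) y < 1" by (rule tendstoD) simp
      then obtain c where c: "c < x" "\<And>v. c < v \<Longrightarrow> v < x \<Longrightarrow> dist (z v) y < 1"
        unfolding eventually_at_left_field by auto
      have "\<bar>z v\<bar> \<le> \<bar>y\<bar> + 1" if "v < x" "x - (x - c) < v" for v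
        using c(2)[of v] that by (auto simp: dist_real_def abs_if split: if_splits)
      then show ?thesis using c(1) by (intro exI[of _ "x - c"]) auto
    qed
    consider "x < 0" | "x = 0" | "0 < x" by linarith
    then show ?case
    proof cases
      case 1
      then have "{0..t} \<inter> {a..b} = {}" if "a \<le> x \<and> x \<le> b \<and> b - a < - x" for a b using that by auto
      then show ?thesis using 1 by (intro exI[of _ "- x"]) auto
    next
      case 2
      obtain d where d: "0 < d" "\<And>v. 0 \<le> v \<Longrightarrow> x \<le> v \<Longrightarrow> v < x + d \<Longrightarrow> \<bar>z v\<bar> \<le> \<bar>z x\<bar> + 1"
        using right 2 by auto
      have "\<forall>u\<in>{0..t} \<inter> {a..b}. \<bar>z u\<bar> \<le> \<bar>z x\<bar> + 1" if "a \<le> x \<and> x \<le> b \<and> b - a < d" for a b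
        using d(2) that 2 by auto
      then show ?thesis using d(1) by (intro exI[of _ d]) blast
    next
      case 3
      obtain d1 where d1: "d1 > 0" "\<And>v. 0 \<le> v \<Longrightarrow> x \<le> v \<Longrightarrow> v < x + d1 \<Longrightarrow> \<bar>z v\<bar> \<le> \<bar>z x\<bar> + 1"
        using right 3 by auto
      obtain d2 B where d2: "d2 > 0" "\<And>v. 0 \<le> v \<Longrightarrow> v < x \<Longrightarrow> x - d2 < v \<Longrightarrow> \<bar>z v\<bar> \<le> B"
        using left 3 by auto
      have "\<forall>u\<in>{0..t} \<inter> {a..b}. \<bar>z u\<bar> \<le> max (\<bar>z x\<bar> + 1) B"
        if "a \<le> x \<and> x \<le> b \<and> b - a < min d1 d2" for a b
      proof
        fix u assume u: "u \<in> {0..t} \<inter> {a..b}"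
        show "\<bar>z u\<bar> \<le> max (\<bar>z x\<bar> + 1) B"
          using d1(2)[of u] d2(2)[of u] u that by (cases "x \<le> u") auto
      qed
      then show ?thesis using d1 d2 by (intro exI[of _ "min d1 d2"]) auto
    qed
  qed
  from this[of 0 t] show ?thesis using assms by simp
qed

text \<open>
  By right-continuity a visit to an open set lasts for some time, unless it takes place at the end
  point \<open>t\<close>, which belongs to every grid.
\<close>

lemma grid_hits:
  assumes z: "cadlag z" and u: "0 \<le> u" "u \<le> t" and "open U" "z u \<in> U"
  shows "\<forall>\<^sub>F n in sequentially. \<exists>k\<le>n. z (real k * t / real n) \<in> U"
proof (cases "u = t")
  case True
  show ?thesis
    using eventually_gt_at_top[of 0]
  proof eventually_elim
    case (elim n) then show ?case using True assms by (intro exI[of _ n]) auto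
  qed
next
  case False
  then have ut: "u < t" "0 < t" using u by auto
  obtain d where d: "0 < d" "\<And>v. u \<le> v \<Longrightarrow> v < u + d \<Longrightarrow> z v \<in> U"
    using cadlag_right[OF z u(1) assms(4,5)] by blast
  have "\<forall>\<^sub>F n in sequentially. t / d < real n"
    using filterlim_real_sequentially by (simp add: filterlim_at_top_dense)
  then show ?thesis
  proof eventually_elim
    case (elim n)
    have n: "0 < real n" using elim d ut by (metis divide_pos_pos less_trans)
    let ?k = "nat \<lceil>u * real n / t\<rceil>"
    have k: "u * real n / t \<le> real ?k" "real ?k < u * real n / t + 1"
      using u n ut by (auto simp: ceiling_less_iff) linarith+
    have "u \<le> real ?k * t / real n" using k(1) n ut by (simp add: field_simps)
    moreover have "real ?k * t / real n < u + t / real n" using k(2) n ut by (simp add: field_simps)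
    moreover have "t / real n < d" using elim n d by (simp add: field_simps)
    moreover have "?k \<le> n"
    proof -
      have "u * real n / t \<le> real n" using ut n u by (simp add: field_simps)
      then show ?thesis by (simp add: ceiling_le_iff nat_le_iff)
    qed
    ultimately show ?case using d(2) by (intro exI[of _ ?k]) auto
  qed
qed

lemma grid_mem: assumes "0 \<le> t" "k \<le> n" shows "real k * t / real n \<in> {0..t}"
proof (cases "n = 0")
  case False
  have "real k * t \<le> real n * t" using assms by (intro mult_right_mono) auto
  then show ?thesis using False assms by (auto simp: field_simps)
qed (use assms in auto)

lemma cadlag_bdd_below: "cadlag z \<Longrightarrow> 0 \<le> t \<Longrightarrow> bdd_below (z ` {0..t})"
  using cadlag_bounded[of z t] by (force intro: bdd_belowI2 simp: abs_le_iff minus_le_iff)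

lemma gmin_tendsto:
  assumes z: "cadlag z" and t: "0 \<le> t"
  shows "gmin z t \<longlonglongrightarrow> Inf (z ` {0..t})"
proof (rule order_tendstoI)
  fix a assume a: "a < Inf (z ` {0..t})"
  have "a < gmin z t n" for n
    unfolding gmin_def
    using grid_mem[OF t] by (subst Min_gr_iff)
      (auto intro!: less_le_trans[OF a] cInf_lower cadlag_bdd_below[OF z t])
  then show "\<forall>\<^sub>F n in sequentially. a < gmin z t n" by simp
next
  fix a assume "Inf (z ` {0..t}) < a"
  then obtain u where u: "u \<in> {0..t}" "z u < a"
    using cInf_lessD[of "z ` {0..t}" a] t by auto
  have "\<forall>\<^sub>F n in sequentially. \<exists>k\<le>n. z (real k * t / real n) \<in> {..<a}"
    by (rule grid_hits[OF z]) (use u in auto)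
  then show "\<forall>\<^sub>F n in sequentially. gmin z t n < a"
    by eventually_elim (auto simp: gmin_def Min_less_iff)
qed

lemma rinf_eq_Inf: "cadlag z \<Longrightarrow> 0 \<le> t \<Longrightarrow> rinf z t = Inf (z ` {0..t})"
  unfolding rinf_def by (rule limI[OF gmin_tendsto])

lemma gmin_tendsto_rinf: "cadlag z \<Longrightarrow> 0 \<le> t \<Longrightarrow> gmin z t \<longlonglongrightarrow> rinf z t"
  using gmin_tendsto rinf_eq_Inf by metis

lemma rinf_le: "cadlag z \<Longrightarrow> 0 \<le> u \<Longrightarrow> u \<le> t \<Longrightarrow> rinf z t \<le> z u"
  by (auto simp: rinf_eq_Inf intro!: cInf_lower cadlag_bdd_below)

lemma rinf_greatest:
  "cadlag z \<Longrightarrow> 0 \<le> t \<Longrightarrow> (\<And>u. 0 \<le> u \<Longrightarrow> u \<le> t \<Longrightarrow> c \<le> z u) \<Longrightarrow> c \<le> rinf z t"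
  by (auto simp: rinf_eq_Inf intro!: cInf_greatest)

lemma rinf_lessE:
  assumes "cadlag z" "0 \<le> t" "rinf z t < c"
  obtains u where "0 \<le> u" "u \<le> t" "z u < c"
  using rinf_greatest[OF assms(1,2), of c] assms(3) by force

lemma rsup_ge: "cadlag z \<Longrightarrow> 0 \<le> u \<Longrightarrow> u \<le> t \<Longrightarrow> z u \<le> rsup z t"
  using rinf_le[OF cadlag_uminus, of z u t] by (simp add: rsup_def)

lemma rsup_gtE:
  assumes "cadlag z" "0 \<le> t" "c < rsup z t"
  obtains u where "0 \<le> u" "u \<le> t" "c < z u"
  using rinf_lessE[OF cadlag_uminus[OF assms(1)] assms(2), of "- c"] assms(3)
  by (auto simp: rsup_def)

lemma rinf_mono: "cadlag z \<Longrightarrow> 0 \<le> s \<Longrightarrow> s \<le> t \<Longrightarrow> rinf z t \<le> rinf z s"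
  by (auto intro!: rinf_greatest rinf_le)

lemma rinf_split:
  assumes z: "cadlag z" and "0 \<le> s" "0 \<le> t"
  shows "rinf z (s + t) = min (rinf z s) (z s + rinf (\<lambda>r. z (s + r) - z s) t)"
proof (rule antisym)
  note z' = cadlag_shift[OF z assms(2)]
  have "rinf z (s + t) - z s \<le> rinf (\<lambda>r. z (s + r) - z s) t"
    using assms by (intro rinf_greatest z') (auto intro!: rinf_le)
  then show "rinf z (s + t) \<le> min (rinf z s) (z s + rinf (\<lambda>r. z (s + r) - z s) t)"
    using rinf_mono[OF z, of s "s + t"] assms by auto
  show "min (rinf z s) (z s + rinf (\<lambda>r. z (s + r) - z s) t) \<le> rinf z (s + t)"
  proof (rule rinf_greatest[OF z])
    fix u assume u: "0 \<le> u" "u \<le> s + t"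
    show "min (rinf z s) (z s + rinf (\<lambda>r. z (s + r) - z s) t) \<le> z u"
    proof (cases "u \<le> s")
      case True then show ?thesis using rinf_le[OF z, of u s] u by auto
    next
      case False
      then show ?thesis using rinf_le[OF z', of "u - s" t] u by (auto simp: min_le_iff_disj)
    qed
  qed (use assms in auto)
qed

lemma rinf_near_0:
  assumes z: "cadlag z" "z 0 = 0" and e: "0 < e"
  obtains d where "0 < d" "\<And>t. 0 \<le> t \<Longrightarrow> t < d \<Longrightarrow> - e < rinf z t \<and> rinf z t \<le> 0"
proof -
  obtain d where d: "0 < d" "\<And>v. 0 \<le> v \<Longrightarrow> v < 0 + d \<Longrightarrow> z v \<in> {- (e / 2)<..}"
    using cadlag_right[OF z(1), of 0 "{- (e / 2)<..}"] z e by auto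
  show ?thesis
  proof (rule that[OF d(1)])
    fix t assume t: "0 \<le> t" "t < d"
    have "- (e / 2) \<le> rinf z t"
      by (rule rinf_greatest[OF z(1)]) (use t d(2) in \<open>auto intro: less_imp_le\<close>)
    then show "- e < rinf z t \<and> rinf z t \<le> 0" using rinf_le[OF z(1), of 0 t] z t e by auto
  qed
qed

lemma rsup_near_0:
  assumes z: "cadlag z" "z 0 = 0" and e: "0 < e"
  obtains d where "0 < d" "\<And>t. 0 \<le> t \<Longrightarrow> t < d \<Longrightarrow> 0 \<le> rsup z t \<and> rsup z t < e"
proof -
  obtain d where d: "0 < d" "\<And>t. 0 \<le> t \<Longrightarrow> t < d \<Longrightarrow> - e < rinf (\<lambda>s. - z s) t \<and> rinf (\<lambda>s. - z s) t \<le> 0"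
    using rinf_near_0[OF cadlag_uminus[OF z(1)], of e] z e by auto
  show ?thesis
    by (rule that[OF d(1)]) (use d(2) in \<open>simp add: rsup_def minus_less_iff\<close>)
qed

section \<open>Levy processes\<close>

lemma gmin_measurable:
  assumes "\<And>s. 0 \<le> s \<Longrightarrow> W s \<in> borel_measurable M" "0 \<le> t"
  shows "(\<lambda>\<omega>. gmin (\<lambda>s. W s \<omega>) t n) \<in> borel_measurable M"
  unfolding gmin_def using assms by (intro borel_measurable_Min) auto

lemma rinf_measurable:
  assumes "\<And>s. 0 \<le> s \<Longrightarrow> W s \<in> borel_measurable M" "0 \<le> t"
  shows "(\<lambda>\<omega>. rinf (\<lambda>s. W s \<omega>) t) \<in> borel_measurable M"
  unfolding rinf_def using gmin_measurable[OF assms] by (intro borel_measurable_lim_metric)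

lemma rsup_measurable:
  assumes "\<And>s. 0 \<le> s \<Longrightarrow> W s \<in> borel_measurable M" "0 \<le> t"
  shows "(\<lambda>\<omega>. rsup (\<lambda>s. W s \<omega>) t) \<in> borel_measurable M"
  unfolding rsup_def using assms by (intro borel_measurable_uminus rinf_measurable) auto

lemma (in prob_space) indep_var_integral:
  fixes g :: "'b \<times> 'b \<Rightarrow> real"
  assumes ind: "indep_var N V K Y" and g: "g \<in> borel_measurable (N \<Otimes>\<^sub>M K)"
    and bound: "\<And>p. \<bar>g p\<bar> \<le> B"
  shows "(LINT \<omega>|M. g (V \<omega>, Y \<omega>)) = (LINT \<omega>|M. LINT \<omega>'|M. g (V \<omega>, Y \<omega>'))"
proof -
  note rv [measurable] = indep_var_rv1[OF ind] indep_var_rv2[OF ind]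
  have eq: "distr M N V \<Otimes>\<^sub>M distr M K Y = distr M (N \<Otimes>\<^sub>M K) (\<lambda>\<omega>. (V \<omega>, Y \<omega>))"
    using ind by (simp add: indep_var_distribution_eq)
  interpret V: prob_space "distr M N V" by (rule prob_space_distr) fact
  interpret Y: prob_space "distr M K Y" by (rule prob_space_distr) fact
  interpret VY: pair_prob_space "distr M N V" "distr M K Y" ..
  have g': "g \<in> borel_measurable (distr M N V \<Otimes>\<^sub>M distr M K Y)" using g by simp
  have int: "integrable (distr M N V \<Otimes>\<^sub>M distr M K Y) g"
    using bound g' by (intro VY.integrable_const_bound[of _ B]) auto
  have "(LINT \<omega>|M. g (V \<omega>, Y \<omega>)) = (LINT p|distr M (N \<Otimes>\<^sub>M K) (\<lambda>\<omega>. (V \<omega>, Y \<omega>)). g p)"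
    using g by (subst integral_distr) auto
  also have "\<dots> = (LINT v|distr M N V. LINT y|distr M K Y. g (v, y))"
    unfolding eq[symmetric] by (rule VY.integral_fst'[OF int, symmetric])
  also have "\<dots> = (LINT \<omega>|M. LINT y|distr M K Y. g (V \<omega>, y))"
    using g by (subst integral_distr) auto
  also have "\<dots> = (LINT \<omega>|M. LINT \<omega>'|M. g (V \<omega>, Y \<omega>'))"
  proof (rule Bochner_Integration.integral_cong[OF refl])
    fix \<omega> assume "\<omega> \<in> space M"
    then have [measurable]: "V \<omega> \<in> space N" by (rule measurable_space[OF rv(1)])
    have "(\<lambda>y. g (V \<omega>, y)) \<in> borel_measurable K" using g by measurable
    then show "(LINT y|distr M K Y. g (V \<omega>, y)) = (LINT \<omega>'|M. g (V \<omega>, Y \<omega>'))"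
      by (subst integral_distr) auto
  qed
  finally show ?thesis .
qed

lemma (in prob_space) prob_tendsto:
  assumes A: "\<And>n::nat. A n \<in> events" "B \<in> events"
    and ev: "AE \<omega> in M. \<forall>\<^sub>F n in sequentially. \<omega> \<in> A n \<longleftrightarrow> \<omega> \<in> B"
  shows "(\<lambda>n. prob (A n)) \<longlonglongrightarrow> prob B"
proof -
  have "(\<lambda>n. LINT \<omega>|M. indicator (A n) \<omega> :: real) \<longlonglongrightarrow> (LINT \<omega>|M. indicator B \<omega>)"
  proof (rule integral_dominated_convergence[where w = "\<lambda>_. 1"])
    show "AE \<omega> in M. (\<lambda>n. indicator (A n) \<omega> :: real) \<longlonglongrightarrow> indicator B \<omega>"
      using ev
    proof eventually_elim
      case (elim \<omega>)
      then have "\<forall>\<^sub>F n in sequentially. indicator (A n) \<omega> = (indicator B \<omega> :: real)"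
        by eventually_elim (simp add: indicator_def)
      then show ?case by (rule tendsto_eventually)
    qed
  qed (use A in \<open>auto simp: indicator_def\<close>)
  then show ?thesis using A by simp
qed

locale levy =
  fixes M :: "'w measure" and Z :: "real \<Rightarrow> 'w \<Rightarrow> real"
  assumes levy: "levy_process M Z"
begin

sublocale prob_space M using levy by (simp add: levy_process_def)

lemma Z_measurable [measurable]: "0 \<le> t \<Longrightarrow> Z t \<in> borel_measurable M"
  using levy by (simp add: levy_process_def)

lemma AE_Z_0: "AE \<omega> in M. Z 0 \<omega> = 0"
  using levy by (simp add: levy_process_def)

lemma AE_cadlag: "AE \<omega> in M. cadlag (\<lambda>s. Z s \<omega>)"
  using levy by (simp add: levy_process_def cadlag_def)

abbreviation "lo \<omega> \<equiv> rinf (\<lambda>s. Z s \<omega>)"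
abbreviation "hi \<omega> \<equiv> rsup (\<lambda>s. Z s \<omega>)"

lemma distr_increment:
  "0 \<le> s \<Longrightarrow> 0 \<le> h \<Longrightarrow> distr M borel (\<lambda>\<omega>. Z (s + h) \<omega> - Z s \<omega>) = distr M borel (Z h)"
  using levy by (simp add: levy_process_def)

lemma indep_increments:
  fixes \<sigma> :: "nat \<Rightarrow> real"
  assumes "0 \<le> \<sigma> 0" "\<And>i. i < n \<Longrightarrow> \<sigma> i < \<sigma> (Suc i)"
  shows "indep_vars (\<lambda>_. borel) (\<lambda>i \<omega>. Z (\<sigma> (Suc i)) \<omega> - Z (\<sigma> i) \<omega>) {..<n}"
  using levy assms unfolding levy_process_def by blast

text \<open>
  Past and future of the time \<open>\<sigma> n\<close> along a grid: both are partial sums of disjoint blocks of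
  increments. As \<open>Z 0\<close> vanishes only almost surely, it is subtracted.
\<close>

lemma indep_blocks:
  assumes \<sigma>: "strict_mono \<sigma>" "\<sigma> (0::nat) = 0"
  shows "indep_var (PiM {..n} (\<lambda>_. borel)) (\<lambda>\<omega>. \<lambda>k\<in>{..n}. Z (\<sigma> k) \<omega> - Z 0 \<omega>)
    (PiM {..m} (\<lambda>_. borel)) (\<lambda>\<omega>. \<lambda>k\<in>{..m}. Z (\<sigma> (n + k)) \<omega> - Z (\<sigma> n) \<omega>)"
proof -
  define X where "X i \<omega> = Z (\<sigma> (Suc i)) \<omega> - Z (\<sigma> i) \<omega>" for i \<omega>
  define S where "S p q x = (\<lambda>k\<in>{..q}. \<Sum>i=p..<p+k. x i)" for p q :: nat and x :: "nat \<Rightarrow> real"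
  have S: "S p q \<in> PiM {p..<p+q} (\<lambda>_. borel) \<rightarrow>\<^sub>M PiM {..q} (\<lambda>_. borel)" for p q
    unfolding S_def by (intro measurable_restrict borel_measurable_sum measurable_component_singleton) auto
  have sums: "S p q \<circ> (\<lambda>\<omega>. restrict (\<lambda>i. X i \<omega>) {p..<p+q}) = (\<lambda>\<omega>. \<lambda>k\<in>{..q}. Z (\<sigma> (p + k)) \<omega> - Z (\<sigma> p) \<omega>)" for p q
  proof
    fix \<omega>
    have "(\<Sum>i=p..<p+k. restrict (\<lambda>i. X i \<omega>) {p..<p+q} i) = Z (\<sigma> (p + k)) \<omega> - Z (\<sigma> p) \<omega>" if "k \<le> q" for k
    proof -
      have "(\<Sum>i=p..<p+k. restrict (\<lambda>i. X i \<omega>) {p..<p+q} i) = (\<Sum>i=p..<p+k. X i \<omega>)"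
        using that by (intro sum.cong) auto
      also have "\<dots> = Z (\<sigma> (p + k)) \<omega> - Z (\<sigma> p) \<omega>"
        unfolding X_def by (rule sum_Suc_diff') simp
      finally show ?thesis .
    qed
    then show "(S p q \<circ> (\<lambda>\<omega>. restrict (\<lambda>i. X i \<omega>) {p..<p+q})) \<omega> = (\<lambda>k\<in>{..q}. Z (\<sigma> (p + k)) \<omega> - Z (\<sigma> p) \<omega>)"
      unfolding S_def o_def by (intro restrict_ext) auto
  qed
  have "indep_vars (\<lambda>_. borel) X {..<n + m}"
    unfolding X_def using \<sigma> by (intro indep_increments) (auto simp: strict_mono_Suc_iff)
  then have "indep_var (PiM {0..<0+n} (\<lambda>_. borel)) (\<lambda>\<omega>. restrict (\<lambda>i. X i \<omega>) {0..<0+n})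
      (PiM {n..<n+m} (\<lambda>_. borel)) (\<lambda>\<omega>. restrict (\<lambda>i. X i \<omega>) {n..<n+m})"
    by (rule indep_var_restrict) auto
  from indep_var_compose[OF this S S] show ?thesis
    unfolding sums using \<sigma> by simp
qed

text \<open>
  Tested only at the times of a grid \<open>\<sigma>\<close>, the killed process is a Markov chain in discrete time, whose
  transition operator over a step of length \<open>h\<close> is \<open>stepE D h\<close>.
\<close>

definition chainE :: "real set \<Rightarrow> (nat \<Rightarrow> real) \<Rightarrow> nat \<Rightarrow> (real \<Rightarrow> real) \<Rightarrow> real \<Rightarrow> real" where
  "chainE D \<sigma> n g x = (LINT \<omega>|M. (\<Prod>k\<le>n. indicator D (x + Z (\<sigma> k) \<omega>)) * g (x + Z (\<sigma> n) \<omega>))"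

definition stepE :: "real set \<Rightarrow> real \<Rightarrow> (real \<Rightarrow> real) \<Rightarrow> real \<Rightarrow> real" where
  "stepE D h g x = (LINT \<omega>|M. indicator D (x + Z h \<omega>) * g (x + Z h \<omega>))"

lemma prod_indicator_bound: "\<bar>\<Prod>k\<in>A. indicator D (f k) :: real\<bar> \<le> 1"
  by (simp add: abs_prod) (intro prod_le_1, auto simp: indicator_def)

lemma abs_integral_le:
  assumes "\<And>\<omega>. \<bar>F \<omega>\<bar> \<le> (B::real)" "0 \<le> B" shows "\<bar>LINT \<omega>|M. F \<omega>\<bar> \<le> B"
proof (cases "integrable M F")
  case True
  have "\<bar>LINT \<omega>|M. F \<omega>\<bar> \<le> (LINT \<omega>|M. \<bar>F \<omega>\<bar>)" by simp
  also have "\<dots> \<le> (LINT \<omega>|M. B)" using True assms by (intro integral_mono) auto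
  finally show ?thesis by (simp add: prob_space)
qed (use assms in \<open>simp add: not_integrable_integral_eq\<close>)

lemma stepE_bound: "(\<And>x. \<bar>g x\<bar> \<le> B) \<Longrightarrow> 0 \<le> B \<Longrightarrow> \<bar>stepE D h g x\<bar> \<le> B"
  unfolding stepE_def by (intro abs_integral_le) (auto simp: indicator_def)

lemma chainE_bound: assumes "\<And>x. \<bar>g x\<bar> \<le> B" "0 \<le> B" shows "\<bar>chainE D \<sigma> n g x\<bar> \<le> B"
  unfolding chainE_def
proof (intro abs_integral_le)
  fix \<omega>
  have "\<bar>(\<Prod>k\<le>n. indicator D (x + Z (\<sigma> k) \<omega>)) * g (x + Z (\<sigma> n) \<omega>)\<bar> \<le> 1 * B"
    unfolding abs_mult by (intro mult_mono prod_indicator_bound assms) auto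
  then show "\<bar>(\<Prod>k\<le>n. indicator D (x + Z (\<sigma> k) \<omega>)) * g (x + Z (\<sigma> n) \<omega>)\<bar> \<le> B" by simp
qed fact

lemma stepE_measurable:
  assumes [measurable]: "g \<in> borel_measurable borel" "D \<in> sets borel" and "0 \<le> h"
  shows "stepE D h g \<in> borel_measurable borel"
proof -
  have [measurable]: "Z h \<in> borel_measurable M" using assms by simp
  show ?thesis unfolding stepE_def by measurable
qed

lemma chainE_Suc:
  assumes \<sigma>: "strict_mono \<sigma>" "\<sigma> 0 = 0"
    and g [measurable]: "g \<in> borel_measurable borel" and D [measurable]: "D \<in> sets borel"
    and B: "\<And>x. \<bar>g x\<bar> \<le> B"
  shows "chainE D \<sigma> (Suc n) g x = chainE D \<sigma> n (stepE D (\<sigma> (Suc n) - \<sigma> n) g) x"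
proof -
  have \<sigma>pos: "0 \<le> \<sigma> k" for k using \<sigma> strict_mono_less_eq[OF \<sigma>(1), of 0 k] by simp
  have inc: "\<sigma> n < \<sigma> (Suc n)" using \<sigma> by (simp add: strict_mono_Suc_iff)
  have [measurable]: "Z (\<sigma> k) \<in> borel_measurable M" for k using \<sigma>pos by simp
  define N where "N = PiM {..n} (\<lambda>_. borel :: real measure)"
  define V where "V \<omega> = (\<lambda>k\<in>{..n}. Z (\<sigma> k) \<omega> - Z 0 \<omega>)" for \<omega>
  define K where "K = PiM {..1::nat} (\<lambda>_. borel :: real measure)"
  define Y where "Y \<omega> = (\<lambda>k\<in>{..1}. Z (\<sigma> (n + k)) \<omega> - Z (\<sigma> n) \<omega>)" for \<omega>
  define G where "G p = (\<Prod>k\<le>n. indicator D (x + fst p k)) *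
    (indicator D (x + fst p n + snd p 1) * g (x + fst p n + snd p 1))" for p :: "(nat \<Rightarrow> real) \<times> (nat \<Rightarrow> real)"
  have comp [measurable]: "(\<lambda>p. fst p k) \<in> borel_measurable (N \<Otimes>\<^sub>M K)" if "k \<in> {..n}" for k
    unfolding N_def using that by measurable
  have [measurable]: "(\<lambda>p. snd p 1) \<in> borel_measurable (N \<Otimes>\<^sub>M K)"
    unfolding K_def by measurable
  have B0: "0 \<le> B" using B[of 0] by linarith
  have "(\<lambda>p. fst p n) \<in> borel_measurable (N \<Otimes>\<^sub>M K)" by (rule comp) simp
  then have Gm: "G \<in> borel_measurable (N \<Otimes>\<^sub>M K)"
    unfolding G_def by (intro borel_measurable_times borel_measurable_prod) measurable
  have Gb: "\<bar>G p\<bar> \<le> B" for p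
  proof -
    have "\<bar>indicator D (x + fst p n + snd p 1) * g (x + fst p n + snd p 1)\<bar> \<le> B"
      using B B0 by (auto simp: indicator_def)
    then have "\<bar>G p\<bar> \<le> 1 * B"
      unfolding G_def abs_mult[of "prod _ _"] by (intro mult_mono prod_indicator_bound) auto
    then show ?thesis by simp
  qed
  have ind: "indep_var N V K Y"
    unfolding N_def K_def V_def Y_def by (rule indep_blocks[OF \<sigma>])
  have "chainE D \<sigma> (Suc n) g x = (LINT \<omega>|M. G (V \<omega>, Y \<omega>))"
    unfolding chainE_def
  proof (rule integral_cong_AE)
    show "(\<lambda>\<omega>. G (V \<omega>, Y \<omega>)) \<in> borel_measurable M"
      using Gm indep_var_rv1[OF ind] indep_var_rv2[OF ind] by measurable
    show "AE \<omega> in M. (\<Prod>k\<le>Suc n. indicator D (x + Z (\<sigma> k) \<omega>)) * g (x + Z (\<sigma> (Suc n)) \<omega>) = G (V \<omega>, Y \<omega>)"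
      using AE_Z_0 by eventually_elim (simp add: G_def V_def Y_def algebra_simps)
  qed measurable
  also have "\<dots> = (LINT \<omega>|M. LINT \<omega>'|M. G (V \<omega>, Y \<omega>'))"
    by (rule indep_var_integral[OF ind Gm Gb])
  also have "\<dots> = (LINT \<omega>|M. (\<Prod>k\<le>n. indicator D (x + V \<omega> k)) * stepE D (\<sigma> (Suc n) - \<sigma> n) g (x + V \<omega> n))"
  proof (rule Bochner_Integration.integral_cong[OF refl])
    fix \<omega>
    let ?h = "\<lambda>y. indicator D (x + V \<omega> n + y) * g (x + V \<omega> n + y)"
    have h: "?h \<in> borel_measurable borel" by measurable
    have "(LINT \<omega>'|M. ?h (Y \<omega>' 1)) = (LINT y|distr M borel (\<lambda>\<omega>. Z (\<sigma> n + (\<sigma> (Suc n) - \<sigma> n)) \<omega> - Z (\<sigma> n) \<omega>). ?h y)"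
      using h by (subst integral_distr) (auto simp: Y_def)
    also have "\<dots> = (LINT y|distr M borel (Z (\<sigma> (Suc n) - \<sigma> n)). ?h y)"
      using distr_increment[of "\<sigma> n" "\<sigma> (Suc n) - \<sigma> n"] \<sigma>pos inc by simp
    also have "\<dots> = stepE D (\<sigma> (Suc n) - \<sigma> n) g (x + V \<omega> n)"
      unfolding stepE_def using h inc by (subst integral_distr) auto
    finally show "(LINT \<omega>'|M. G (V \<omega>, Y \<omega>')) = (\<Prod>k\<le>n. indicator D (x + V \<omega> k)) * stepE D (\<sigma> (Suc n) - \<sigma> n) g (x + V \<omega> n)"
      by (simp add: G_def)
  qed
  also have "\<dots> = chainE D \<sigma> n (stepE D (\<sigma> (Suc n) - \<sigma> n) g) x"
    unfolding chainE_def
  proof (rule integral_cong_AE)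
    have [measurable]: "stepE D (\<sigma> (Suc n) - \<sigma> n) g \<in> borel_measurable borel"
      using inc by (intro stepE_measurable) auto
    show "AE \<omega> in M. (\<Prod>k\<le>n. indicator D (x + V \<omega> k)) * stepE D (\<sigma> (Suc n) - \<sigma> n) g (x + V \<omega> n)
      = (\<Prod>k\<le>n. indicator D (x + Z (\<sigma> k) \<omega>)) * stepE D (\<sigma> (Suc n) - \<sigma> n) g (x + Z (\<sigma> n) \<omega>)"
      using AE_Z_0 by eventually_elim (simp add: V_def)
    have "(\<lambda>\<omega>. V \<omega> k) \<in> borel_measurable M" if "k \<le> n" for k
      using that unfolding V_def by simp
    then show "(\<lambda>\<omega>. (\<Prod>k\<le>n. indicator D (x + V \<omega> k)) * stepE D (\<sigma> (Suc n) - \<sigma> n) g (x + V \<omega> n)) \<in> borel_measurable M"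
    proof (intro borel_measurable_times borel_measurable_prod)
      have [measurable]: "(\<lambda>\<omega>. V \<omega> n) \<in> borel_measurable M"
        using \<open>\<And>k. k \<le> n \<Longrightarrow> (\<lambda>\<omega>. V \<omega> k) \<in> borel_measurable M\<close> by simp
      show "(\<lambda>\<omega>. stepE D (\<sigma> (Suc n) - \<sigma> n) g (x + V \<omega> n)) \<in> borel_measurable M" by measurable
      fix k assume "k \<in> {..n}"
      then have [measurable]: "(\<lambda>\<omega>. V \<omega> k) \<in> borel_measurable M"
        using \<open>\<And>k. k \<le> n \<Longrightarrow> (\<lambda>\<omega>. V \<omega> k) \<in> borel_measurable M\<close> by simp
      show "(\<lambda>\<omega>. indicator D (x + V \<omega> k) :: real) \<in> borel_measurable M" by measurable
    qed
    show "(\<lambda>\<omega>. (\<Prod>k\<le>n. indicator D (x + Z (\<sigma> k) \<omega>)) * stepE D (\<sigma> (Suc n) - \<sigma> n) g (x + Z (\<sigma> n) \<omega>)) \<in> borel_measurable M"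
      by measurable
  qed
  finally show ?thesis .
qed

text \<open>
  The Markov property of the chain. The common grid point \<open>\<sigma> n\<close> is tested twice, which is harmless for
  an indicator.
\<close>

lemma chainE_append:
  assumes \<sigma>: "strict_mono \<sigma>" "\<sigma> 0 = 0"
    and "g \<in> borel_measurable borel" and D: "D \<in> sets borel" and "\<And>x. \<bar>g x\<bar> \<le> B"
  shows "chainE D \<sigma> (n + m) g x = chainE D \<sigma> n (chainE D (\<lambda>k. \<sigma> (n + k) - \<sigma> n) m g) x"
  using assms(3,5)
proof (induction m arbitrary: g)
  case 0
  have "(LINT \<omega>'|M. indicator D (y + Z 0 \<omega>') * g (y + Z 0 \<omega>')) = (LINT \<omega>'|M. indicator D y * g y)" for y
    using 0 D AE_Z_0 by (intro integral_cong_AE) auto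
  then have start: "chainE D (\<lambda>k. \<sigma> (n + k) - \<sigma> n) 0 g = (\<lambda>y. indicator D y * g y)"
    by (auto simp: chainE_def prob_space)
  show ?case
    unfolding start unfolding chainE_def
    by (rule Bochner_Integration.integral_cong) (auto simp: indicator_def)
next
  case (Suc m)
  have mono: "\<sigma> i < \<sigma> j" if "i < j" for i j using \<sigma>(1) that by (simp add: strict_mono_def)
  let ?h = "\<sigma> (Suc (n + m)) - \<sigma> (n + m)"
  have B0: "0 \<le> B" using Suc.prems(2)[of 0] by linarith
  have sg: "stepE D ?h g \<in> borel_measurable borel" "\<And>x. \<bar>stepE D ?h g x\<bar> \<le> B"
    using Suc.prems D B0 mono[of "n + m" "Suc (n + m)"] by (auto intro!: stepE_measurable stepE_bound)
  have \<sigma>': "strict_mono (\<lambda>k. \<sigma> (n + k) - \<sigma> n)" "\<sigma> (n + 0) - \<sigma> n = 0"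
    using mono by (auto simp: strict_mono_def)
  have "chainE D \<sigma> (n + Suc m) g x = chainE D \<sigma> (n + m) (stepE D ?h g) x"
    using chainE_Suc[OF \<sigma> Suc.prems(1) D Suc.prems(2)] by simp
  also have "\<dots> = chainE D \<sigma> n (chainE D (\<lambda>k. \<sigma> (n + k) - \<sigma> n) m (stepE D ?h g)) x"
    by (rule Suc.IH[OF sg])
  also have "chainE D (\<lambda>k. \<sigma> (n + k) - \<sigma> n) m (stepE D ?h g) = chainE D (\<lambda>k. \<sigma> (n + k) - \<sigma> n) (Suc m) g"
    using chainE_Suc[OF \<sigma>' Suc.prems(1) D Suc.prems(2)] by (auto simp: fun_eq_iff)
  finally show ?case .
qed

text \<open>By right-continuity at \<open>0\<close> both extrema tend to \<open>0\<close> with \<open>t\<close>, almost surely.\<close>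

lemma prob_oscillation:
  assumes d: "0 < d"
  shows "((\<lambda>t. \<P>(\<omega> in M. \<not> (- d < lo \<omega> t \<and> hi \<omega> t < d))) \<longlongrightarrow> 0) (at_right 0)"
  unfolding tendsto_at_iff_sequentially
proof (intro allI impI)
  fix X :: "nat \<Rightarrow> real" assume X: "\<forall>i. X i \<in> {0<..} - {0}" "X \<longlonglongrightarrow> 0"
  let ?A = "\<lambda>t. {\<omega> \<in> space M. \<not> (- d < lo \<omega> t \<and> hi \<omega> t < d)}"
  have Xpos: "0 < X i" for i using X(1) by auto
  have [measurable]: "(\<lambda>\<omega>. lo \<omega> (X i)) \<in> borel_measurable M"
    "(\<lambda>\<omega>. hi \<omega> (X i)) \<in> borel_measurable M" for i
    using Xpos[of i] by (auto intro!: rinf_measurable rsup_measurable)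
  have A [measurable]: "?A (X i) \<in> sets M" for i by measurable
  have "(\<lambda>i. prob (?A (X i))) \<longlonglongrightarrow> prob {}"
  proof (rule prob_tendsto)
    show "AE \<omega> in M. \<forall>\<^sub>F i in sequentially. \<omega> \<in> ?A (X i) \<longleftrightarrow> \<omega> \<in> {}"
      using AE_cadlag AE_Z_0
    proof eventually_elim
      case (elim \<omega>)
      obtain d1 where d1: "0 < d1" "\<And>t. 0 \<le> t \<Longrightarrow> t < d1 \<Longrightarrow> - d < lo \<omega> t \<and> lo \<omega> t \<le> 0"
        using rinf_near_0[OF elim d] by blast
      obtain d2 where d2: "0 < d2" "\<And>t. 0 \<le> t \<Longrightarrow> t < d2 \<Longrightarrow> 0 \<le> hi \<omega> t \<and> hi \<omega> t < d"
        using rsup_near_0[OF elim d] by blast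
      have "\<forall>\<^sub>F i in sequentially. X i < min d1 d2"
        using X(2) d1 d2 by (intro order_tendstoD) auto
      then show ?case
        by eventually_elim (use d1 d2 Xpos in \<open>auto simp: less_imp_le\<close>)
    qed
  qed (use A in auto)
  then show "((\<lambda>t. prob (?A t)) \<circ> X) \<longlonglongrightarrow> 0" by (simp add: o_def)
qed

text \<open>
  One estimate serves for strong continuity of the free and of the killed semigroup. The threshold in
  \<open>t\<close> is uniform in \<open>F\<close> and \<open>c\<close>, hence in the starting point.
\<close>

lemma expectation_near_start:
  fixes d e B :: real
  assumes "0 < d" "0 < e" "0 \<le> B"
  shows "\<forall>\<^sub>F t in at_right 0. \<forall>F c. F \<in> borel_measurable M \<longrightarrow> (\<forall>\<omega>. \<bar>F \<omega>\<bar> \<le> B) \<longrightarrow> \<bar>c\<bar> \<le> B \<longrightarrow>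
    (AE \<omega> in M. - d < lo \<omega> t \<and> hi \<omega> t < d \<longrightarrow> \<bar>F \<omega> - c\<bar> \<le> e / 2) \<longrightarrow>
    \<bar>(LINT \<omega>|M. F \<omega>) - c\<bar> \<le> e"
proof -
  let ?A = "\<lambda>t. {\<omega> \<in> space M. \<not> (- d < lo \<omega> t \<and> hi \<omega> t < d)}"
  have "0 < e / (4 * (B + 1))" using assms by simp
  then have "\<forall>\<^sub>F t in at_right 0. prob (?A t) < e / (4 * (B + 1))"
    using prob_oscillation[OF assms(1)] by (intro order_tendstoD)
  then show ?thesis using eventually_at_right_less[of "0::real"]
  proof eventually_elim
    case (elim t)
    show ?case
    proof (intro allI impI)
      fix F :: "'w \<Rightarrow> real" and c
      assume F [measurable]: "F \<in> borel_measurable M" and FB: "\<forall>\<omega>. \<bar>F \<omega>\<bar> \<le> B" and c: "\<bar>c\<bar> \<le> B"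
        and close: "AE \<omega> in M. - d < lo \<omega> t \<and> hi \<omega> t < d \<longrightarrow> \<bar>F \<omega> - c\<bar> \<le> e / 2"
      have [measurable]: "(\<lambda>\<omega>. lo \<omega> t) \<in> borel_measurable M"
        "(\<lambda>\<omega>. hi \<omega> t) \<in> borel_measurable M"
        using elim by (auto intro!: rinf_measurable rsup_measurable)
      have A [measurable]: "?A t \<in> sets M" by measurable
      have intA: "integrable M (indicator (?A t) :: 'w \<Rightarrow> real)"
        using A by (intro integrable_const_bound[of _ 1]) auto
      have intF: "integrable M F" using FB by (intro integrable_const_bound[of _ B]) auto
      have "(LINT \<omega>|M. F \<omega>) - c = (LINT \<omega>|M. F \<omega> - c)"
        using intF by (simp add: prob_space)
      also have "\<bar>\<dots>\<bar> \<le> (LINT \<omega>|M. \<bar>F \<omega> - c\<bar>)" by simp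
      also have "\<dots> \<le> (LINT \<omega>|M. e / 2 + 2 * B * indicator (?A t) \<omega>)"
      proof (rule integral_mono_AE)
        show "AE \<omega> in M. \<bar>F \<omega> - c\<bar> \<le> e / 2 + 2 * B * indicator (?A t) \<omega>"
          using close AE_space
        proof eventually_elim
          case (elim \<omega>)
          have "\<bar>F \<omega> - c\<bar> \<le> 2 * B" using FB[rule_format, of \<omega>] c by (auto simp: abs_le_iff)
          then show ?case using elim assms by (auto simp: indicator_def)
        qed
      next
        show "integrable M (\<lambda>\<omega>. e / 2 + 2 * B * indicator (?A t) \<omega>)"
          using intA by (intro Bochner_Integration.integrable_add integrable_mult_right) auto
      qed (use intF in auto)
      also have "\<dots> = e / 2 + 2 * B * prob (?A t)"
        using Bochner_Integration.integral_add[OF integrable_const[of "e / 2"] integrable_mult_right[OF intA, of "2 * B"]] A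
        by (simp add: prob_space)
      also have "2 * B * prob (?A t) \<le> 2 * B * (e / (4 * (B + 1)))"
        using elim assms by (intro mult_left_mono) auto
      also have "\<dots> \<le> e / 2" using assms by (simp add: field_simps)
      finally show "\<bar>(LINT \<omega>|M. F \<omega>) - c\<bar> \<le> e" by simp
    qed
  qed
qed

lemma levy_near:
  assumes f: "f \<in> C0 UNIV" and e: "0 < e"
  shows "\<forall>\<^sub>F t in at_right 0. \<forall>x. \<bar>levy_semigroup M Z t (apply_bcontfun f) x - apply_bcontfun f x\<bar> \<le> e"
proof -
  obtain d where d: "0 < d" "\<And>x y. \<bar>x - y\<bar> < d \<Longrightarrow> \<bar>apply_bcontfun f x - apply_bcontfun f y\<bar> < e / 2"
    using C0_uniformly_continuous[OF f, of "e / 2"] e by auto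
  show ?thesis
    using expectation_near_start[OF d(1) e norm_ge_zero[of f]] eventually_at_right_less[of "0::real"]
  proof (rule eventually_elim2)
    fix t :: real
    assume elim: "\<forall>F c. F \<in> borel_measurable M \<longrightarrow> (\<forall>\<omega>. \<bar>F \<omega>\<bar> \<le> norm f) \<longrightarrow> \<bar>c\<bar> \<le> norm f \<longrightarrow>
      (AE \<omega> in M. - d < lo \<omega> t \<and> hi \<omega> t < d \<longrightarrow> \<bar>F \<omega> - c\<bar> \<le> e / 2) \<longrightarrow>
      \<bar>(LINT \<omega>|M. F \<omega>) - c\<bar> \<le> e" and "0 < t"
    show "\<forall>x. \<bar>levy_semigroup M Z t (apply_bcontfun f) x - apply_bcontfun f x\<bar> \<le> e"
    proof
      fix x
      have "AE \<omega> in M. - d < lo \<omega> t \<and> hi \<omega> t < d \<longrightarrow>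
          \<bar>apply_bcontfun f (x + Z t \<omega>) - apply_bcontfun f x\<bar> \<le> e / 2"
        using AE_cadlag
      proof eventually_elim
        case (elim \<omega>)
        then show ?case using rinf_le[of "\<lambda>s. Z s \<omega>" t t] rsup_ge[of "\<lambda>s. Z s \<omega>" t t] \<open>0 < t\<close>
            d(2)[of "x + Z t \<omega>" x] by (auto intro: less_imp_le)
      qed
      moreover have "(\<lambda>\<omega>. apply_bcontfun f (x + Z t \<omega>)) \<in> borel_measurable M"
      proof -
        have [measurable]: "apply_bcontfun f \<in> borel_measurable borel"
          by (rule borel_measurable_continuous_onI) simp
        have "0 \<le> t" using \<open>0 < t\<close> by simp
        then show ?thesis by measurable
      qed
      moreover have "\<bar>apply_bcontfun f y\<bar> \<le> norm f" for y using norm_bounded[of f y] by simp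
      ultimately show "\<bar>levy_semigroup M Z t (apply_bcontfun f) x - apply_bcontfun f x\<bar> \<le> e"
        unfolding levy_semigroup_def using elim by simp
    qed
  qed
qed

lemma apply_bcontfun_measurable: "apply_bcontfun (f :: (real, real) bcontfun) \<in> borel_measurable borel"
  by (rule borel_measurable_continuous_onI) simp

lemma abs_apply_bcontfun_le: "\<bar>apply_bcontfun f x\<bar> \<le> norm f" for f :: "(real, real) bcontfun"
  using norm_bounded[of f x] by simp

lemma levy_semigroup_plus:
  assumes "0 < s" "0 < t"
  shows "levy_semigroup M Z (s + t) (apply_bcontfun f) x = levy_semigroup M Z s (levy_semigroup M Z t (apply_bcontfun f)) x"
proof -
  define \<sigma> where "\<sigma> k = (if k = 0 then 0 else s + t * (real k - 1))" for k
  have \<sigma>: "strict_mono \<sigma>" "\<sigma> 0 = 0"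
    unfolding strict_mono_Suc_iff \<sigma>_def using assms by auto
  have val: "\<sigma> 1 = s" "\<sigma> 2 = s + t" "\<sigma> (1 + 1) - \<sigma> 1 = t" by (simp_all add: \<sigma>_def)
  have "chainE UNIV \<sigma> (1 + 1) (apply_bcontfun f) x =
      chainE UNIV \<sigma> 1 (chainE UNIV (\<lambda>k. \<sigma> (1 + k) - \<sigma> 1) 1 (apply_bcontfun f)) x"
    by (rule chainE_append[OF \<sigma> apply_bcontfun_measurable _ abs_apply_bcontfun_le]) simp
  then show ?thesis
    unfolding chainE_def levy_semigroup_def val one_add_one by simp
qed

lemma feller_levy: "feller_semigroup UNIV (levy_semigroup M Z)"
proof
  show "subspace (C0 UNIV)" "closed (C0 UNIV)" by (fact subspace_C0_UNIV closed_C0_UNIV)+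
  fix t :: real and f :: "(real, real) bcontfun"
  note [measurable] = apply_bcontfun_measurable
  have int: "integrable M (\<lambda>\<omega>. apply_bcontfun f (x + Z t \<omega>))" if "0 \<le> t" for t x and f :: "(real, real) bcontfun"
    using that by (intro integrable_const_bound[of _ "norm f"]) (auto simp: abs_apply_bcontfun_le)
  show bound: "\<bar>levy_semigroup M Z t (apply_bcontfun f) x\<bar> \<le> norm f" for x
    unfolding levy_semigroup_def by (intro abs_integral_le) (auto simp: abs_apply_bcontfun_le)
  have lim: "(\<lambda>n. levy_semigroup M Z t (apply_bcontfun f) (X n)) \<longlonglongrightarrow> (LINT \<omega>|M. h \<omega>)"
    if "0 \<le> t" "h \<in> borel_measurable M" "\<And>\<omega>. (\<lambda>n. apply_bcontfun f (X n + Z t \<omega>)) \<longlonglongrightarrow> h \<omega>" for X h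
    unfolding levy_semigroup_def
    by (rule integral_dominated_convergence[where w = "\<lambda>_. norm f"])
      (use that in \<open>auto simp: abs_apply_bcontfun_le\<close>)
  have isCont: "isCont (apply_bcontfun f) x" for x
    by (rule continuous_on_interior[OF continuous_on_apply_bcontfun[of UNIV f]]) simp
  show cont: "continuous_on UNIV (levy_semigroup M Z t (apply_bcontfun f))" if t: "0 \<le> t"
    unfolding continuous_on_eq_continuous_at[OF open_UNIV] continuous_at_sequentially
  proof (intro ballI allI impI)
    fix x X assume X: "X \<longlonglongrightarrow> (x::real)"
    have "(\<lambda>n. levy_semigroup M Z t (apply_bcontfun f) (X n)) \<longlonglongrightarrow> levy_semigroup M Z t (apply_bcontfun f) x"
      unfolding levy_semigroup_def[of M Z t _ x]
      by (rule lim[OF t]) (use t X in \<open>auto intro!: isCont_tendsto_compose[OF isCont] tendsto_intros\<close>)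
    then show "(levy_semigroup M Z t (apply_bcontfun f) \<circ> X) \<longlonglongrightarrow> levy_semigroup M Z t (apply_bcontfun f) x"
      by (simp add: o_def)
  qed
  show "Bcontfun (levy_semigroup M Z t (apply_bcontfun f)) \<in> C0 UNIV" if t: "0 \<le> t" and f: "f \<in> C0 UNIV"
  proof -
    have "Bcontfun (levy_semigroup M Z t (apply_bcontfun f)) \<in> C0 UNIV \<longleftrightarrow>
      (\<forall>e>0. \<exists>r. \<forall>x. r < \<bar>x\<bar> \<longrightarrow> \<bar>levy_semigroup M Z t (apply_bcontfun f) x\<bar> < e)"
      unfolding C0_UNIV_iff
      by (subst Bcontfun_inverse) (use cont[OF t] bound in \<open>auto intro!: bcontfun_normI\<close>)
    also have "\<dots>"
    proof (rule ccontr)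
      assume "\<not> ?thesis"
      then obtain e where e: "0 < e" "\<And>r. \<exists>x. r < \<bar>x\<bar> \<and> e \<le> \<bar>levy_semigroup M Z t (apply_bcontfun f) x\<bar>"
        by (auto simp: not_less)
      then have "\<forall>n. \<exists>x. real n < \<bar>x\<bar> \<and> e \<le> \<bar>levy_semigroup M Z t (apply_bcontfun f) x\<bar>" by blast
      then obtain X where X: "\<And>n. real n < \<bar>X n\<bar>" "\<And>n. e \<le> \<bar>levy_semigroup M Z t (apply_bcontfun f) (X n)\<bar>"
        by metis
      have "(\<lambda>n. levy_semigroup M Z t (apply_bcontfun f) (X n)) \<longlonglongrightarrow> (LINT \<omega>|M. 0)"
      proof (rule lim[OF t])
        fix \<omega>
        show "(\<lambda>n. apply_bcontfun f (X n + Z t \<omega>)) \<longlonglongrightarrow> 0"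
        proof (rule tendstoI)
          fix c :: real assume "0 < c"
          then obtain r where r: "\<And>x. r < \<bar>x\<bar> \<Longrightarrow> \<bar>apply_bcontfun f x\<bar> < c"
            using f unfolding C0_UNIV_iff by blast
          have "\<forall>\<^sub>F n in sequentially. r + \<bar>Z t \<omega>\<bar> < real n"
            using filterlim_real_sequentially by (simp add: filterlim_at_top_dense)
          then show "\<forall>\<^sub>F n in sequentially. dist (apply_bcontfun f (X n + Z t \<omega>)) 0 < c"
          proof eventually_elim
            case (elim n)
            have "r < \<bar>X n + Z t \<omega>\<bar>" using elim X(1)[of n] by linarith
            then show ?case using r by simp
          qed
        qed
      qed simp
      then have "(\<lambda>n. levy_semigroup M Z t (apply_bcontfun f) (X n)) \<longlonglongrightarrow> 0" by simp
      then have "\<forall>\<^sub>F n in sequentially. dist (levy_semigroup M Z t (apply_bcontfun f) (X n)) 0 < e"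
        using e(1) by (rule tendstoD)
      then obtain n where "dist (levy_semigroup M Z t (apply_bcontfun f) (X n)) 0 < e"
        by (auto simp: eventually_sequentially)
      then show False using X(2)[of n] by simp
    qed
    finally show ?thesis .
  qed
  show "levy_semigroup M Z t (\<lambda>x. apply_bcontfun f x + apply_bcontfun g x) x =
      levy_semigroup M Z t (apply_bcontfun f) x + levy_semigroup M Z t (apply_bcontfun g) x" if "0 \<le> t" for g x
    unfolding levy_semigroup_def using int[OF that] by (intro Bochner_Integration.integral_add)
  show "levy_semigroup M Z t (\<lambda>x. c * apply_bcontfun f x) x = c * levy_semigroup M Z t (apply_bcontfun f) x" for c x
    unfolding levy_semigroup_def by simp
  show "levy_semigroup M Z 0 (apply_bcontfun f) x = apply_bcontfun f x" for x
  proof -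
    have "(LINT \<omega>|M. apply_bcontfun f (x + Z 0 \<omega>)) = (LINT \<omega>|M. apply_bcontfun f x)"
      using AE_Z_0 by (intro integral_cong_AE) auto
    then show ?thesis by (simp add: levy_semigroup_def prob_space)
  qed
  show "levy_semigroup M Z (s + t) (apply_bcontfun f) x = levy_semigroup M Z s (levy_semigroup M Z t (apply_bcontfun f)) x"
    if "0 < s" "0 < t" for s x
    by (rule levy_semigroup_plus[OF that])
  show "\<forall>\<^sub>F t in at_right 0. \<forall>x. \<bar>levy_semigroup M Z t (apply_bcontfun f) x - apply_bcontfun f x\<bar> \<le> e"
    if "f \<in> C0 UNIV" "0 < e" for e
    by (rule levy_near[OF that])
qed

end

text \<open>
  Reflection carries results on running infima over to running suprema.
\<close>

lemma levy_uminus: assumes "levy M Z" shows "levy M (\<lambda>t \<omega>. - Z t \<omega>)"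
proof
  interpret levy M Z by fact
  show "levy_process M (\<lambda>t \<omega>. - Z t \<omega>)"
    unfolding levy_process_def
  proof (intro conjI allI impI)
    show "prob_space M" by (rule prob_space_axioms)
    show "(\<lambda>\<omega>. - Z t \<omega>) \<in> borel_measurable M" if "0 \<le> t" for t using that by simp
    show "AE \<omega> in M. - Z 0 \<omega> = 0" using AE_Z_0 by simp
    show "indep_vars (\<lambda>_. borel) (\<lambda>i \<omega>. - Z (s (Suc i)) \<omega> - - Z (s i) \<omega>) {..<n}"
      if "0 \<le> s 0" "\<forall>i<n. s i < s (Suc i)" for n and s :: "nat \<Rightarrow> real"
    proof -
      have "indep_vars (\<lambda>_. borel) (\<lambda>i \<omega>. - (Z (s (Suc i)) \<omega> - Z (s i) \<omega>)) {..<n}"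
        using that by (intro indep_vars_compose2[OF indep_increments, of s n "\<lambda>_ x. - x" "\<lambda>_. borel"]) auto
      then show ?thesis by simp
    qed
    show "distr M borel (\<lambda>\<omega>. - Z (s + h) \<omega> - - Z s \<omega>) = distr M borel (\<lambda>\<omega>. - Z h \<omega>)"
      if "0 \<le> s" "0 \<le> h" for s h
    proof -
      have "distr M borel (\<lambda>\<omega>. - (Z (s + h) \<omega> - Z s \<omega>)) = distr (distr M borel (\<lambda>\<omega>. Z (s + h) \<omega> - Z s \<omega>)) borel uminus"
        using that by (subst distr_distr) (auto simp: o_def)
      also have "\<dots> = distr M borel (\<lambda>\<omega>. - Z h \<omega>)"
        unfolding distr_increment[OF that] using that by (subst distr_distr) (auto simp: o_def)
      finally show ?thesis by simp
    qed
    have "AE \<omega> in M. cadlag (\<lambda>s. - Z s \<omega>)"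
      using AE_cadlag by eventually_elim (rule cadlag_uminus)
    then show "AE \<omega> in M. (\<forall>t\<ge>0. continuous (at_right t) (\<lambda>s. - Z s \<omega>)) \<and>
        (\<forall>t>0. \<exists>y. ((\<lambda>s. - Z s \<omega>) \<longlongrightarrow> y) (at_left t))"
      by (simp only: cadlag_def)
  qed
qed

section \<open>The characteristic exponent of a stable process\<close>

lemma sets_stable_jump_measure [measurable_cong, simp]: "sets (stable_jump_measure \<alpha> b c) = sets borel"
  by (simp add: stable_jump_measure_def)

locale stable_params =
  fixes \<alpha> b c :: real
  assumes \<alpha>: "1 < \<alpha>" "\<alpha> < 2" and b: "0 \<le> b" and c: "0 \<le> c" and bc: "b \<noteq> 0 \<or> c \<noteq> 0"
begin

abbreviation "\<phi> \<equiv> stable_jump_measure \<alpha> b c"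

definition jump_const :: real where "jump_const = \<alpha> * (\<alpha> - 1) / Gamma (2 - \<alpha>)"

definition \<kappa> :: "real \<Rightarrow> real" where
  "\<kappa> y = (if y > 0 then b * jump_const * y powr (- \<alpha> - 1)
     else if y < 0 then c * jump_const * \<bar>y\<bar> powr (- \<alpha> - 1) else 0)"

lemma jump_const_pos: "0 < jump_const"
  unfolding jump_const_def using \<alpha> by (intro divide_pos_pos mult_pos_pos Gamma_real_pos) auto

lemma jump_eq: "\<phi> = density lborel (\<lambda>y. ennreal (\<kappa> y))"
  unfolding stable_jump_measure_def \<kappa>_def jump_const_def ..

lemma \<kappa>_measurable [measurable]: "\<kappa> \<in> borel_measurable borel"
  unfolding \<kappa>_def by measurable

lemma \<kappa>_nonneg: "0 \<le> \<kappa> y"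
  using jump_const_pos b c by (auto simp: \<kappa>_def intro!: mult_nonneg_nonneg)

lemma integral_jump:
  fixes f :: "real \<Rightarrow> 'b::{banach, second_countable_topology}"
  assumes "f \<in> borel_measurable borel"
  shows "(LINT y|\<phi>. f y) = (LINT y|lborel. \<kappa> y *\<^sub>R f y)"
  unfolding jump_eq using assms by (intro integral_density) (auto simp: \<kappa>_nonneg)

lemma integrable_jump:
  fixes f :: "real \<Rightarrow> 'b::{banach, second_countable_topology}"
  assumes "f \<in> borel_measurable borel"
  shows "integrable \<phi> f \<longleftrightarrow> integrable lborel (\<lambda>y. \<kappa> y *\<^sub>R f y)"
  unfolding jump_eq using assms by (intro integrable_density) (auto simp: \<kappa>_nonneg)

lemma \<kappa>_scale: assumes "0 < r" shows "\<kappa> (r * y) = r powr (- \<alpha> - 1) * \<kappa> y"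
proof -
  have "r * y > 0 \<longleftrightarrow> y > 0" "r * y < 0 \<longleftrightarrow> y < 0"
    using assms by (auto simp: zero_less_mult_iff mult_less_0_iff)
  moreover have "\<bar>r * y\<bar> powr (- \<alpha> - 1) = r powr (- \<alpha> - 1) * \<bar>y\<bar> powr (- \<alpha> - 1)"
    using assms by (simp add: abs_mult powr_mult)
  ultimately show ?thesis by (auto simp: \<kappa>_def)
qed

text \<open>
  Compensated increments of smooth functions are of order \<open>y\<^sup>2\<close> for small and \<open>\<bar>y\<bar>\<close> for large
  jumps. Against the density \<open>\<bar>y\<bar> powr (- \<alpha> - 1)\<close> this leaves \<open>\<bar>y\<bar> powr (1 - \<alpha>)\<close> near \<open>0\<close>, integrable
  as \<open>\<alpha> < 2\<close>, and \<open>\<bar>y\<bar> powr (- \<alpha>)\<close> at infinity, integrable as \<open>\<alpha> > 1\<close>.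
\<close>

lemma integrable_min: "integrable \<phi> (\<lambda>y. min (y\<^sup>2) \<bar>y\<bar>)"
proof -
  define g where "g y = indicator {0..1} y * y powr (1 - \<alpha>) + indicator {1..} y * y powr (- \<alpha>)" for y :: real
  have set_int: "integrable lborel (\<lambda>y. indicator A y * y powr e)"
    if "(\<lambda>y. y powr e) integrable_on A" and [measurable]: "A \<in> sets borel" for A :: "real set" and e
  proof -
    have "(\<lambda>y. y powr e) absolutely_integrable_on A"
      by (rule nonnegative_absolutely_integrable_1[OF that(1)]) simp
    then have "integrable lebesgue (\<lambda>y. indicator A y * y powr e)"
      by (simp add: set_integrable_def)
    then show ?thesis by (subst (asm) integrable_completion) simp_all
  qed
  have "(\<lambda>y. y powr (1 - \<alpha>)) integrable_on {0..1}"
    using has_integral_powr_from_0[of "1 - \<alpha>" 1] \<alpha> by (auto intro: has_integral_integrable)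
  moreover have "(\<lambda>y. y powr (- \<alpha>)) integrable_on {1..}"
    using has_integral_powr_to_inf[of "- \<alpha>" 1] \<alpha> by (auto intro: has_integral_integrable)
  ultimately have g: "integrable lborel g"
    unfolding g_def by (intro Bochner_Integration.integrable_add set_int) auto
  have g': "integrable lborel (\<lambda>y. g (- y))"
    using g lborel_integrable_real_affine_iff[of "- 1" g 0] by simp
  have "integrable lborel (\<lambda>y. \<kappa> y *\<^sub>R min (y\<^sup>2) \<bar>y\<bar>)"
  proof (rule Bochner_Integration.integrable_bound)
    show "integrable lborel (\<lambda>y. (b + c) * jump_const * (g y + g (- y)))"
      using g g' by auto
    have key: "\<bar>y\<bar> powr (- \<alpha> - 1) * min (y\<^sup>2) \<bar>y\<bar> \<le> g y + g (- y)" if "y \<noteq> 0" for y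
    proof -
      have pos: "0 < \<bar>y\<bar>" using that by simp
      have g0: "0 \<le> g y" "0 \<le> g (- y)" by (auto simp: g_def)
      have "\<bar>y\<bar> powr (- \<alpha> - 1) * min (y\<^sup>2) \<bar>y\<bar> \<le> g \<bar>y\<bar>"
      proof (cases "\<bar>y\<bar> \<le> 1")
        case True
        have "\<bar>y\<bar> powr (- \<alpha> - 1) * y\<^sup>2 = \<bar>y\<bar> powr (- \<alpha> - 1) * \<bar>y\<bar> powr 2"
          using pos by (simp add: powr_numeral)
        also have "\<dots> = \<bar>y\<bar> powr (1 - \<alpha>)" by (subst powr_add[symmetric]) simp
        also have "\<dots> \<le> g \<bar>y\<bar>" using True by (simp add: g_def)
        finally have "\<bar>y\<bar> powr (- \<alpha> - 1) * y\<^sup>2 \<le> g \<bar>y\<bar>" .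
        moreover have "\<bar>y\<bar> powr (- \<alpha> - 1) * min (y\<^sup>2) \<bar>y\<bar> \<le> \<bar>y\<bar> powr (- \<alpha> - 1) * y\<^sup>2"
          by (intro mult_left_mono) auto
        ultimately show ?thesis by linarith
      next
        case False
        have "\<bar>y\<bar> powr (- \<alpha> - 1) * \<bar>y\<bar> = \<bar>y\<bar> powr (- \<alpha> - 1) * \<bar>y\<bar> powr 1" by simp
        also have "\<dots> = \<bar>y\<bar> powr (- \<alpha>)" by (subst powr_add[symmetric]) simp
        also have "\<dots> \<le> g \<bar>y\<bar>" using False by (simp add: g_def)
        finally have "\<bar>y\<bar> powr (- \<alpha> - 1) * \<bar>y\<bar> \<le> g \<bar>y\<bar>" .
        moreover have "\<bar>y\<bar> powr (- \<alpha> - 1) * min (y\<^sup>2) \<bar>y\<bar> \<le> \<bar>y\<bar> powr (- \<alpha> - 1) * \<bar>y\<bar>"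
          by (intro mult_left_mono) auto
        ultimately show ?thesis by linarith
      qed
      also have "g \<bar>y\<bar> \<le> g y + g (- y)" using g0 by (cases "0 \<le> y") auto
      finally show ?thesis .
    qed
    show "AE y in lborel. norm (\<kappa> y *\<^sub>R min (y\<^sup>2) \<bar>y\<bar>) \<le> norm ((b + c) * jump_const * (g y + g (- y)))"
    proof (rule AE_I2)
      fix y :: real
      have g0: "0 \<le> g y + g (- y)" by (auto simp: g_def)
      have k: "\<kappa> y \<le> (b + c) * jump_const * \<bar>y\<bar> powr (- \<alpha> - 1)"
        unfolding \<kappa>_def using b c jump_const_pos by (auto intro!: mult_right_mono)
      have m0: "0 \<le> min (y\<^sup>2) \<bar>y\<bar>" by simp
      have "\<kappa> y * min (y\<^sup>2) \<bar>y\<bar> \<le> (b + c) * jump_const * (g y + g (- y))"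
      proof (cases "y = 0")
        case False
        have "\<kappa> y * min (y\<^sup>2) \<bar>y\<bar> \<le> (b + c) * jump_const * \<bar>y\<bar> powr (- \<alpha> - 1) * min (y\<^sup>2) \<bar>y\<bar>"
          by (rule mult_right_mono[OF k m0])
        also have "\<dots> \<le> (b + c) * jump_const * (g y + g (- y))"
          unfolding mult.assoc[of "(b + c) * jump_const"] using key[OF False] b c jump_const_pos
          by (intro mult_left_mono mult_nonneg_nonneg) auto
        finally show ?thesis .
      qed (use g0 b c jump_const_pos in \<open>auto simp: \<kappa>_def intro!: mult_nonneg_nonneg\<close>)
      moreover have "0 \<le> \<kappa> y * min (y\<^sup>2) \<bar>y\<bar>" by (rule mult_nonneg_nonneg[OF \<kappa>_nonneg m0])
      ultimately show "norm (\<kappa> y *\<^sub>R min (y\<^sup>2) \<bar>y\<bar>) \<le> norm ((b + c) * jump_const * (g y + g (- y)))"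
        by simp
    qed
  qed measurable
  then show ?thesis by (subst integrable_jump) simp_all
qed

text \<open>
  The exponent of the centred process. The sign of \<open>\<xi> * y\<close> reflects that mass of the jump measure at
  \<open>y\<close> stands for jumps of size \<open>- y\<close>.
\<close>

definition \<eta>\<^sub>0 :: "real \<Rightarrow> complex" where
  "\<eta>\<^sub>0 \<xi> = (LINT y|\<phi>. iexp (- \<xi> * y) - 1 + \<i> * of_real (\<xi> * y))"

lemma iexp_second_order_bound:
  "norm (iexp (- \<xi> * y) - 1 + \<i> * of_real (\<xi> * y)) \<le> 2 * max (\<xi>\<^sup>2) \<bar>\<xi>\<bar> * min (y\<^sup>2) \<bar>y\<bar>"
proof -
  let ?N = "norm (iexp (- \<xi> * y) - 1 + \<i> * of_real (\<xi> * y))"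
  have eq: "iexp (- \<xi> * y) - (\<Sum>k\<le>1. (\<i> * of_real (- \<xi> * y)) ^ k / fact k)
      = iexp (- \<xi> * y) - 1 + \<i> * of_real (\<xi> * y)" by simp
  have "?N \<le> \<bar>- \<xi> * y\<bar> ^ Suc 1 / fact (Suc 1)"
    using iexp_approx1[of "- \<xi> * y" 1] unfolding eq .
  also have "\<dots> = \<bar>\<xi> * y\<bar>\<^sup>2 / 2" by (simp add: power2_eq_square)
  also have "\<dots> \<le> \<xi>\<^sup>2 * y\<^sup>2" by (simp add: power_mult_distrib)
  finally have 1: "?N \<le> \<xi>\<^sup>2 * y\<^sup>2" .
  have 2: "?N \<le> 2 * \<bar>\<xi>\<bar> * \<bar>y\<bar>"
    using iexp_approx2[of "- \<xi> * y" 1] unfolding eq by (simp add: abs_mult)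
  show ?thesis
  proof (cases "y\<^sup>2 \<le> \<bar>y\<bar>")
    case True
    have "\<xi>\<^sup>2 * y\<^sup>2 \<le> 2 * max (\<xi>\<^sup>2) \<bar>\<xi>\<bar> * y\<^sup>2" by (intro mult_right_mono) auto
    then show ?thesis using 1 True by (simp add: min_def)
  next
    case False
    have "2 * \<bar>\<xi>\<bar> * \<bar>y\<bar> \<le> 2 * max (\<xi>\<^sup>2) \<bar>\<xi>\<bar> * \<bar>y\<bar>" by (intro mult_right_mono) auto
    then show ?thesis using 2 False by (simp add: min_def)
  qed
qed

lemma integrable_\<eta>\<^sub>0: "integrable \<phi> (\<lambda>y. iexp (- \<xi> * y) - 1 + \<i> * of_real (\<xi> * y))"
proof (rule Bochner_Integration.integrable_bound)
  show "integrable \<phi> (\<lambda>y. 2 * max (\<xi>\<^sup>2) \<bar>\<xi>\<bar> * min (y\<^sup>2) \<bar>y\<bar>)"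
    by (intro integrable_mult_right integrable_min)
  show "AE y in \<phi>. norm (iexp (- \<xi> * y) - 1 + \<i> * of_real (\<xi> * y)) \<le> norm (2 * max (\<xi>\<^sup>2) \<bar>\<xi>\<bar> * min (y\<^sup>2) \<bar>y\<bar>)"
    using iexp_second_order_bound[of \<xi>] by (intro AE_I2) (auto simp: abs_mult intro: order.trans)
qed measurable

text \<open>
  The substitution \<open>y = r * y'\<close>, under which the jump density is homogeneous of degree \<open>- \<alpha> - 1\<close>.
\<close>

lemma \<eta>\<^sub>0_scale: assumes r: "0 < r" shows "\<eta>\<^sub>0 (r * \<xi>) = of_real (r powr \<alpha>) * \<eta>\<^sub>0 \<xi>"
proof -
  let ?F = "\<lambda>\<xi> y. iexp (- \<xi> * y) - 1 + \<i> * of_real (\<xi> * y)"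
  have "\<eta>\<^sub>0 \<xi> = (LINT y|lborel. \<kappa> y *\<^sub>R ?F \<xi> y)"
    unfolding \<eta>\<^sub>0_def by (rule integral_jump) measurable
  also have "\<dots> = \<bar>r\<bar> *\<^sub>R (LINT y|lborel. \<kappa> (0 + r * y) *\<^sub>R ?F \<xi> (0 + r * y))"
    using r by (intro lborel_integral_real_affine) auto
  also have "(LINT y|lborel. \<kappa> (0 + r * y) *\<^sub>R ?F \<xi> (0 + r * y))
      = (LINT y|lborel. (r powr (- \<alpha> - 1)) *\<^sub>R (\<kappa> y *\<^sub>R ?F (r * \<xi>) y))"
    using r unfolding add_0_left \<kappa>_scale[OF r] scaleR_scaleR
    by (intro Bochner_Integration.integral_cong refl) (simp add: mult_ac)
  also have "\<dots> = (r powr (- \<alpha> - 1)) *\<^sub>R (LINT y|lborel. \<kappa> y *\<^sub>R ?F (r * \<xi>) y)"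
    by (rule integral_scaleR_right)
  also have "(LINT y|lborel. \<kappa> y *\<^sub>R ?F (r * \<xi>) y) = \<eta>\<^sub>0 (r * \<xi>)"
    unfolding \<eta>\<^sub>0_def by (rule integral_jump[symmetric]) measurable
  finally have "\<eta>\<^sub>0 \<xi> = (\<bar>r\<bar> * r powr (- \<alpha> - 1)) *\<^sub>R \<eta>\<^sub>0 (r * \<xi>)" by simp
  also have "\<bar>r\<bar> * r powr (- \<alpha> - 1) = r powr (- \<alpha>)"
    using r powr_add[of r 1 "- \<alpha> - 1"] by simp
  finally have "\<eta>\<^sub>0 \<xi> = (r powr (- \<alpha>)) *\<^sub>R \<eta>\<^sub>0 (r * \<xi>)" .
  then have "of_real (r powr \<alpha>) * \<eta>\<^sub>0 \<xi> = of_real (r powr \<alpha> * r powr (- \<alpha>)) * \<eta>\<^sub>0 (r * \<xi>)"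
    by (simp add: scaleR_conv_of_real)
  also have "r powr \<alpha> * r powr (- \<alpha>) = 1" using r by (simp flip: powr_add)
  finally show ?thesis by simp
qed

lemma Re_\<eta>\<^sub>0_neg: "Re (\<eta>\<^sub>0 1) < 0"
proof -
  have Re: "Re (\<eta>\<^sub>0 1) = (LINT y|\<phi>. cos y - 1)"
    unfolding \<eta>\<^sub>0_def by (subst integral_Re[symmetric, OF integrable_\<eta>\<^sub>0]) (simp add: Re_exp)
  have int: "integrable \<phi> (\<lambda>y. 1 - cos y)"
    using integrable_Re[OF integrable_\<eta>\<^sub>0[of 1]] Bochner_Integration.integrable_minus[of \<phi> "\<lambda>y. cos y - 1"]
    by (simp add: Re_exp)
  have "(LINT y|\<phi>. 1 - cos y) \<noteq> 0"
  proof
    assume "(LINT y|\<phi>. 1 - cos y) = 0"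
    then have "AE y in \<phi>. 1 - cos y = 0"
      using integral_nonneg_eq_0_iff_AE[OF int] by simp
    then have ae: "AE y in lborel. 0 < ennreal (\<kappa> y) \<longrightarrow> 1 - cos y = 0"
      unfolding jump_eq by (subst (asm) AE_density) auto
    obtain l :: real where l: "\<And>y. y \<in> {l<..<l+1} \<Longrightarrow> 0 < \<kappa> y \<and> 1 - cos y \<noteq> 0"
    proof -
      have cos: "1 - cos y \<noteq> 0" if "0 < \<bar>y\<bar>" "\<bar>y\<bar> < 1" for y :: real
        using cos_monotone_0_pi[of 0 "\<bar>y\<bar>"] that pi_gt3 by auto
      show ?thesis
      proof (cases "b = 0")
        case True
        then have "0 < c" using bc c by auto
        then have "0 < \<kappa> y \<and> 1 - cos y \<noteq> 0" if "y \<in> {-1<..<-1+1}" for y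
          using jump_const_pos cos[of y] that by (auto simp: \<kappa>_def)
        then show ?thesis by (rule that)
      next
        case False
        then have "0 < b" using b by auto
        then have "0 < \<kappa> y \<and> 1 - cos y \<noteq> 0" if "y \<in> {0<..<0+1}" for y
          using jump_const_pos cos[of y] that by (auto simp: \<kappa>_def)
        then show ?thesis by (rule that)
      qed
    qed
    have "AE y in lborel. y \<notin> {l<..<l+1}"
      using ae by eventually_elim (use l in auto)
    then have "emeasure lborel {l<..<l+1} = 0"
      by (subst (asm) AE_iff_measurable[where N = "{l<..<l+1}"]) auto
    then show False by simp
  qed
  moreover have "0 \<le> (LINT y|\<phi>. 1 - cos y)" by simp
  moreover have "Re (\<eta>\<^sub>0 1) = - (LINT y|\<phi>. 1 - cos y)"
    unfolding Re by (subst integral_minus[symmetric]) simp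
  ultimately show ?thesis by linarith
qed

end

text \<open>
  Integrability of the right-hand side alone makes \<open>\<psi>\<close> continuous, then differentiable, and then
  \<open>exp (- \<eta> t) \<psi> t\<close> is constant.
\<close>

lemma exp_integral_equation:
  fixes \<psi> :: "real \<Rightarrow> complex"
  assumes eq: "\<And>t. 0 \<le> t \<Longrightarrow> ((\<lambda>s. \<eta> * \<psi> s) has_integral (\<psi> t - 1)) {0..t}" and t: "0 \<le> t"
  shows "\<psi> t = exp (\<eta> * of_real t)"
proof -
  have \<psi>_int: "\<psi> s = 1 + integral {0..s} (\<lambda>s. \<eta> * \<psi> s)" if "0 \<le> s" for s
    using integral_unique[OF eq[OF that]] by simp
  have cont: "continuous_on {0..t} \<psi>"
  proof -
    have "continuous_on {0..t} (\<lambda>s. 1 + integral {0..s} (\<lambda>s. \<eta> * \<psi> s))"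
      using eq[OF t] by (intro continuous_intros indefinite_integral_continuous_1) auto
    then show ?thesis by (rule continuous_on_eq) (use \<psi>_int in auto)
  qed
  have d: "(\<psi> has_vector_derivative \<eta> * \<psi> s) (at s within {0..t})" if s: "s \<in> {0..t}" for s
  proof -
    have "((\<lambda>s. integral {0..s} (\<lambda>s. \<eta> * \<psi> s)) has_vector_derivative \<eta> * \<psi> s) (at s within {0..t})"
      using s by (intro integral_has_vector_derivative continuous_intros cont)
    then have "((\<lambda>s. 1 + integral {0..s} (\<lambda>s. \<eta> * \<psi> s)) has_vector_derivative 0 + \<eta> * \<psi> s) (at s within {0..t})"
      by (intro has_vector_derivative_add has_vector_derivative_const)
    then show ?thesis
      using has_vector_derivative_transform[OF s, of \<psi>] \<psi>_int by auto
  qed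
  have e: "((\<lambda>s. exp (- \<eta> * of_real s)) has_vector_derivative (- \<eta> * exp (- \<eta> * of_real s))) (at s within {0..t})" for s
    by (rule has_vector_derivative_at_within, rule has_vector_derivative_real_field)
      (auto intro!: derivative_eq_intros)
  have "((\<lambda>s. exp (- \<eta> * of_real s) * \<psi> s) has_vector_derivative 0) (at s within {0..t})" if s: "s \<in> {0..t}" for s
    by (rule has_vector_derivative_eq_rhs[OF has_vector_derivative_mult[OF e d[OF s]]])
      (simp add: algebra_simps)
  then have "((\<lambda>s. 0) has_integral (exp (- \<eta> * of_real t) * \<psi> t - exp (- \<eta> * of_real 0) * \<psi> 0)) {0..t}"
    using t by (intro fundamental_theorem_of_calculus) auto
  then have "exp (- \<eta> * of_real t) * \<psi> t = \<psi> 0"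
    by (auto dest: has_integral_unique[OF has_integral_0])
  moreover have "\<psi> 0 = 1" using \<psi>_int[of 0] by simp
  ultimately have "exp (\<eta> * of_real t) * (exp (- \<eta> * of_real t) * \<psi> t) = exp (\<eta> * of_real t)" by simp
  then show ?thesis by (simp add: mult.assoc[symmetric] exp_add[symmetric])
qed

text \<open>
  The test functions approximating \<open>cos (\<xi> x + \<theta>)\<close>, which does not vanish at infinity. All bounds
  are uniform in the damping \<open>e \<le> 1\<close>.
\<close>

locale damped_cosine =
  fixes e \<xi> \<theta> :: real
  assumes e: "0 < e" "e \<le> 1"
begin

definition "F x = exp (- (e * x)\<^sup>2) * cos (\<xi> * x + \<theta>)"
definition "F' x = exp (- (e * x)\<^sup>2) * (- 2 * e\<^sup>2 * x * cos (\<xi> * x + \<theta>) - \<xi> * sin (\<xi> * x + \<theta>))"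
definition "F'' x = exp (- (e * x)\<^sup>2) *
  ((4 * e ^ 4 * x\<^sup>2 - 2 * e\<^sup>2 - \<xi>\<^sup>2) * cos (\<xi> * x + \<theta>) + 4 * e\<^sup>2 * \<xi> * x * sin (\<xi> * x + \<theta>))"
definition "D = 2 * (6 + 4 * \<bar>\<xi>\<bar> + \<xi>\<^sup>2)"

lemma F_deriv: "(F has_real_derivative F' x) (at x)"
  unfolding F_def[abs_def] F'_def
  by (auto intro!: derivative_eq_intros simp: power2_eq_square algebra_simps)

lemma F'_deriv: "(F' has_real_derivative F'' x) (at x)"
  unfolding F'_def[abs_def] F''_def
  by (auto intro!: derivative_eq_intros simp: power2_eq_square power4_eq_xxxx algebra_simps)

lemma gauss_decay: "(1 + w\<^sup>2) * exp (- w\<^sup>2) \<le> 2 / (1 + w\<^sup>2)" for w :: real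
proof -
  have *: "1 + w\<^sup>2 + (w\<^sup>2)\<^sup>2 / 2 \<le> exp (w\<^sup>2)" by (rule exp_lower_Taylor_quadratic) simp
  have "(1 + w\<^sup>2)\<^sup>2 \<le> 2 * (1 + w\<^sup>2 + (w\<^sup>2)\<^sup>2 / 2)" by (simp add: power2_eq_square algebra_simps)
  also have "\<dots> \<le> 2 * exp (w\<^sup>2)" by (intro mult_left_mono *) simp
  finally have "(1 + w\<^sup>2)\<^sup>2 \<le> 2 * exp (w\<^sup>2)" .
  moreover have "0 < 1 + w\<^sup>2" by (simp add: add_pos_nonneg)
  ultimately show ?thesis by (simp add: exp_minus field_simps power2_eq_square)
qed

lemma decay_bound:
  assumes "\<bar>h\<bar> \<le> C * (1 + (e * x)\<^sup>2)" "C \<le> 6 + 4 * \<bar>\<xi>\<bar> + \<xi>\<^sup>2"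
  shows "\<bar>exp (- (e * x)\<^sup>2) * h\<bar> \<le> D / (1 + (e * x)\<^sup>2)"
proof -
  let ?w = "(e * x)\<^sup>2"
  have pos: "0 < 1 + ?w" by (simp add: add_pos_nonneg)
  have "\<bar>exp (- ?w) * h\<bar> = exp (- ?w) * \<bar>h\<bar>" by (simp add: abs_mult)
  also have "\<dots> \<le> exp (- ?w) * ((6 + 4 * \<bar>\<xi>\<bar> + \<xi>\<^sup>2) * (1 + ?w))"
    using assms pos by (intro mult_left_mono order.trans[OF assms(1)] mult_right_mono) auto
  also have "\<dots> = (6 + 4 * \<bar>\<xi>\<bar> + \<xi>\<^sup>2) * ((1 + ?w) * exp (- ?w))" by simp
  also have "\<dots> \<le> (6 + 4 * \<bar>\<xi>\<bar> + \<xi>\<^sup>2) * (2 / (1 + ?w))"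
    by (intro mult_left_mono gauss_decay) auto
  finally show ?thesis by (simp add: D_def mult.commute)
qed

lemma ex_le: "\<bar>e * x\<bar> \<le> 1 + (e * x)\<^sup>2"
proof -
  have "0 \<le> (\<bar>e * x\<bar> - 1)\<^sup>2" by simp
  then have "2 * \<bar>e * x\<bar> \<le> 1 + (e * x)\<^sup>2" by (simp add: power2_diff)
  then show ?thesis using abs_ge_zero[of "e * x"] by linarith
qed

lemma e2x: "\<bar>e\<^sup>2 * x\<bar> \<le> 1 + (e * x)\<^sup>2"
proof -
  have "\<bar>e\<^sup>2 * x\<bar> = e * \<bar>e * x\<bar>" using e by (simp add: power2_eq_square abs_mult)
  also have "\<dots> \<le> 1 * (1 + (e * x)\<^sup>2)" using e by (intro mult_mono ex_le) auto
  finally show ?thesis by simp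
qed

lemma F_bound: "\<bar>F x\<bar> \<le> D / (1 + (e * x)\<^sup>2)"
  unfolding F_def
proof (rule decay_bound)
  have "\<bar>cos (\<xi> * x + \<theta>)\<bar> \<le> 1" by simp
  then show "\<bar>cos (\<xi> * x + \<theta>)\<bar> \<le> 1 * (1 + (e * x)\<^sup>2)" by (simp add: add_increasing2 del: abs_cos_le_one)
qed (simp add: add_increasing2)

lemma F'_bound: "\<bar>F' x\<bar> \<le> D / (1 + (e * x)\<^sup>2)"
  unfolding F'_def
proof (rule decay_bound)
  have "\<bar>- 2 * e\<^sup>2 * x * cos (\<xi> * x + \<theta>) - \<xi> * sin (\<xi> * x + \<theta>)\<bar>
      \<le> 2 * \<bar>e\<^sup>2 * x\<bar> * \<bar>cos (\<xi> * x + \<theta>)\<bar> + \<bar>\<xi>\<bar> * \<bar>sin (\<xi> * x + \<theta>)\<bar>"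
    by (rule order.trans[OF abs_triangle_ineq4]) (simp add: abs_mult)
  also have "\<dots> \<le> 2 * (1 + (e * x)\<^sup>2) * 1 + \<bar>\<xi>\<bar> * (1 + (e * x)\<^sup>2)"
  proof (intro add_mono mult_mono)
    show "\<bar>sin (\<xi> * x + \<theta>)\<bar> \<le> 1 + (e * x)\<^sup>2"
      using abs_sin_le_one[of "\<xi> * x + \<theta>"] zero_le_power2[of "e * x"] by linarith
  qed (use e2x in auto)
  finally show "\<bar>- 2 * e\<^sup>2 * x * cos (\<xi> * x + \<theta>) - \<xi> * sin (\<xi> * x + \<theta>)\<bar> \<le> (2 + \<bar>\<xi>\<bar>) * (1 + (e * x)\<^sup>2)"
    by (simp add: algebra_simps)
qed (use zero_le_power2[of \<xi>] abs_ge_zero[of \<xi>] in linarith)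

lemma F''_bound: "\<bar>F'' x\<bar> \<le> D / (1 + (e * x)\<^sup>2)"
  unfolding F''_def
proof (rule decay_bound[OF _ order.refl])
  let ?w = "(e * x)\<^sup>2"
  have e2: "e\<^sup>2 \<le> 1" using e by (simp add: power_le_one)
  have 1: "\<bar>4 * e ^ 4 * x\<^sup>2 - 2 * e\<^sup>2 - \<xi>\<^sup>2\<bar> \<le> (6 + \<xi>\<^sup>2) * (1 + ?w)"
  proof -
    have "e ^ 4 * x\<^sup>2 = e\<^sup>2 * ?w" by (simp add: power_mult_distrib power4_eq_xxxx power2_eq_square)
    also have "\<dots> \<le> ?w" using e2 mult_right_mono[of "e\<^sup>2" 1 ?w] by simp
    finally have "e ^ 4 * x\<^sup>2 \<le> ?w" .
    moreover have "0 \<le> e ^ 4 * x\<^sup>2" "0 \<le> e\<^sup>2" "0 \<le> \<xi>\<^sup>2" "0 \<le> ?w" "0 \<le> \<xi>\<^sup>2 * ?w" by simp_all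
    moreover have "(6 + \<xi>\<^sup>2) * (1 + ?w) = 6 + \<xi>\<^sup>2 + 6 * ?w + \<xi>\<^sup>2 * ?w" by (simp add: algebra_simps)
    ultimately show ?thesis using e2 unfolding abs_le_iff by linarith
  qed
  have 2: "\<bar>4 * e\<^sup>2 * \<xi> * x\<bar> \<le> 4 * \<bar>\<xi>\<bar> * (1 + ?w)"
  proof -
    have "\<bar>4 * e\<^sup>2 * \<xi> * x\<bar> = 4 * \<bar>\<xi>\<bar> * \<bar>e\<^sup>2 * x\<bar>" by (simp add: abs_mult)
    also have "\<dots> \<le> 4 * \<bar>\<xi>\<bar> * (1 + ?w)" by (intro mult_left_mono e2x) auto
    finally show ?thesis .
  qed
  have "\<bar>(4 * e ^ 4 * x\<^sup>2 - 2 * e\<^sup>2 - \<xi>\<^sup>2) * cos (\<xi> * x + \<theta>) + 4 * e\<^sup>2 * \<xi> * x * sin (\<xi> * x + \<theta>)\<bar>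
    \<le> \<bar>4 * e ^ 4 * x\<^sup>2 - 2 * e\<^sup>2 - \<xi>\<^sup>2\<bar> * \<bar>cos (\<xi> * x + \<theta>)\<bar> + \<bar>4 * e\<^sup>2 * \<xi> * x\<bar> * \<bar>sin (\<xi> * x + \<theta>)\<bar>"
    by (rule order.trans[OF abs_triangle_ineq]) (simp only: abs_mult order.refl)
  also have "\<dots> \<le> \<bar>4 * e ^ 4 * x\<^sup>2 - 2 * e\<^sup>2 - \<xi>\<^sup>2\<bar> * 1 + \<bar>4 * e\<^sup>2 * \<xi> * x\<bar> * 1"
    by (intro add_mono mult_left_mono) auto
  also have "\<dots> \<le> (6 + \<xi>\<^sup>2) * (1 + ?w) + 4 * \<bar>\<xi>\<bar> * (1 + ?w)"
    using add_mono[OF 1 2] by simp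
  also have "\<dots> = (6 + 4 * \<bar>\<xi>\<bar> + \<xi>\<^sup>2) * (1 + ?w)" by (simp add: algebra_simps)
  finally show "\<bar>(4 * e ^ 4 * x\<^sup>2 - 2 * e\<^sup>2 - \<xi>\<^sup>2) * cos (\<xi> * x + \<theta>) + 4 * e\<^sup>2 * \<xi> * x * sin (\<xi> * x + \<theta>)\<bar>
    \<le> (6 + 4 * \<bar>\<xi>\<bar> + \<xi>\<^sup>2) * (1 + ?w)" .
qed

lemma D_pos: "0 < D" by (simp add: D_def add_pos_nonneg)

lemma bound_D: "h \<le> D / (1 + (e * x)\<^sup>2) \<Longrightarrow> h \<le> D"
proof -
  assume h: "h \<le> D / (1 + (e * x)\<^sup>2)"
  have "D / (1 + (e * x)\<^sup>2) \<le> D / 1" using D_pos by (intro divide_left_mono) (auto simp: add_pos_nonneg)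
  then show "h \<le> D" using h by simp
qed

lemma C0_of_decay:
  assumes cont: "continuous_on UNIV H" and bound: "\<And>x. \<bar>H x\<bar> \<le> D / (1 + (e * x)\<^sup>2)"
  shows "Bcontfun H \<in> C0 UNIV" "apply_bcontfun (Bcontfun H) = H"
proof -
  show eq: "apply_bcontfun (Bcontfun H) = H"
    using bound_D[OF bound] by (intro Bcontfun_inverse bcontfun_normI[OF cont]) auto
  show "Bcontfun H \<in> C0 UNIV"
    unfolding C0_UNIV_iff eq
  proof (intro allI impI)
    fix d :: real assume d: "0 < d"
    have "\<bar>H x\<bar> < d" if x: "sqrt (D / d) / e < \<bar>x\<bar>" for x
    proof -
      have "sqrt (D / d) < e * \<bar>x\<bar>" using x e by (simp add: field_simps)
      then have "(sqrt (D / d))\<^sup>2 < (e * \<bar>x\<bar>)\<^sup>2"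
        using D_pos d by (intro power_strict_mono) auto
      then have "D / d < (e * x)\<^sup>2" using D_pos d by (simp add: power_mult_distrib)
      then have "D < d * (e * x)\<^sup>2" using d by (simp add: field_simps)
      then have "D < d * (1 + (e * x)\<^sup>2)" using d by (simp add: algebra_simps)
      then have "D / (1 + (e * x)\<^sup>2) < d" by (simp add: pos_divide_less_eq add_pos_nonneg)
      then show ?thesis using bound[of x] by linarith
    qed
    then show "\<exists>r. \<forall>x. r < \<bar>x\<bar> \<longrightarrow> \<bar>H x\<bar> < d" by blast
  qed
qed

lemma continuous: "continuous_on UNIV F" "continuous_on UNIV F'" "continuous_on UNIV F''"
  unfolding F_def[abs_def] F'_def[abs_def] F''_def[abs_def] by (intro continuous_intros)+

lemmas C0_F = C0_of_decay[OF continuous(1) F_bound]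
lemmas C0_F' = C0_of_decay[OF continuous(2) F'_bound]
lemmas C0_F'' = C0_of_decay[OF continuous(3) F''_bound]

lemma mvt_bound:
  fixes h h' :: "real \<Rightarrow> real"
  assumes "\<And>s. (h has_real_derivative h' s) (at s)" "\<And>s. \<bar>s\<bar> \<le> \<bar>y\<bar> \<Longrightarrow> \<bar>h' s\<bar> \<le> B"
  shows "\<bar>h y - h 0\<bar> \<le> B * \<bar>y\<bar>"
proof -
  have "norm (h y - h 0) \<le> B * norm (y - 0)"
    by (rule field_differentiable_bound[of "{- \<bar>y\<bar>..\<bar>y\<bar>}" h h'])
      (use assms in \<open>auto intro: DERIV_subset\<close>)
  then show ?thesis by simp
qed

lemma increment_bound: "\<bar>F (x - y) - F x + y * F' x\<bar> \<le> 2 * D * min (y\<^sup>2) \<bar>y\<bar>"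
proof -
  let ?g = "\<lambda>s. F (x - s) - F x + s * F' x"
  have g: "(?g has_real_derivative (F' x - F' (x - s))) (at s)" for s
    by (auto intro!: derivative_eq_intros DERIV_chain'[OF _ F_deriv])
  have "\<bar>F' x - F' (x - s)\<bar> \<le> D * \<bar>s\<bar>" for s
  proof -
    have "\<bar>F' (x - s) - F' (x - 0)\<bar> \<le> D * \<bar>s\<bar>"
    proof (rule mvt_bound[of _ "\<lambda>s. - F'' (x - s)"])
      show "((\<lambda>s. F' (x - s)) has_real_derivative - F'' (x - s)) (at s)" for s
      proof -
        have "((\<lambda>s. x - s) has_real_derivative - 1) (at s)" by (auto intro!: derivative_eq_intros)
        from DERIV_chain'[OF this F'_deriv] show ?thesis by simp
      qed
    qed (use bound_D[OF F''_bound] in auto)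
    then show ?thesis by (simp add: abs_minus_commute)
  qed
  then have "\<bar>F' x - F' (x - s)\<bar> \<le> D * \<bar>y\<bar>" if "\<bar>s\<bar> \<le> \<bar>y\<bar>" for s
    using mult_left_mono[OF that, of D] D_pos by (meson less_imp_le order.trans)
  then have "\<bar>?g y - ?g 0\<bar> \<le> (D * \<bar>y\<bar>) * \<bar>y\<bar>" by (rule mvt_bound[OF g])
  then have 1: "\<bar>?g y\<bar> \<le> 2 * D * y\<^sup>2"
    using D_pos by (simp add: power2_eq_square mult.assoc)
  have "\<bar>F' x - F' (x - s)\<bar> \<le> 2 * D" for s
    using bound_D[OF F'_bound, of x] bound_D[OF F'_bound, of "x - s"] by linarith
  then have "\<bar>?g y - ?g 0\<bar> \<le> (2 * D) * \<bar>y\<bar>" by (intro mvt_bound[OF g])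
  then have 2: "\<bar>?g y\<bar> \<le> 2 * D * \<bar>y\<bar>" by simp
  show ?thesis using 1 2 by (simp add: min_def)
qed

end

locale stable_levy = levy M Z + stable_params \<alpha> b c
  for M :: "'w measure" and Z :: "real \<Rightarrow> 'w \<Rightarrow> real" and \<alpha> b c :: real +
  fixes a :: real
  assumes stable: "stable_levy_process M Z \<alpha> a b c"
begin

interpretation free: feller_semigroup UNIV "levy_semigroup M Z" by (rule feller_levy)

definition \<eta> :: "real \<Rightarrow> complex" where
  "\<eta> \<xi> = - \<i> * of_real (a * \<xi>) + \<eta>\<^sub>0 \<xi>"

definition jump_mass :: real where "jump_mass = (LINT y|\<phi>. min (y\<^sup>2) \<bar>y\<bar>)"

lemma damped_increment_measurable:
  assumes "damped_cosine e"
  shows "(\<lambda>y. damped_cosine.F e \<xi> \<theta> (x - y) - damped_cosine.F e \<xi> \<theta> x + y * damped_cosine.F' e \<xi> \<theta> x) \<in> borel_measurable borel"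
  unfolding damped_cosine.F_def[OF assms] damped_cosine.F'_def[OF assms] by measurable

lemma stable_operator_damped:
  assumes "damped_cosine e"
  shows "stable_operator \<alpha> a b c (damped_cosine.F e \<xi> \<theta>) x = - a * damped_cosine.F' e \<xi> \<theta> x +
     (LINT y|\<phi>. damped_cosine.F e \<xi> \<theta> (x - y) - damped_cosine.F e \<xi> \<theta> x + y * damped_cosine.F' e \<xi> \<theta> x)"
proof -
  interpret damped_cosine e \<xi> \<theta> by fact
  show ?thesis by (simp add: stable_operator_def DERIV_imp_deriv[OF F_deriv])
qed

lemma stable_operator_bound:
  assumes "damped_cosine e"
  shows "\<bar>stable_operator \<alpha> a b c (damped_cosine.F e \<xi> \<theta>) x\<bar> \<le> (\<bar>a\<bar> + 2 * jump_mass) * damped_cosine.D \<xi>"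
proof -
  interpret damped_cosine e \<xi> \<theta> by fact
  let ?J = "\<lambda>y. F (x - y) - F x + y * F' x"
  have int: "integrable \<phi> (\<lambda>y. 2 * D * min (y\<^sup>2) \<bar>y\<bar>)" by (intro integrable_mult_right integrable_min)
  have J: "integrable \<phi> ?J"
    by (rule Bochner_Integration.integrable_bound[OF int])
      (use damped_increment_measurable[OF assms] in \<open>auto intro!: AE_I2 order.trans[OF increment_bound]\<close>)
  have "\<bar>LINT y|\<phi>. ?J y\<bar> \<le> (LINT y|\<phi>. \<bar>?J y\<bar>)" by simp
  also have "\<dots> \<le> (LINT y|\<phi>. 2 * D * min (y\<^sup>2) \<bar>y\<bar>)"
    using J int increment_bound by (intro integral_mono) auto
  also have "\<dots> = 2 * D * jump_mass" by (simp add: jump_mass_def)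
  finally have 1: "\<bar>LINT y|\<phi>. ?J y\<bar> \<le> 2 * D * jump_mass" .
  have "\<bar>- a * F' x\<bar> \<le> \<bar>a\<bar> * D"
    unfolding abs_mult abs_minus_cancel by (intro mult_left_mono bound_D[OF F'_bound]) auto
  then have "\<bar>- a * F' x + (LINT y|\<phi>. ?J y)\<bar> \<le> \<bar>a\<bar> * D + 2 * D * jump_mass"
    using 1 abs_triangle_ineq[of "- a * F' x" "LINT y|\<phi>. ?J y"] by linarith
  then show ?thesis unfolding stable_operator_damped[OF assms] by (simp add: algebra_simps)
qed

lemma stable_operator_tendsto:
  assumes E: "\<And>n. damped_cosine (E n)" "E \<longlonglongrightarrow> 0"
  shows "(\<lambda>n. stable_operator \<alpha> a b c (damped_cosine.F (E n) \<xi> \<theta>) x) \<longlonglongrightarrow> Re (iexp (\<xi> * x + \<theta>) * \<eta> \<xi>)"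
proof -
  have F: "(\<lambda>n. damped_cosine.F (E n) \<xi> \<theta> y) \<longlonglongrightarrow> cos (\<xi> * y + \<theta>)" for y
    unfolding damped_cosine.F_def[OF E(1)] by (auto intro!: tendsto_eq_intros E(2))
  have F': "(\<lambda>n. damped_cosine.F' (E n) \<xi> \<theta> y) \<longlonglongrightarrow> - \<xi> * sin (\<xi> * y + \<theta>)" for y
    unfolding damped_cosine.F'_def[OF E(1)] by (auto intro!: tendsto_eq_intros E(2))
  let ?J = "\<lambda>n y. damped_cosine.F (E n) \<xi> \<theta> (x - y) - damped_cosine.F (E n) \<xi> \<theta> x + y * damped_cosine.F' (E n) \<xi> \<theta> x"
  let ?L = "\<lambda>y. Re (iexp (\<xi> * x + \<theta>) * (iexp (- \<xi> * y) - 1 + \<i> * of_real (\<xi> * y)))"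
  have Leq: "?L y = cos (\<xi> * (x - y) + \<theta>) - cos (\<xi> * x + \<theta>) + y * (- \<xi> * sin (\<xi> * x + \<theta>))" for y
  proof -
    have "iexp (\<xi> * x + \<theta>) * iexp (- \<xi> * y) = iexp (\<xi> * (x - y) + \<theta>)"
      by (simp add: exp_add[symmetric] algebra_simps)
    then have "?L y = Re (iexp (\<xi> * (x - y) + \<theta>) - iexp (\<xi> * x + \<theta>) + iexp (\<xi> * x + \<theta>) * (\<i> * of_real (\<xi> * y)))"
      by (simp only: ring_distribs mult_1_right)
    then show ?thesis by (simp add: Re_exp Im_exp algebra_simps)
  qed
  have "(\<lambda>n. LINT y|\<phi>. ?J n y) \<longlonglongrightarrow> (LINT y|\<phi>. ?L y)"
  proof (rule integral_dominated_convergence[where w = "\<lambda>y. 2 * damped_cosine.D \<xi> * min (y\<^sup>2) \<bar>y\<bar>"])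
    show "integrable \<phi> (\<lambda>y. 2 * damped_cosine.D \<xi> * min (y\<^sup>2) \<bar>y\<bar>)"
      by (intro integrable_mult_right integrable_min)
    show "AE y in \<phi>. (\<lambda>n. ?J n y) \<longlonglongrightarrow> ?L y"
      unfolding Leq by (intro AE_I2 tendsto_intros F F')
    show "AE y in \<phi>. norm (?J n y) \<le> 2 * damped_cosine.D \<xi> * min (y\<^sup>2) \<bar>y\<bar>" for n
      using damped_cosine.increment_bound[OF E(1)] by auto
  qed (use damped_increment_measurable[OF E(1)] in auto)
  also have "(LINT y|\<phi>. ?L y) = Re (iexp (\<xi> * x + \<theta>) * \<eta>\<^sub>0 \<xi>)"
  proof -
    have "(LINT y|\<phi>. ?L y) = Re (LINT y|\<phi>. iexp (\<xi> * x + \<theta>) * (iexp (- \<xi> * y) - 1 + \<i> * of_real (\<xi> * y)))"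
      by (rule integral_Re[OF integrable_mult_right[OF integrable_\<eta>\<^sub>0]])
    then show ?thesis by (simp only: integral_mult_right_zero \<eta>\<^sub>0_def)
  qed
  finally have J: "(\<lambda>n. LINT y|\<phi>. ?J n y) \<longlonglongrightarrow> Re (iexp (\<xi> * x + \<theta>) * \<eta>\<^sub>0 \<xi>)" .
  have "(\<lambda>n. - a * damped_cosine.F' (E n) \<xi> \<theta> x + (LINT y|\<phi>. ?J n y))
      \<longlonglongrightarrow> - a * (- \<xi> * sin (\<xi> * x + \<theta>)) + Re (iexp (\<xi> * x + \<theta>) * \<eta>\<^sub>0 \<xi>)"
    by (intro tendsto_intros F' J)
  also have "- a * (- \<xi> * sin (\<xi> * x + \<theta>)) = Re (iexp (\<xi> * x + \<theta>) * (- \<i> * of_real (a * \<xi>)))"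
    by (simp add: Re_exp Im_exp)
  also have "\<dots> + Re (iexp (\<xi> * x + \<theta>) * \<eta>\<^sub>0 \<xi>) = Re (iexp (\<xi> * x + \<theta>) * \<eta> \<xi>)"
    unfolding \<eta>_def by (simp only: distrib_left plus_complex.sel)
  finally show ?thesis unfolding stable_operator_damped[OF E(1)] .
qed

text \<open>
  The assumption on the generator enters here, as \<open>T t f - f = \<integral> T s (L f) ds\<close> evaluated at \<open>0\<close> for
  a damped cosine \<open>f\<close>.
\<close>

lemma damped_integral_equation:
  fixes e t \<xi> \<theta> :: real
  assumes "damped_cosine e" "0 \<le> t"
  defines "g \<equiv> stable_operator \<alpha> a b c (damped_cosine.F e \<xi> \<theta>)"
  shows "((\<lambda>s. LINT \<omega>|M. g (Z s \<omega>)) has_integral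
      ((LINT \<omega>|M. damped_cosine.F e \<xi> \<theta> (Z t \<omega>)) - damped_cosine.F e \<xi> \<theta> 0)) {0..t}"
    and "g \<in> borel_measurable borel"
proof -
  interpret damped_cosine e \<xi> \<theta> by fact
  let ?f = "Bcontfun F"
  have "\<exists>g. has_generator (levy_semigroup M Z) UNIV ?f g \<and>
      (\<forall>x. apply_bcontfun g x = stable_operator \<alpha> a b c (apply_bcontfun ?f) x)"
    using stable unfolding stable_levy_process_def
    by (elim conjE allE[of _ ?f] allE[of _ "Bcontfun F'"] allE[of _ "Bcontfun F''"] impE)
      (auto simp: C0_F C0_F' C0_F'' F_deriv F'_deriv)
  then obtain h where h: "free.gen ?f h" "apply_bcontfun h = g"
    by (auto simp: free.has_generator_iff C0_F(2) g_def)
  show "g \<in> borel_measurable borel" using apply_bcontfun_measurable[of h] h by simp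
  have hC: "h \<in> C0 UNIV" using free.gen_in_V[OF h(1)] by simp
  have bl: "bounded_linear (\<lambda>f. apply_bcontfun f (0::real) :: real)"
    by (rule bounded_linear_intro[of _ 1])
      (auto simp: plus_bcontfun.rep_eq scaleR_bcontfun.rep_eq abs_apply_bcontfun_le)
  have "((\<lambda>s. apply_bcontfun (free.P s h) 0) has_integral apply_bcontfun (free.P t ?f - ?f) 0) {0..t}"
    using has_integral_linear[OF free.has_integral_orbit[OF h(1) assms(2)] bl] by (simp add: o_def)
  also have "apply_bcontfun (free.P t ?f - ?f) 0 = (LINT \<omega>|M. F (Z t \<omega>)) - F 0"
    using assms(2) by (simp add: minus_bcontfun.rep_eq free.apply_P C0_F levy_semigroup_def)
  finally have "((\<lambda>s. apply_bcontfun (free.P s h) 0) has_integral ((LINT \<omega>|M. F (Z t \<omega>)) - F 0)) {0..t}" .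
  then show "((\<lambda>s. LINT \<omega>|M. g (Z s \<omega>)) has_integral ((LINT \<omega>|M. F (Z t \<omega>)) - F 0)) {0..t}"
    by (rule has_integral_eq[rotated]) (simp add: free.apply_P hC levy_semigroup_def h(2))
qed

definition \<psi> :: "real \<Rightarrow> real \<Rightarrow> complex" where
  "\<psi> \<xi> t = (LINT \<omega>|M. iexp (\<xi> * Z t \<omega>))"

lemma expectation_phase:
  assumes "0 \<le> t"
  shows "(LINT \<omega>|M. Re (iexp (\<xi> * Z t \<omega> + \<theta>) * z)) = Re (iexp \<theta> * (z * \<psi> \<xi> t))"
proof -
  have [measurable]: "Z t \<in> borel_measurable M" using assms by simp
  have int: "integrable M (\<lambda>\<omega>. iexp (\<xi> * Z t \<omega> + \<theta>) * z)"
    by (intro integrable_mult_left integrable_const_bound[of _ 1]) (auto simp del: of_real_add of_real_mult)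
  have "(LINT \<omega>|M. Re (iexp (\<xi> * Z t \<omega> + \<theta>) * z)) = Re (LINT \<omega>|M. iexp (\<xi> * Z t \<omega> + \<theta>) * z)"
    by (rule integral_Re[OF int])
  also have "(LINT \<omega>|M. iexp (\<xi> * Z t \<omega> + \<theta>) * z) = (LINT \<omega>|M. (iexp \<theta> * z) * iexp (\<xi> * Z t \<omega>))"
    by (intro Bochner_Integration.integral_cong refl) (simp add: exp_add algebra_simps)
  also have "\<dots> = iexp \<theta> * (z * \<psi> \<xi> t)"
    by (simp add: \<psi>_def)
  finally show ?thesis .
qed

lemma phase_integral_equation:
  assumes t: "0 \<le> t"
  shows "((\<lambda>s. Re (iexp \<theta> * (\<eta> \<xi> * \<psi> \<xi> s))) has_integral Re (iexp \<theta> * (\<psi> \<xi> t - 1))) {0..t}"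
proof -
  define E where "E n = inverse (real (Suc n))" for n
  have E: "damped_cosine (E n)" for n by unfold_locales (auto simp: E_def field_simps)
  have E0: "E \<longlonglongrightarrow> 0" unfolding E_def[abs_def] by (rule LIMSEQ_inverse_real_of_nat)
  let ?F = "\<lambda>n. damped_cosine.F (E n) \<xi> \<theta>"
  let ?g = "\<lambda>n. stable_operator \<alpha> a b c (?F n)"
  let ?K = "(\<bar>a\<bar> + 2 * jump_mass) * damped_cosine.D \<xi>"
  note eq = damped_integral_equation(1)[OF E t, where \<xi> = \<xi> and \<theta> = \<theta>] and gm [measurable] = damped_integral_equation(2)[OF E t, where \<xi> = \<xi> and \<theta> = \<theta>]
  have lim_g: "(\<lambda>n. LINT \<omega>|M. ?g n (Z s \<omega>)) \<longlonglongrightarrow> Re (iexp \<theta> * (\<eta> \<xi> * \<psi> \<xi> s))" if s: "0 \<le> s" for s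
    unfolding expectation_phase[OF s, symmetric]
  proof (rule integral_dominated_convergence[where w = "\<lambda>_. ?K"])
    have [measurable]: "Z s \<in> borel_measurable M" using s by simp
    show "(\<lambda>\<omega>. Re (iexp (\<xi> * Z s \<omega> + \<theta>) * \<eta> \<xi>)) \<in> borel_measurable M" by measurable
    show "(\<lambda>\<omega>. ?g n (Z s \<omega>)) \<in> borel_measurable M" for n by measurable
    show "AE \<omega> in M. (\<lambda>n. ?g n (Z s \<omega>)) \<longlonglongrightarrow> Re (iexp (\<xi> * Z s \<omega> + \<theta>) * \<eta> \<xi>)"
      by (intro AE_I2 stable_operator_tendsto E E0)
    show "AE \<omega> in M. norm (?g n (Z s \<omega>)) \<le> ?K" for n
      using stable_operator_bound[OF E] by simp
  qed simp
  have lim_F: "(\<lambda>n. LINT \<omega>|M. ?F n (Z t \<omega>)) \<longlonglongrightarrow> Re (iexp \<theta> * (1 * \<psi> \<xi> t))"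
    unfolding expectation_phase[OF t, symmetric]
  proof (rule integral_dominated_convergence[where w = "\<lambda>_. damped_cosine.D \<xi>"])
    have [measurable]: "Z t \<in> borel_measurable M" using t by simp
    show "(\<lambda>\<omega>. Re (iexp (\<xi> * Z t \<omega> + \<theta>) * 1)) \<in> borel_measurable M" by measurable
    show "(\<lambda>\<omega>. ?F n (Z t \<omega>)) \<in> borel_measurable M" for n
      unfolding damped_cosine.F_def[OF E] by measurable
    show "AE \<omega> in M. (\<lambda>n. ?F n (Z t \<omega>)) \<longlonglongrightarrow> Re (iexp (\<xi> * Z t \<omega> + \<theta>) * 1)"
      unfolding damped_cosine.F_def[OF E] by (auto intro!: tendsto_eq_intros E0 simp: Re_exp)
    show "AE \<omega> in M. norm (?F n (Z t \<omega>)) \<le> damped_cosine.D \<xi>" for n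
      using damped_cosine.bound_D[OF E damped_cosine.F_bound[OF E]] by simp
  qed simp
  have lim_0: "(\<lambda>n. ?F n 0) \<longlonglongrightarrow> Re (iexp \<theta>)"
    unfolding damped_cosine.F_def[OF E] by (auto simp: Re_exp)
  have bound: "norm (LINT \<omega>|M. ?g n (Z s \<omega>)) \<le> ?K" for n s
    unfolding real_norm_def
    by (rule abs_integral_le) (use stable_operator_bound[OF E] order.trans[OF abs_ge_zero] in blast)+
  have dc: "(\<lambda>s. Re (iexp \<theta> * (\<eta> \<xi> * \<psi> \<xi> s))) integrable_on {0..t}"
    "(\<lambda>n. integral {0..t} (\<lambda>s. LINT \<omega>|M. ?g n (Z s \<omega>))) \<longlonglongrightarrow> integral {0..t} (\<lambda>s. Re (iexp \<theta> * (\<eta> \<xi> * \<psi> \<xi> s)))"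
    using dominated_convergence[of "\<lambda>n s. LINT \<omega>|M. ?g n (Z s \<omega>)" "{0..t}" "\<lambda>_. ?K" "\<lambda>s. Re (iexp \<theta> * (\<eta> \<xi> * \<psi> \<xi> s))"]
      eq bound lim_g by (auto simp del: of_real_mult of_real_add intro: has_integral_integrable)
  have "(\<lambda>n. integral {0..t} (\<lambda>s. LINT \<omega>|M. ?g n (Z s \<omega>))) \<longlonglongrightarrow> Re (iexp \<theta> * (1 * \<psi> \<xi> t)) - Re (iexp \<theta>)"
    unfolding integral_unique[OF eq] by (intro tendsto_diff lim_F lim_0)
  then have "integral {0..t} (\<lambda>s. Re (iexp \<theta> * (\<eta> \<xi> * \<psi> \<xi> s))) = Re (iexp \<theta> * (1 * \<psi> \<xi> t)) - Re (iexp \<theta>)"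
    using dc(2) LIMSEQ_unique by blast
  then show ?thesis
    using integrable_integral[OF dc(1)] by (simp add: right_diff_distrib)
qed

text \<open>
  The characteristic function solves \<open>\<psi>' = \<eta> \<psi>\<close>: the generator acts on exponentials as
  multiplication by \<open>\<eta>\<close>. Phases \<open>0\<close> and \<open>- pi / 2\<close> give the real and the imaginary part.
\<close>

lemma char_Z: assumes t: "0 \<le> t" shows "(LINT \<omega>|M. iexp (\<xi> * Z t \<omega>)) = exp (\<eta> \<xi> * of_real t)"
proof -
  have "((\<lambda>s. \<eta> \<xi> * \<psi> \<xi> s) has_integral (\<psi> \<xi> t - 1)) {0..t}" if t: "0 \<le> t" for t
  proof -
    have 1: "((\<lambda>s. Re (\<eta> \<xi> * \<psi> \<xi> s)) has_integral Re (\<psi> \<xi> t - 1)) {0..t}"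
      using phase_integral_equation[OF t, of 0 \<xi>] by simp
    have "iexp (- (pi / 2)) = - \<i>" by (simp add: complex_eq_iff Re_exp Im_exp)
    then have i: "Re (iexp (- (pi / 2)) * z) = Im z" for z by simp
    have 2: "((\<lambda>s. Im (\<eta> \<xi> * \<psi> \<xi> s)) has_integral Im (\<psi> \<xi> t - 1)) {0..t}"
      using phase_integral_equation[OF t, of "- (pi / 2)" \<xi>] unfolding i .
    have "((\<lambda>s. of_real (Re (\<eta> \<xi> * \<psi> \<xi> s)) + \<i> * of_real (Im (\<eta> \<xi> * \<psi> \<xi> s))) has_integral
        (of_real (Re (\<psi> \<xi> t - 1)) + \<i> * of_real (Im (\<psi> \<xi> t - 1)))) {0..t}"
      using has_integral_linear[OF 1 bounded_linear_of_real[where 'a = complex]]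
        has_integral_linear[OF 2 bounded_linear_of_real[where 'a = complex]]
      by (intro has_integral_add has_integral_mult_right) (simp_all only: o_def)
    then show ?thesis by (simp only: complex_eq[symmetric])
  qed
  from exp_integral_equation[OF this t] show ?thesis by (simp add: \<psi>_def)
qed

end

section \<open>Laws read off from characteristic functions\<close>

text \<open>
  Averages of \<open>exp (i k (X - m))\<close> over \<open>k = N, ..., 2 N - 1\<close> converge to the indicator of
  \<open>X - m \<in> 2 pi \<int>\<close>, while their expectations tend to \<open>0\<close>.
\<close>

lemma (in prob_space) no_atom_if_char_vanishes:
  assumes X [measurable]: "X \<in> borel_measurable M"
    and lim: "(\<lambda>n::nat. LINT \<omega>|M. iexp (real n * X \<omega>)) \<longlonglongrightarrow> 0"
  shows "AE \<omega> in M. X \<omega> \<noteq> m"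
proof -
  define q where "q \<omega> = iexp (X \<omega> - m)" for \<omega>
  have q_norm: "norm (q \<omega>) = 1" for \<omega> unfolding q_def by (rule norm_exp_i_times)
  define h where "h N \<omega> = (\<Sum>j<N. q \<omega> ^ (N + j)) / of_nat N" for N :: nat and \<omega>
  have q_meas [measurable]: "q \<in> borel_measurable M" unfolding q_def by measurable
  have h_meas [measurable]: "h N \<in> borel_measurable M" for N
    unfolding h_def[abs_def] by measurable
  have h_norm: "norm (h N \<omega>) \<le> 1" for N \<omega>
  proof (cases "N = 0")
    case False
    have "norm (\<Sum>j<N. q \<omega> ^ (N + j)) \<le> (\<Sum>j<N. norm (q \<omega> ^ (N + j)))" by (rule norm_sum)
    also have "\<dots> = real N" by (simp add: norm_power q_norm)
    finally show ?thesis using False by (simp add: h_def norm_divide)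
  qed (simp add: h_def)
  have h_lim: "(\<lambda>N. h N \<omega>) \<longlonglongrightarrow> indicator {\<omega>. q \<omega> = 1} \<omega>" for \<omega>
  proof (cases "q \<omega> = 1")
    case True
    have "\<forall>\<^sub>F N in sequentially. h N \<omega> = 1"
      using eventually_gt_at_top[of 0] by eventually_elim (simp add: h_def True)
    then show ?thesis using True by (simp add: tendsto_eventually)
  next
    case False
    have hN: "norm (h N \<omega>) \<le> (2 / norm (q \<omega> - 1)) * inverse (real N)" for N
    proof -
      have "(\<Sum>j<N. q \<omega> ^ (N + j)) = q \<omega> ^ N * ((q \<omega> ^ N - 1) / (q \<omega> - 1))"
        unfolding power_add sum_distrib_left[symmetric] by (simp add: geometric_sum[OF False])
      then have "norm (\<Sum>j<N. q \<omega> ^ (N + j)) = norm (q \<omega> ^ N - 1) / norm (q \<omega> - 1)"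
        by (simp add: norm_mult norm_divide norm_power q_norm)
      also have "norm (q \<omega> ^ N - 1) \<le> 2"
        using norm_triangle_ineq4[of "q \<omega> ^ N" 1] by (simp add: norm_power q_norm)
      finally have "norm (\<Sum>j<N. q \<omega> ^ (N + j)) \<le> 2 / norm (q \<omega> - 1)"
        by (simp add: divide_right_mono)
      then have "norm (\<Sum>j<N. q \<omega> ^ (N + j)) / real N \<le> 2 / norm (q \<omega> - 1) / real N"
        by (rule divide_right_mono) simp
      then show ?thesis unfolding h_def norm_divide norm_of_nat by (simp add: divide_inverse)
    qed
    have "(\<lambda>N. (2 / norm (q \<omega> - 1)) * inverse (real N)) \<longlonglongrightarrow> 0"
      by (intro tendsto_mult_right_zero lim_inverse_n)
    then have "(\<lambda>N. h N \<omega>) \<longlonglongrightarrow> 0"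
      by (rule Lim_null_comparison[rotated]) (intro always_eventually allI hN)
    then show ?thesis using False by simp
  qed
  have "(\<lambda>N. LINT \<omega>|M. h N \<omega>) \<longlonglongrightarrow> (LINT \<omega>|M. indicator {\<omega>. q \<omega> = 1} \<omega>)"
  proof (rule integral_dominated_convergence[where w = "\<lambda>_. 1"])
    show "(\<lambda>\<omega>. indicator {\<omega>. q \<omega> = 1} \<omega> :: complex) \<in> borel_measurable M"
      by (rule borel_measurable_LIMSEQ_metric[OF h_meas h_lim])
  qed (use h_norm h_lim in auto)
  moreover have "(\<lambda>N. LINT \<omega>|M. h N \<omega>) \<longlonglongrightarrow> 0"
  proof (rule tendstoI)
    fix e :: real assume e: "0 < e"
    have int: "integrable M (\<lambda>\<omega>. q \<omega> ^ k)" for k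
      by (intro integrable_const_bound[of _ 1]) (auto simp: norm_power q_norm)
    have Eq: "(LINT \<omega>|M. q \<omega> ^ k) = iexp (- real k * m) * (LINT \<omega>|M. iexp (real k * X \<omega>))" for k
    proof -
      have "q \<omega> ^ k = iexp (- real k * m) * iexp (real k * X \<omega>)" for \<omega>
        unfolding q_def exp_of_nat_mult[symmetric] exp_add[symmetric] by (simp add: algebra_simps)
      then show ?thesis by simp
    qed
    have nE: "norm (LINT \<omega>|M. q \<omega> ^ k) = norm (LINT \<omega>|M. iexp (real k * X \<omega>))" for k
      unfolding Eq norm_mult by (simp only: norm_exp_i_times mult_1_left)
    obtain N0 where N0: "\<And>k. N0 \<le> k \<Longrightarrow> norm (LINT \<omega>|M. q \<omega> ^ k) < e"
      using tendstoD[OF lim e] unfolding eventually_sequentially dist_norm diff_zero nE by blast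
    show "\<forall>\<^sub>F N in sequentially. dist (LINT \<omega>|M. h N \<omega>) 0 < e"
      using eventually_ge_at_top[of "max N0 1"]
    proof eventually_elim
      case (elim N)
      have "(LINT \<omega>|M. h N \<omega>) = (\<Sum>j<N. LINT \<omega>|M. q \<omega> ^ (N + j)) / of_nat N"
        unfolding h_def using int by (simp add: integral_sum)
      moreover have "norm (\<Sum>j<N. LINT \<omega>|M. q \<omega> ^ (N + j)) < (\<Sum>j<N. e)"
        using N0 elim by (intro le_less_trans[OF norm_sum sum_strict_mono]) (auto simp: lessThan_empty_iff)
      then have "norm (\<Sum>j<N. LINT \<omega>|M. q \<omega> ^ (N + j)) / real N < e"
        using elim by (simp add: pos_divide_less_eq mult.commute)
      ultimately show ?case by (simp only: dist_norm diff_zero norm_divide norm_of_nat)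
    qed
  qed
  ultimately have "(LINT \<omega>|M. indicator {\<omega>. q \<omega> = 1} \<omega> :: complex) = 0" using LIMSEQ_unique by blast
  moreover have "(LINT \<omega>|M. indicator {\<omega>. q \<omega> = 1} \<omega> :: complex) = of_real (measure M {\<omega> \<in> space M. q \<omega> = 1})"
  proof -
    have "(LINT \<omega>|M. indicator {\<omega>. q \<omega> = 1} \<omega> :: complex) = (LINT \<omega>|M. of_real (indicator {\<omega> \<in> space M. q \<omega> = 1} \<omega>))"
      by (intro Bochner_Integration.integral_cong) (auto simp: indicator_def)
    also have "\<dots> = of_real (LINT \<omega>|M. indicator {\<omega> \<in> space M. q \<omega> = 1} \<omega>)"
      by (intro integral_of_real integrable_const_bound[of _ 1]) (auto simp: indicator_def)
    finally show ?thesis by simp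
  qed
  ultimately have "\<P>(\<omega> in M. q \<omega> = 1) = 0" by simp
  then have "AE \<omega> in M. \<not> q \<omega> = 1"
    by (subst (asm) prob_Collect_eq_0) auto
  then show ?thesis by eventually_elim (auto simp: q_def)
qed

text \<open>
  For \<open>X \<ge> 0\<close> the integral of \<open>sin (u X)\<close> over \<open>u \<in> {0..v}\<close> is \<open>(1 - cos (v X)) / X \<ge> 0\<close>, of order
  \<open>v\<^sup>2 X / 2\<close>. A characteristic function whose imaginary part is of order \<open>u powr \<alpha>\<close> with \<open>\<alpha> > 1\<close>
  thus leaves no room for a positive mean.
\<close>

lemma (in prob_space) nonneg_with_flat_char_is_0:
  fixes X :: "'a \<Rightarrow> real"
  assumes X [measurable]: "X \<in> borel_measurable M" and nonneg: "AE \<omega> in M. 0 \<le> X \<omega>" and \<alpha>: "1 < \<alpha>"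
    and bound: "\<And>u. 0 < u \<Longrightarrow> \<bar>LINT \<omega>|M. sin (u * X \<omega>)\<bar> \<le> C * u powr \<alpha>"
  shows "AE \<omega> in M. X \<omega> = 0"
proof -
  define k where "k v x = (LINT u|lborel. indicator {0..v} u *\<^sub>R sin (u * x))" for v x :: real
  have k0: "k v 0 = 0" for v by (simp add: k_def)
  have k_eq: "k v x = (1 - cos (v * x)) / x" if "0 < v" "x \<noteq> 0" for v x
  proof -
    have "k v x = (- cos (v * x) / x) - (- cos (0 * x) / x)"
      unfolding k_def
    proof (rule integral_FTC_Icc)
      fix u assume "0 \<le> u" "u \<le> v"
      have "((\<lambda>u. - cos (u * x) / x) has_real_derivative sin (u * x)) (at u within {0..v})"
        using that by (auto intro!: derivative_eq_intros)
      then show "((\<lambda>u. - cos (u * x) / x) has_vector_derivative sin (u * x)) (at u within {0..v})"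
        by (simp add: has_real_derivative_iff_has_vector_derivative)
    qed (use that in \<open>auto intro!: continuous_intros\<close>)
    then show ?thesis by (simp add: diff_divide_distrib)
  qed
  have k_nonneg: "0 \<le> k v x" if "0 < v" "0 \<le> x" for v x
    using that k0 k_eq[of v x] by (cases "x = 0") auto
  have Ek: "integrable M (\<lambda>\<omega>. k v (X \<omega>))" "(LINT \<omega>|M. k v (X \<omega>)) \<le> C * v powr \<alpha> * v" if v: "0 < v" for v
  proof -
    interpret lb: pair_sigma_finite lborel M ..
    let ?f = "\<lambda>u \<omega>. indicator {0..v} u *\<^sub>R sin (u * X \<omega>)"
    have "integrable (lborel \<Otimes>\<^sub>M M) (\<lambda>p. indicator ({0..v} \<times> space M) p :: real)"
      using v by (intro integrable_real_indicator) (auto simp: emeasure_pair_measure_Times emeasure_space_1)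
    then have int: "integrable (lborel \<Otimes>\<^sub>M M) (case_prod ?f)"
      by (rule Bochner_Integration.integrable_bound)
        (auto intro!: AE_I2 simp: space_pair_measure indicator_def)
    have C0: "0 \<le> C" using bound[of 1] by simp
    show "integrable M (\<lambda>\<omega>. k v (X \<omega>))"
      unfolding k_def using lb.integrable_snd[OF int] by simp
    have "(LINT \<omega>|M. k v (X \<omega>)) = (LINT u|lborel. LINT \<omega>|M. ?f u \<omega>)"
      unfolding k_def by (rule lb.Fubini_integral[OF int])
    also have "\<dots> \<le> (LINT u|lborel. indicator {0..v} u * (C * v powr \<alpha>))"
    proof (rule integral_mono)
      show "integrable lborel (\<lambda>u. LINT \<omega>|M. ?f u \<omega>)" using lb.integrable_fst[OF int] by simp
      show "integrable lborel (\<lambda>u. indicator {0..v} u * (C * v powr \<alpha>))"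
        using v by (intro integrable_mult_left integrable_real_indicator) auto
      fix u
      show "(LINT \<omega>|M. ?f u \<omega>) \<le> indicator {0..v} u * (C * v powr \<alpha>)"
      proof (cases "u \<in> {0..v} \<and> u \<noteq> 0")
        case True
        then have "(LINT \<omega>|M. sin (u * X \<omega>)) \<le> C * u powr \<alpha>" using bound[of u] by auto
        also have "\<dots> \<le> C * v powr \<alpha>" using True C0 \<alpha> by (intro mult_left_mono powr_mono2) auto
        finally show ?thesis using True by simp
      qed (use C0 in \<open>auto simp: indicator_def\<close>)
    qed
    also have "\<dots> = C * v powr \<alpha> * v" using v by simp
    finally show "(LINT \<omega>|M. k v (X \<omega>)) \<le> C * v powr \<alpha> * v" .
  qed
  define V where "V n = inverse (real (Suc n))" for n
  have V: "0 < V n" for n by (simp add: V_def)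
  have V0: "V \<longlonglongrightarrow> 0" unfolding V_def[abs_def] by (rule LIMSEQ_inverse_real_of_nat)
  have L1: "(\<lambda>n. LINT \<omega>|M. norm (k (V n) (X \<omega>) / (V n)\<^sup>2)) \<longlonglongrightarrow> 0"
  proof (rule tendsto_sandwich)
    show "\<forall>\<^sub>F n in sequentially. 0 \<le> (LINT \<omega>|M. norm (k (V n) (X \<omega>) / (V n)\<^sup>2))" by simp
    have "(LINT \<omega>|M. norm (k (V n) (X \<omega>) / (V n)\<^sup>2)) \<le> C * V n powr (\<alpha> - 1)" for n
    proof -
      have "(LINT \<omega>|M. norm (k (V n) (X \<omega>) / (V n)\<^sup>2)) = (LINT \<omega>|M. k (V n) (X \<omega>) / (V n)\<^sup>2)"
      proof (rule integral_cong_AE)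
        show "AE \<omega> in M. norm (k (V n) (X \<omega>) / (V n)\<^sup>2) = k (V n) (X \<omega>) / (V n)\<^sup>2"
          using nonneg by eventually_elim (simp add: k_nonneg[OF V])
      qed (use Ek(1)[OF V[of n]] in auto)
      also have "\<dots> = (LINT \<omega>|M. k (V n) (X \<omega>)) / (V n)\<^sup>2" by simp
      also have "\<dots> \<le> (C * V n powr \<alpha> * V n) / (V n)\<^sup>2"
        by (intro divide_right_mono Ek V) auto
      also have "\<dots> = C * V n powr (\<alpha> - 1)"
        using V[of n] by (simp add: powr_diff power2_eq_square field_simps)
      finally show ?thesis .
    qed
    then show "\<forall>\<^sub>F n in sequentially. (LINT \<omega>|M. norm (k (V n) (X \<omega>) / (V n)\<^sup>2)) \<le> C * V n powr (\<alpha> - 1)"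
      by simp
    have "(\<lambda>n. V n powr (\<alpha> - 1)) \<longlonglongrightarrow> 0"
      using V \<alpha> by (intro tendsto_zero_powrI[OF V0 tendsto_const]) (auto simp: less_imp_le)
    then show "(\<lambda>n. C * V n powr (\<alpha> - 1)) \<longlonglongrightarrow> 0" by (rule tendsto_mult_right_zero)
  qed simp
  obtain r :: "nat \<Rightarrow> nat" where r: "strict_mono r" "AE \<omega> in M. (\<lambda>n. k (V (r n)) (X \<omega>) / (V (r n))\<^sup>2) \<longlonglongrightarrow> 0"
    using tendsto_L1_AE_subseq[OF _ L1] Ek(1)[OF V] by auto
  have lim: "(\<lambda>n. k (V n) x / (V n)\<^sup>2) \<longlonglongrightarrow> x / 2" if x: "x \<noteq> 0" for x
  proof -
    have "((\<lambda>v. sin (v * (x / 2))) has_real_derivative x / 2) (at 0)"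
      by (auto intro!: derivative_eq_intros)
    then have D: "((\<lambda>h. sin (h * (x / 2)) / h) \<longlongrightarrow> x / 2) (at 0)" by (simp add: DERIV_def)
    have "filterlim V (at 0) sequentially" using V0 V by (intro filterlim_atI) (auto simp: less_imp_neq[symmetric])
    from filterlim_compose[OF D this]
    have s: "(\<lambda>n. sin (V n * (x / 2)) / V n) \<longlonglongrightarrow> x / 2" .
    have eq: "k (V n) x / (V n)\<^sup>2 = (sin (V n * (x / 2)) / V n)\<^sup>2 * (2 / x)" for n
      using k_eq[OF V x, of n] cos_double_sin[of "V n * (x / 2)"]
      by (simp add: power_divide mult.commute)
    have "(\<lambda>n. (sin (V n * (x / 2)) / V n)\<^sup>2 * (2 / x)) \<longlonglongrightarrow> (x / 2)\<^sup>2 * (2 / x)"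
      by (intro tendsto_intros s)
    moreover have "(x / 2)\<^sup>2 * (2 / x) = x / 2" using x by (simp add: power2_eq_square)
    ultimately show ?thesis unfolding eq by (simp only:)
  qed
  show ?thesis
    using r(2)
  proof eventually_elim
    case (elim \<omega>)
    show ?case
    proof (rule ccontr)
      assume x: "X \<omega> \<noteq> 0"
      have "(\<lambda>n. k (V (r n)) (X \<omega>) / (V (r n))\<^sup>2) \<longlonglongrightarrow> X \<omega> / 2"
        using LIMSEQ_subseq_LIMSEQ[OF lim[OF x] r(1)] by (simp add: o_def)
      then show False using LIMSEQ_unique[OF elim] x by force
    qed
  qed
qed

context stable_levy
begin

lemma Re_\<eta>: "0 < \<xi> \<Longrightarrow> Re (\<eta> \<xi>) = \<xi> powr \<alpha> * Re (\<eta>\<^sub>0 1)"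
  using \<eta>\<^sub>0_scale[of \<xi> 1] by (simp add: \<eta>_def)

lemma char_Z_vanishes:
  assumes t: "0 < t"
  shows "(\<lambda>n::nat. LINT \<omega>|M. iexp (real n * Z t \<omega>)) \<longlonglongrightarrow> 0"
proof -
  have "norm (LINT \<omega>|M. iexp (real n * Z t \<omega>)) = exp (Re (\<eta>\<^sub>0 1) * t * real n powr \<alpha>)" if "0 < n" for n
    unfolding char_Z[OF less_imp_le[OF t]] norm_exp_eq_Re using that by (simp add: Re_\<eta> mult_ac)
  note eq = this
  have lim: "(\<lambda>n. exp (Re (\<eta>\<^sub>0 1) * t * real n powr \<alpha>)) \<longlonglongrightarrow> 0"
  proof -
    have "filterlim (\<lambda>n. real n powr \<alpha>) at_top sequentially"
      using \<alpha> by (intro filterlim_compose[OF real_powr_at_top filterlim_real_sequentially]) auto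
    then have "filterlim (\<lambda>n. Re (\<eta>\<^sub>0 1) * t * real n powr \<alpha>) at_bot sequentially"
      using Re_\<eta>\<^sub>0_neg t by (intro filterlim_tendsto_neg_mult_at_bot[OF tendsto_const]) (auto simp: mult_neg_pos)
    then show ?thesis by (rule filterlim_compose[OF exp_at_bot])
  qed
  have "(\<lambda>n. norm (LINT \<omega>|M. iexp (real n * Z t \<omega>))) \<longlonglongrightarrow> 0"
  proof (rule Lim_transform_eventually[OF lim])
    show "\<forall>\<^sub>F n in sequentially. exp (Re (\<eta>\<^sub>0 1) * t * real n powr \<alpha>) = norm (LINT \<omega>|M. iexp (real n * Z t \<omega>))"
      using eventually_gt_at_top[of 0] by eventually_elim (simp only: eq)
  qed
  then show ?thesis by (simp only: tendsto_norm_zero_iff)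
qed

text \<open>Once centred and rescaled, the process has a law that does not depend on time.\<close>

definition W :: "real \<Rightarrow> 'w \<Rightarrow> real" where
  "W t \<omega> = (Z t \<omega> + a * t) / t powr (1 / \<alpha>)"

lemma W_measurable: "0 \<le> t \<Longrightarrow> W t \<in> borel_measurable M"
  unfolding W_def[abs_def] by measurable

lemma char_W: assumes t: "0 < t" shows "(LINT \<omega>|M. iexp (\<xi> * W t \<omega>)) = exp (\<eta>\<^sub>0 \<xi>)"
proof -
  let ?s = "t powr (1 / \<alpha>)"
  have s: "0 < ?s" using t by simp
  have "iexp (\<xi> * W t \<omega>) = iexp (\<xi> * a * t / ?s) * iexp ((\<xi> / ?s) * Z t \<omega>)" for \<omega>
    unfolding W_def exp_add[symmetric] using s by (simp add: field_simps)
  then have "(LINT \<omega>|M. iexp (\<xi> * W t \<omega>)) = iexp (\<xi> * a * t / ?s) * exp (\<eta> (\<xi> / ?s) * of_real t)"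
    using char_Z[of t "\<xi> / ?s"] t by simp
  also have "\<dots> = exp (\<eta>\<^sub>0 (\<xi> / ?s) * of_real t)"
    unfolding exp_add[symmetric] \<eta>_def using s by (simp add: field_simps)
  also have "\<eta>\<^sub>0 (\<xi> / ?s) = of_real ((1 / ?s) powr \<alpha>) * \<eta>\<^sub>0 \<xi>"
    using \<eta>\<^sub>0_scale[of "1 / ?s" \<xi>] s by simp
  also have "(1 / ?s) powr \<alpha> = 1 / t"
    using t \<alpha> by (simp add: powr_divide powr_powr)
  finally show ?thesis using t by simp
qed

lemma distr_W: assumes "0 < s" "0 < t" shows "distr M borel (W s) = distr M borel (W t)"
proof (rule Levy_uniqueness)
  have [measurable]: "W s \<in> borel_measurable M" "W t \<in> borel_measurable M"
    using assms by (auto intro: W_measurable)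
  show "real_distribution (distr M borel (W s))" "real_distribution (distr M borel (W t))"
    by (auto intro!: real_distribution_distr)
  show "char (distr M borel (W s)) = char (distr M borel (W t))"
    unfolding char_def using assms by (auto simp: integral_distr char_W fun_eq_iff simp del: of_real_mult)
qed

text \<open>
  Near \<open>0\<close> the characteristic function \<open>exp (\<eta>\<^sub>0 u)\<close> differs from \<open>1\<close> by order \<open>u powr \<alpha>\<close> only, as if
  the mean were \<open>0\<close>; a one-sided law would be concentrated at \<open>0\<close>, against \<open>Re (\<eta>\<^sub>0 1) < 0\<close>.
\<close>

lemma W_not_one_sided:
  assumes \<epsilon>: "\<epsilon> = 1 \<or> \<epsilon> = - 1"
  shows "\<not> (AE \<omega> in M. 0 \<le> \<epsilon> * W 1 \<omega>)"
proof
  assume ae: "AE \<omega> in M. 0 \<le> \<epsilon> * W 1 \<omega>"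
  have [measurable]: "W 1 \<in> borel_measurable M" by (rule W_measurable) simp
  have "\<bar>LINT \<omega>|M. sin (u * (\<epsilon> * W 1 \<omega>))\<bar> \<le> norm (\<eta>\<^sub>0 1) * u powr \<alpha>" if u: "0 < u" for u
  proof -
    have "\<bar>LINT \<omega>|M. sin (u * (\<epsilon> * W 1 \<omega>))\<bar> = \<bar>LINT \<omega>|M. sin (u * W 1 \<omega>)\<bar>"
      using \<epsilon> by auto
    also have "(LINT \<omega>|M. sin (u * W 1 \<omega>)) = (LINT \<omega>|M. Im (iexp (u * W 1 \<omega>)))"
      by (simp add: Im_exp)
    also have "\<dots> = Im (LINT \<omega>|M. iexp (u * W 1 \<omega>))"
      by (intro integral_Im integrable_const_bound[of _ 1]) (auto simp del: of_real_mult)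
    also have "\<dots> = Im (exp (\<eta>\<^sub>0 u))" by (simp only: char_W[OF zero_less_one])
    also have "\<bar>\<dots>\<bar> = exp (Re (\<eta>\<^sub>0 u)) * \<bar>sin (Im (\<eta>\<^sub>0 u))\<bar>" by (simp add: Im_exp abs_mult)
    also have "\<dots> \<le> 1 * \<bar>Im (\<eta>\<^sub>0 u)\<bar>"
      using Re_\<eta>\<^sub>0_neg u \<eta>\<^sub>0_scale[of u 1] by (intro mult_mono abs_sin_x_le_abs_x) (auto simp: mult_nonneg_nonpos)
    also have "\<dots> \<le> norm (\<eta>\<^sub>0 u)" using abs_Im_le_cmod by simp
    also have "\<dots> = norm (\<eta>\<^sub>0 1) * u powr \<alpha>" using \<eta>\<^sub>0_scale[of u 1] u by (simp add: norm_mult)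
    finally show ?thesis .
  qed
  from nonneg_with_flat_char_is_0[OF _ ae \<alpha>(1) this]
  have 0: "AE \<omega> in M. \<epsilon> * W 1 \<omega> = 0" by simp
  have "(LINT \<omega>|M. iexp (1 * W 1 \<omega>)) = (LINT \<omega>|M. 1)"
    by (rule integral_cong_AE) (use 0 \<epsilon> in \<open>auto elim!: eventually_mono\<close>)
  then have "exp (\<eta>\<^sub>0 1) = 1" unfolding char_W[OF zero_less_one] by (simp add: prob_space)
  then have "exp (Re (\<eta>\<^sub>0 1)) = 1" using norm_exp_eq_Re[of "\<eta>\<^sub>0 1"] by simp
  then show False using Re_\<eta>\<^sub>0_neg by simp
qed

text \<open>
  At small times the drift \<open>a t\<close> is negligible against the scale \<open>t powr (1 / \<alpha>)\<close> of the
  fluctuations, since \<open>\<alpha> > 1\<close>.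
\<close>

lemma both_signs:
  assumes \<epsilon>: "\<epsilon> = 1 \<or> \<epsilon> = - 1"
  shows "\<exists>\<delta>>0. \<forall>r>0. \<exists>s. 0 < s \<and> s < r \<and> \<delta> \<le> \<P>(\<omega> in M. \<epsilon> * Z s \<omega> < 0)"
proof -
  have [measurable]: "W 1 \<in> borel_measurable M" by (rule W_measurable) simp
  have "\<exists>n. \<not> (AE \<omega> in M. - inverse (real (Suc n)) \<le> \<epsilon> * W 1 \<omega>)"
  proof (rule ccontr)
    assume "\<nexists>n. \<not> (AE \<omega> in M. - inverse (real (Suc n)) \<le> \<epsilon> * W 1 \<omega>)"
    then have "AE \<omega> in M. \<forall>n. - inverse (real (Suc n)) \<le> \<epsilon> * W 1 \<omega>"
      by (simp add: AE_all_countable)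
    then have "AE \<omega> in M. 0 \<le> \<epsilon> * W 1 \<omega>"
    proof eventually_elim
      case (elim \<omega>)
      have "(\<lambda>n. - inverse (real (Suc n))) \<longlonglongrightarrow> - 0"
        by (intro tendsto_minus LIMSEQ_inverse_real_of_nat)
      then show ?case using LIMSEQ_le_const2[of _ "- 0" "\<epsilon> * W 1 \<omega>"] elim by auto
    qed
    then show False using W_not_one_sided[OF \<epsilon>] by blast
  qed
  then obtain n where n: "\<not> (AE \<omega> in M. - inverse (real (Suc n)) \<le> \<epsilon> * W 1 \<omega>)" by blast
  define \<kappa>' where "\<kappa>' = inverse (real (Suc n))"
  have \<kappa>': "0 < \<kappa>'" by (simp add: \<kappa>'_def)
  define \<delta> where "\<delta> = \<P>(\<omega> in M. \<epsilon> * W 1 \<omega> < - \<kappa>')"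
  have "\<delta> \<noteq> 0"
  proof
    assume "\<delta> = 0"
    then have "AE \<omega> in M. \<not> \<epsilon> * W 1 \<omega> < - \<kappa>'"
      unfolding \<delta>_def by (subst (asm) prob_Collect_eq_0) auto
    then show False using n by (simp add: \<kappa>'_def not_less)
  qed
  then have \<delta>: "0 < \<delta>" using measure_nonneg[of M] by (simp add: \<delta>_def less_le)
  have "\<exists>s. 0 < s \<and> s < r \<and> \<delta> \<le> \<P>(\<omega> in M. \<epsilon> * Z s \<omega> < 0)" if r: "0 < r" for r
  proof -
    let ?p = "1 - 1 / \<alpha>"
    have p: "0 < ?p" using \<alpha> by simp
    have "((\<lambda>s. \<bar>a\<bar> * s powr ?p) \<longlongrightarrow> \<bar>a\<bar> * 0) (at_right 0)"
      using p by (intro tendsto_intros tendsto_zero_powrI[of _ _ _ ?p])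
        (auto intro: eventually_mono[OF eventually_at_right_less] tendsto_eq_intros)
    then have "\<forall>\<^sub>F s in at_right 0. \<bar>a\<bar> * s powr ?p < \<kappa>'"
      using \<kappa>' by (intro order_tendstoD) auto
    then have "\<forall>\<^sub>F s in at_right 0. \<bar>a\<bar> * s powr ?p < \<kappa>' \<and> s \<in> {0<..<r}"
      using r by (intro eventually_conj eventually_at_right_real)
    then obtain s where s: "\<bar>a\<bar> * s powr ?p < \<kappa>'" "0 < s" "s < r"
      using eventually_happens[of _ "at_right (0::real)"] by auto
    have [measurable]: "W s \<in> borel_measurable M" "Z s \<in> borel_measurable M"
      using s by (auto intro: W_measurable)
    have meas: "\<P>(\<omega> in M. \<epsilon> * W t \<omega> < - \<kappa>') = measure (distr M borel (W t)) {x. \<epsilon> * x < - \<kappa>'}"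
      if "0 < t" for t
    proof -
      have [measurable]: "W t \<in> borel_measurable M" using that by (auto intro: W_measurable)
      show ?thesis by (subst measure_distr) (auto simp: vimage_def Int_def conj_commute)
    qed
    have "\<delta> = \<P>(\<omega> in M. \<epsilon> * W s \<omega> < - \<kappa>')"
      unfolding \<delta>_def meas[OF zero_less_one] meas[OF s(2)] distr_W[OF zero_less_one s(2)] ..
    also have "\<dots> \<le> \<P>(\<omega> in M. \<epsilon> * Z s \<omega> < 0)"
    proof (rule finite_measure_mono)
      show "{\<omega> \<in> space M. \<epsilon> * W s \<omega> < - \<kappa>'} \<subseteq> {\<omega> \<in> space M. \<epsilon> * Z s \<omega> < 0}"
      proof safe
        fix \<omega> assume "\<epsilon> * W s \<omega> < - \<kappa>'"
        let ?q = "s powr (1 / \<alpha>)"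
        have q: "0 < ?q" using s by simp
        have "\<epsilon> * (Z s \<omega> + a * s) = (\<epsilon> * W s \<omega>) * ?q" using q by (simp add: W_def)
        also have "\<dots> < - \<kappa>' * ?q" using \<open>\<epsilon> * W s \<omega> < - \<kappa>'\<close> q by (rule mult_strict_right_mono)
        also have "\<dots> < - (\<bar>a\<bar> * s powr ?p) * ?q" using s(1) q by (intro mult_strict_right_mono) auto
        also have "\<dots> = - (\<bar>a\<bar> * (s powr ?p * ?q))" by simp
        also have "s powr ?p * ?q = s" using s by (simp flip: powr_add)
        also have "- (\<bar>a\<bar> * s) \<le> \<epsilon> * (a * s)"
          using \<epsilon> s abs_ge_self[of "a * s"] abs_ge_minus_self[of "a * s"] by (auto simp: abs_mult)
        finally show "\<epsilon> * Z s \<omega> < 0" by (simp add: distrib_left)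
      qed
    qed measurable
    finally show ?thesis using s by auto
  qed
  then show ?thesis using \<delta> by blast
qed

end

section \<open>The running extrema have no atoms\<close>

context levy
begin

lemma Z_sup_measurable [measurable]:
  "0 \<le> t \<Longrightarrow> (\<lambda>\<omega>. lo \<omega> t) \<in> borel_measurable M"
  "0 \<le> t \<Longrightarrow> (\<lambda>\<omega>. hi \<omega> t) \<in> borel_measurable M"
  by (auto intro!: rinf_measurable rsup_measurable)

text \<open>
  An independent summand cannot increase the modulus of a characteristic function. For the infimum
  over a finite grid this is the independence of increments, and the inequality survives the limit.
\<close>

lemma char_shifted_infimum_le:
  assumes s: "0 < s" and r: "0 < r"
  shows "norm (LINT \<omega>|M. iexp (u * (Z s \<omega> + rinf (\<lambda>v. Z (s + v) \<omega> - Z s \<omega>) r)))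
    \<le> norm (LINT \<omega>|M. iexp (u * Z s \<omega>))"
proof -
  define G where "G N \<omega> = gmin (\<lambda>v. Z (s + v) \<omega> - Z s \<omega>) r N" for N \<omega>
  have [measurable]: "Z s \<in> borel_measurable M" using s by simp
  have Wm: "(\<lambda>\<omega>. Z (s + v) \<omega> - Z s \<omega>) \<in> borel_measurable M" if "0 \<le> v" for v
    using that s by (intro borel_measurable_diff) auto
  have G [measurable]: "G N \<in> borel_measurable M" for N
    unfolding G_def using Wm r by (intro gmin_measurable) auto
  have [measurable]: "(\<lambda>\<omega>. rinf (\<lambda>v. Z (s + v) \<omega> - Z s \<omega>) r) \<in> borel_measurable M"
    using Wm r by (intro rinf_measurable) auto
  have grid: "norm (LINT \<omega>|M. iexp (u * (Z s \<omega> + G N \<omega>))) \<le> norm (LINT \<omega>|M. iexp (u * Z s \<omega>))" if N: "0 < N" for N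
  proof -
    define \<sigma> where "\<sigma> k = (if k = 0 then 0 else s + real (k - 1) * r / real N)" for k
    have \<sigma>: "strict_mono \<sigma>" "\<sigma> 0 = 0"
      unfolding strict_mono_Suc_iff using s r N by (auto simp: \<sigma>_def field_simps)
    have "indep_var borel ((\<lambda>x. x 1) \<circ> (\<lambda>\<omega>. \<lambda>k\<in>{..1}. Z (\<sigma> k) \<omega> - Z 0 \<omega>))
      borel ((\<lambda>x. Min ((\<lambda>k. x k) ` {..N})) \<circ> (\<lambda>\<omega>. \<lambda>k\<in>{..N}. Z (\<sigma> (1 + k)) \<omega> - Z (\<sigma> 1) \<omega>))"
      by (rule indep_var_compose[OF indep_blocks[OF \<sigma>]])
        (auto intro!: borel_measurable_Min measurable_component_singleton)
    also have "(\<lambda>x. x 1) \<circ> (\<lambda>\<omega>. \<lambda>k\<in>{..1}. Z (\<sigma> k) \<omega> - Z 0 \<omega>) = (\<lambda>\<omega>. Z s \<omega> - Z 0 \<omega>)"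
      by (auto simp: \<sigma>_def)
    also have "(\<lambda>x. Min ((\<lambda>k. x k) ` {..N})) \<circ> (\<lambda>\<omega>. \<lambda>k\<in>{..N}. Z (\<sigma> (1 + k)) \<omega> - Z (\<sigma> 1) \<omega>) = G N"
      by (auto simp: G_def gmin_def \<sigma>_def fun_eq_iff intro!: arg_cong[where f = Min] image_cong)
    finally have ind: "indep_var borel (\<lambda>\<omega>. Z s \<omega> - Z 0 \<omega>) borel (G N)" .
    have "(LINT \<omega>|M. iexp (u * (Z s \<omega> + G N \<omega>))) = (LINT \<omega>|M. iexp (u * ((Z s \<omega> - Z 0 \<omega>) + G N \<omega>)))"
      by (rule integral_cong_AE) (use AE_Z_0 in \<open>auto elim!: eventually_mono\<close>)
    also have "\<dots> = char (distr M borel (\<lambda>\<omega>. (Z s \<omega> - Z 0 \<omega>) + G N \<omega>)) u"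
      unfolding char_def by (subst integral_distr) auto
    also have "\<dots> = char (distr M borel (\<lambda>\<omega>. Z s \<omega> - Z 0 \<omega>)) u * char (distr M borel (G N)) u"
      by (rule char_distr_add[OF ind])
    also have "char (distr M borel (\<lambda>\<omega>. Z s \<omega> - Z 0 \<omega>)) u = (LINT \<omega>|M. iexp (u * (Z s \<omega> - Z 0 \<omega>)))"
      unfolding char_def by (subst integral_distr) auto
    also have "\<dots> = (LINT \<omega>|M. iexp (u * Z s \<omega>))"
      by (rule integral_cong_AE) (use AE_Z_0 in \<open>auto elim!: eventually_mono\<close>)
    finally have eq: "(LINT \<omega>|M. iexp (u * (Z s \<omega> + G N \<omega>))) = (LINT \<omega>|M. iexp (u * Z s \<omega>)) * char (distr M borel (G N)) u" .
    interpret d: real_distribution "distr M borel (G N)" by (rule real_distribution_distr) measurable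
    show ?thesis unfolding eq norm_mult
      using mult_left_mono[OF d.cmod_char_le_1 norm_ge_zero] by (simp only: mult_1_right)
  qed
  have "(\<lambda>N. LINT \<omega>|M. iexp (u * (Z s \<omega> + G N \<omega>))) \<longlonglongrightarrow>
      (LINT \<omega>|M. iexp (u * (Z s \<omega> + rinf (\<lambda>v. Z (s + v) \<omega> - Z s \<omega>) r)))"
  proof (rule integral_dominated_convergence[where w = "\<lambda>_. 1"])
    show "AE \<omega> in M. (\<lambda>N. iexp (u * (Z s \<omega> + G N \<omega>))) \<longlonglongrightarrow> iexp (u * (Z s \<omega> + rinf (\<lambda>v. Z (s + v) \<omega> - Z s \<omega>) r))"
      using AE_cadlag
    proof eventually_elim
      case (elim \<omega>)
      have "(\<lambda>N. G N \<omega>) \<longlonglongrightarrow> rinf (\<lambda>v. Z (s + v) \<omega> - Z s \<omega>) r"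
        unfolding G_def using elim s r by (intro gmin_tendsto_rinf cadlag_shift) auto
      then show ?case by (intro tendsto_intros)
    qed
  qed (auto simp del: of_real_mult of_real_add)
  from tendsto_norm[OF this] show ?thesis
    by (rule tendsto_upperbound) (use grid in \<open>auto intro: eventually_mono[OF eventually_gt_at_top[of 0]]\<close>)
qed

text \<open>
  By \<open>rinf_split\<close> the infimum up to \<open>t\<close> is the minimum of the infimum up to \<open>s\<close> and of a variable
  without atoms. So where the infimum up to \<open>t\<close> equals \<open>m\<close>, the one up to every \<open>s = t / (n + 2)\<close> equals
  \<open>m\<close> as well, yet it tends to \<open>0\<close>.
\<close>

lemma infimum_no_atom_off_0:
  assumes char: "\<And>t. 0 < t \<Longrightarrow> (\<lambda>n::nat. LINT \<omega>|M. iexp (real n * Z t \<omega>)) \<longlonglongrightarrow> 0"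
    and t: "0 < t" and m: "m \<noteq> 0"
  shows "AE \<omega> in M. lo \<omega> t \<noteq> m"
proof -
  define s where "s n = t / real (n + 2)" for n :: nat
  have s: "0 < s n" "s n < t" for n
    using t by (auto simp: s_def field_simps intro: add_pos_nonneg)
  have "AE \<omega> in M. Z (s n) \<omega> + rinf (\<lambda>v. Z (s n + v) \<omega> - Z (s n) \<omega>) (t - s n) \<noteq> m" for n
  proof (rule no_atom_if_char_vanishes)
    show "(\<lambda>\<omega>. Z (s n) \<omega> + rinf (\<lambda>v. Z (s n + v) \<omega> - Z (s n) \<omega>) (t - s n)) \<in> borel_measurable M"
      using s[of n] by (intro borel_measurable_add rinf_measurable borel_measurable_diff) auto
    show "(\<lambda>k. LINT \<omega>|M. iexp (real k * (Z (s n) \<omega> + rinf (\<lambda>v. Z (s n + v) \<omega> - Z (s n) \<omega>) (t - s n)))) \<longlonglongrightarrow> 0"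
      by (rule Lim_null_comparison[OF _ tendsto_norm_zero[OF char[OF s(1)[of n]]]])
        (use s[of n] in \<open>auto intro!: always_eventually char_shifted_infimum_le simp del: of_real_mult of_real_add\<close>)
  qed
  then have "AE \<omega> in M. \<forall>n. Z (s n) \<omega> + rinf (\<lambda>v. Z (s n + v) \<omega> - Z (s n) \<omega>) (t - s n) \<noteq> m"
    by (simp add: AE_all_countable)
  then show ?thesis
    using AE_cadlag AE_Z_0
  proof eventually_elim
    case (elim \<omega>)
    show ?case
    proof
      assume eq: "lo \<omega> t = m"
      have sm: "lo \<omega> (s n) = m" for n
        using rinf_split[OF elim(2), of "s n" "t - s n"] s[of n] elim(1)[rule_format, of n] eq
        by (auto simp: min_def split: if_splits)
      obtain d where d: "0 < d" "\<And>t. 0 \<le> t \<Longrightarrow> t < d \<Longrightarrow> - \<bar>m\<bar> < lo \<omega> t \<and> lo \<omega> t \<le> 0"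
        using rinf_near_0[OF elim(2,3), of "\<bar>m\<bar>"] m by auto
      obtain n :: nat where "t / d < real n" using reals_Archimedean2 by blast
      then have "s n < d" using d t by (simp add: s_def field_simps)
      then show False using d(2)[of "s n"] s[of n] sm[of n] m by auto
    qed
  qed
qed

lemma infimum_nonneg_increment:
  assumes r: "0 < r" "r < s"
  shows "\<P>(\<omega> in M. 0 \<le> lo \<omega> r \<and> c \<le> Z s \<omega> - Z r \<omega>)
    \<le> \<P>(\<omega> in M. 0 \<le> lo \<omega> r) * \<P>(\<omega> in M. c \<le> Z s \<omega> - Z r \<omega>)"
proof -
  have [measurable]: "Z s \<in> borel_measurable M" "Z r \<in> borel_measurable M" using r by auto
  have [measurable]: "(\<lambda>\<omega>. lo \<omega> r) \<in> borel_measurable M" using r by simp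
  define G where "G N \<omega> = gmin (\<lambda>v. Z v \<omega>) r N" for N \<omega>
  have [measurable]: "G N \<in> borel_measurable M" for N
    unfolding G_def using r by (intro gmin_measurable) auto
  let ?Y = "{\<omega> \<in> space M. c \<le> Z s \<omega> - Z r \<omega>}"
  have "\<P>(\<omega> in M. 0 \<le> lo \<omega> r \<and> c \<le> Z s \<omega> - Z r \<omega>) \<le> \<P>(\<omega> in M. 0 \<le> G N \<omega>) * prob ?Y"
    if N: "0 < N" for N
  proof -
    define \<sigma> where "\<sigma> k = (if k \<le> N then real k * r / real N else s + real (k - Suc N))" for k
    have \<sigma>: "strict_mono \<sigma>" "\<sigma> 0 = 0"
      unfolding strict_mono_Suc_iff
    proof
      fix k
      show "\<sigma> k < \<sigma> (Suc k)"
        using r N by (cases "k = N") (auto simp: \<sigma>_def field_simps)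
    qed (use N in \<open>auto simp: \<sigma>_def\<close>)
    have "indep_var borel ((\<lambda>x. Min ((\<lambda>k. x k) ` {..N})) \<circ> (\<lambda>\<omega>. \<lambda>k\<in>{..N}. Z (\<sigma> k) \<omega> - Z 0 \<omega>))
       borel ((\<lambda>x. x 1) \<circ> (\<lambda>\<omega>. \<lambda>k\<in>{..1}. Z (\<sigma> (N + k)) \<omega> - Z (\<sigma> N) \<omega>))"
      by (rule indep_var_compose[OF indep_blocks[OF \<sigma>]])
        (auto intro!: borel_measurable_Min measurable_component_singleton)
    also have "(\<lambda>x. x 1) \<circ> (\<lambda>\<omega>. \<lambda>k\<in>{..1}. Z (\<sigma> (N + k)) \<omega> - Z (\<sigma> N) \<omega>) = (\<lambda>\<omega>. Z s \<omega> - Z r \<omega>)"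
      using N by (auto simp: \<sigma>_def)
    also have "(\<lambda>x. Min ((\<lambda>k. x k) ` {..N})) \<circ> (\<lambda>\<omega>. \<lambda>k\<in>{..N}. Z (\<sigma> k) \<omega> - Z 0 \<omega>)
        = (\<lambda>\<omega>. gmin (\<lambda>v. Z v \<omega> - Z 0 \<omega>) r N)"
      by (auto simp: gmin_def \<sigma>_def fun_eq_iff intro!: arg_cong[where f = Min] image_cong)
    finally have ind: "indep_var borel (\<lambda>\<omega>. gmin (\<lambda>v. Z v \<omega> - Z 0 \<omega>) r N) borel (\<lambda>\<omega>. Z s \<omega> - Z r \<omega>)" .
    have [measurable]: "(\<lambda>\<omega>. gmin (\<lambda>v. Z v \<omega> - Z 0 \<omega>) r N) \<in> borel_measurable M"
      using r by (intro gmin_measurable borel_measurable_diff) auto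
    have 0: "AE \<omega> in M. gmin (\<lambda>v. Z v \<omega> - Z 0 \<omega>) r N = G N \<omega>"
      using AE_Z_0 by eventually_elim (simp add: G_def)
    have "\<P>(\<omega> in M. 0 \<le> lo \<omega> r \<and> c \<le> Z s \<omega> - Z r \<omega>)
      \<le> \<P>(\<omega> in M. 0 \<le> gmin (\<lambda>v. Z v \<omega> - Z 0 \<omega>) r N \<and> c \<le> Z s \<omega> - Z r \<omega>)"
    proof (rule finite_measure_mono_AE)
      show "AE \<omega> in M. \<omega> \<in> {\<omega> \<in> space M. 0 \<le> lo \<omega> r \<and> c \<le> Z s \<omega> - Z r \<omega>} \<longrightarrow>
        \<omega> \<in> {\<omega> \<in> space M. 0 \<le> gmin (\<lambda>v. Z v \<omega> - Z 0 \<omega>) r N \<and> c \<le> Z s \<omega> - Z r \<omega>}"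
        using 0 AE_cadlag
      proof eventually_elim
        case (elim \<omega>)
        have "lo \<omega> r \<le> G N \<omega>"
          unfolding G_def gmin_def using grid_mem[of r _ N] r elim(2)
          by (intro Min.boundedI) (auto intro!: rinf_le)
        then show ?case using elim(1) by auto
      qed
    qed measurable
    also have "\<dots> = \<P>(\<omega> in M. 0 \<le> gmin (\<lambda>v. Z v \<omega> - Z 0 \<omega>) r N) * prob ?Y"
      using indep_varD[OF ind, of "{0..}" "{c..}"]
      by (simp add: vimage_def Int_def conj_commute conj_left_commute)
    also have "\<P>(\<omega> in M. 0 \<le> gmin (\<lambda>v. Z v \<omega> - Z 0 \<omega>) r N) = \<P>(\<omega> in M. 0 \<le> G N \<omega>)"
      by (rule measure_eq_AE) (use 0 in \<open>auto elim!: eventually_mono\<close>)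
    finally show ?thesis .
  qed
  note grid = this
  have "(\<lambda>N. \<P>(\<omega> in M. 0 \<le> G N \<omega>)) \<longlonglongrightarrow> \<P>(\<omega> in M. 0 \<le> lo \<omega> r)"
  proof (rule prob_tendsto)
    show "AE \<omega> in M. \<forall>\<^sub>F N in sequentially. \<omega> \<in> {\<omega> \<in> space M. 0 \<le> G N \<omega>} \<longleftrightarrow> \<omega> \<in> {\<omega> \<in> space M. 0 \<le> lo \<omega> r}"
      using AE_cadlag
    proof eventually_elim
      case (elim \<omega>)
      have ge: "lo \<omega> r \<le> G N \<omega>" for N
        unfolding G_def gmin_def using grid_mem[of r _ N] r elim
        by (intro Min.boundedI) (auto intro!: rinf_le)
      show ?case
      proof (cases "0 \<le> lo \<omega> r")
        case True
        then have "0 \<le> G N \<omega>" for N using ge[of N] by linarith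
        then show ?thesis using True by simp
      next
        case False
        have "\<forall>\<^sub>F N in sequentially. G N \<omega> < 0"
          using gmin_tendsto_rinf[OF elim, of r] False r unfolding G_def by (intro order_tendstoD) auto
        then show ?thesis by eventually_elim (use False in auto)
      qed
    qed
  qed measurable
  then have "(\<lambda>N. \<P>(\<omega> in M. 0 \<le> G N \<omega>) * prob ?Y) \<longlonglongrightarrow> \<P>(\<omega> in M. 0 \<le> lo \<omega> r) * prob ?Y"
    by (intro tendsto_intros)
  then show ?thesis
    by (rule tendsto_lowerbound) (use grid in \<open>auto intro: eventually_mono[OF eventually_gt_at_top[of 0]]\<close>)
qed

text \<open>
  Regularity of \<open>0\<close> for the negative half-line. With \<open>q s\<close> the probability to stay nonnegative up to
  time \<open>s\<close>, which decreases in \<open>s\<close>, and \<open>L\<close> its supremum, independence of the past up to a vanishing time \<open>r\<close> from the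
  increment over \<open>{r..s}\<close> gives \<open>q s \<le> L * P (Z s \<ge> 0)\<close>, hence \<open>L \<le> L * (1 - \<delta>)\<close>.
\<close>

lemma infimum_negative:
  assumes \<delta>: "0 < \<delta>" "\<And>r. 0 < r \<Longrightarrow> \<exists>s. 0 < s \<and> s < r \<and> \<delta> \<le> \<P>(\<omega> in M. Z s \<omega> < 0)"
    and t: "0 < t"
  shows "AE \<omega> in M. lo \<omega> t < 0"
proof -
  define q where "q r = \<P>(\<omega> in M. 0 \<le> lo \<omega> r)" for r
  define L where "L = Sup (q ` {0<..})"
  have bdd: "bdd_above (q ` {0<..})" by (rule bdd_aboveI2[of _ _ 1]) (simp add: q_def)
  have qL: "q r \<le> L" if "0 < r" for r unfolding L_def using that bdd by (intro cSup_upper) auto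
  have L0: "0 \<le> L" using qL[of 1] unfolding q_def by (meson measure_nonneg order.trans zero_less_one)
  have step: "q s \<le> L * \<P>(\<omega> in M. 0 \<le> Z s \<omega>)" if s: "0 < s" for s
  proof -
    have [measurable]: "Z s \<in> borel_measurable M" using s by simp
    have eta: "q s \<le> L * \<P>(\<omega> in M. - (2 * \<eta>) \<le> Z s \<omega>)" if \<eta>: "0 < \<eta>" for \<eta>
    proof -
      define p where "p r = \<P>(\<omega> in M. \<not> (- \<eta> < lo \<omega> r \<and> hi \<omega> r < \<eta>))" for r
      let ?c = "\<P>(\<omega> in M. - (2 * \<eta>) \<le> Z s \<omega>)"
      have p: "(p \<longlongrightarrow> 0) (at_right 0)" unfolding p_def[abs_def] by (rule prob_oscillation[OF \<eta>])
      have bound: "q s \<le> L * (?c + p r) + p r" if r: "0 < r" "r < s" for r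
      proof -
        have [measurable]: "Z r \<in> borel_measurable M" "(\<lambda>\<omega>. lo \<omega> s) \<in> borel_measurable M"
          "(\<lambda>\<omega>. lo \<omega> r) \<in> borel_measurable M" "(\<lambda>\<omega>. hi \<omega> r) \<in> borel_measurable M"
          using r by auto
        let ?A = "{\<omega> \<in> space M. \<not> (- \<eta> < lo \<omega> r \<and> hi \<omega> r < \<eta>)}"
        let ?B = "{\<omega> \<in> space M. 0 \<le> lo \<omega> r \<and> - \<eta> \<le> Z s \<omega> - Z r \<omega>}"
        have small: "AE \<omega> in M. \<omega> \<notin> ?A \<longrightarrow> \<omega> \<in> space M \<longrightarrow> \<bar>Z r \<omega>\<bar> < \<eta>"
          using AE_cadlag
        proof eventually_elim
          case (elim \<omega>)
          then show ?case
            using rinf_le[OF elim, of r r] rsup_ge[OF elim, of r r] r by auto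
        qed
        have "q s \<le> prob (?B \<union> ?A)"
          unfolding q_def
        proof (rule finite_measure_mono_AE)
          show "AE \<omega> in M. \<omega> \<in> {\<omega> \<in> space M. 0 \<le> lo \<omega> s} \<longrightarrow> \<omega> \<in> ?B \<union> ?A"
            using small AE_cadlag
          proof eventually_elim
            case (elim \<omega>)
            then show ?case
              using rinf_mono[OF elim(2), of r s] rinf_le[OF elim(2), of s s] r by auto
          qed
        qed measurable
        also have "\<dots> \<le> prob ?B + p r"
          unfolding p_def by (rule measure_Un_le) measurable
        also have "prob ?B \<le> q r * \<P>(\<omega> in M. - \<eta> \<le> Z s \<omega> - Z r \<omega>)"
          unfolding q_def by (rule infimum_nonneg_increment[OF r])
        also have "\<dots> \<le> L * (?c + p r)"
        proof (rule mult_mono)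
          have "\<P>(\<omega> in M. - \<eta> \<le> Z s \<omega> - Z r \<omega>) \<le> prob ({\<omega> \<in> space M. - (2 * \<eta>) \<le> Z s \<omega>} \<union> ?A)"
          proof (rule finite_measure_mono_AE)
            show "AE \<omega> in M. \<omega> \<in> {\<omega> \<in> space M. - \<eta> \<le> Z s \<omega> - Z r \<omega>} \<longrightarrow> \<omega> \<in> {\<omega> \<in> space M. - (2 * \<eta>) \<le> Z s \<omega>} \<union> ?A"
              using small by eventually_elim auto
          qed measurable
          also have "\<dots> \<le> ?c + p r"
            unfolding p_def by (rule measure_Un_le) measurable
          finally show "\<P>(\<omega> in M. - \<eta> \<le> Z s \<omega> - Z r \<omega>) \<le> ?c + p r" .
        qed (use qL r L0 in auto)
        finally show ?thesis by simp
      qed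
      have "((\<lambda>r. L * (?c + p r) + p r) \<longlongrightarrow> L * (?c + 0) + 0) (at_right 0)"
        by (intro tendsto_intros p)
      moreover have "\<forall>\<^sub>F r in at_right 0. q s \<le> L * (?c + p r) + p r"
        by (rule eventually_at_rightI[OF _ s]) (use bound in auto)
      ultimately have "q s \<le> L * (?c + 0) + 0" by (rule tendsto_lowerbound) simp
      then show ?thesis by simp
    qed
    have "(\<lambda>n. \<P>(\<omega> in M. - (2 * inverse (real (Suc n))) \<le> Z s \<omega>)) \<longlonglongrightarrow> \<P>(\<omega> in M. 0 \<le> Z s \<omega>)"
    proof (rule prob_tendsto)
      show "AE \<omega> in M. \<forall>\<^sub>F n in sequentially. \<omega> \<in> {\<omega> \<in> space M. - (2 * inverse (real (Suc n))) \<le> Z s \<omega>} \<longleftrightarrow> \<omega> \<in> {\<omega> \<in> space M. 0 \<le> Z s \<omega>}"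
      proof (rule AE_I2)
        fix \<omega>
        show "\<forall>\<^sub>F n in sequentially. \<omega> \<in> {\<omega> \<in> space M. - (2 * inverse (real (Suc n))) \<le> Z s \<omega>} \<longleftrightarrow> \<omega> \<in> {\<omega> \<in> space M. 0 \<le> Z s \<omega>}"
        proof (cases "0 \<le> Z s \<omega>")
          case True
          have "- (2 * inverse (real (Suc n))) \<le> Z s \<omega>" for n
            using True by (rule order.trans[rotated]) simp
          then show ?thesis using True by simp
        next
          case False
          have "(\<lambda>n. - (2 * inverse (real (Suc n)))) \<longlonglongrightarrow> - (2 * 0)"
            by (intro tendsto_intros LIMSEQ_inverse_real_of_nat)
          then have "\<forall>\<^sub>F n in sequentially. Z s \<omega> < - (2 * inverse (real (Suc n)))"
            using False by (intro order_tendstoD) auto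
          then show ?thesis by eventually_elim (use False in auto)
        qed
      qed
    qed measurable
    then have "(\<lambda>n. L * \<P>(\<omega> in M. - (2 * inverse (real (Suc n))) \<le> Z s \<omega>)) \<longlonglongrightarrow> L * \<P>(\<omega> in M. 0 \<le> Z s \<omega>)"
      by (intro tendsto_intros)
    then show ?thesis by (rule tendsto_lowerbound) (auto intro!: always_eventually eta)
  qed
  have "q r \<le> L * (1 - \<delta>)" if r: "0 < r" for r
  proof -
    obtain s where s: "0 < s" "s < r" "\<delta> \<le> \<P>(\<omega> in M. Z s \<omega> < 0)" using \<delta>(2)[OF r] by blast
    have [measurable]: "Z s \<in> borel_measurable M" "(\<lambda>\<omega>. lo \<omega> s) \<in> borel_measurable M"
      "(\<lambda>\<omega>. lo \<omega> r) \<in> borel_measurable M" using s r by auto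
    have "q r \<le> q s"
      unfolding q_def
    proof (rule finite_measure_mono_AE)
      show "AE \<omega> in M. \<omega> \<in> {\<omega> \<in> space M. 0 \<le> lo \<omega> r} \<longrightarrow> \<omega> \<in> {\<omega> \<in> space M. 0 \<le> lo \<omega> s}"
        using AE_cadlag
      proof eventually_elim
        case (elim \<omega>)
        then show ?case using rinf_mono[OF elim, of s r] s by auto
      qed
    qed measurable
    also have "\<dots> \<le> L * \<P>(\<omega> in M. 0 \<le> Z s \<omega>)" by (rule step[OF s(1)])
    also have "\<P>(\<omega> in M. 0 \<le> Z s \<omega>) = 1 - \<P>(\<omega> in M. Z s \<omega> < 0)"
      by (subst prob_compl[symmetric]) (auto intro!: arg_cong[where f = prob])
    also have "L * \<dots> \<le> L * (1 - \<delta>)" using s L0 by (intro mult_left_mono) auto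
    finally show ?thesis .
  qed
  then have "Sup (q ` {0<..}) \<le> L * (1 - \<delta>)" by (intro cSup_least) auto
  then have "L \<le> L * (1 - \<delta>)" by (simp only: L_def)
  then have "L * \<delta> \<le> 0" by (simp add: algebra_simps)
  then have "L \<le> 0" using \<delta>(1) by (simp add: mult_le_0_iff)
  then have "q t = 0" using qL[OF t] measure_nonneg[of M] by (auto simp: q_def intro!: antisym)
  then have "AE \<omega> in M. \<not> 0 \<le> lo \<omega> t"
    unfolding q_def using t by (subst (asm) prob_Collect_eq_0) auto
  then show ?thesis by (simp add: not_le)
qed

end

context stable_levy
begin

lemma infimum_facts:
  assumes "0 < t"
  shows "AE \<omega> in M. lo \<omega> t < 0" "AE \<omega> in M. lo \<omega> t \<noteq> m"
proof -
  show neg: "AE \<omega> in M. lo \<omega> t < 0"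
  proof -
    have "\<exists>\<delta>>0. \<forall>r>0. \<exists>s. 0 < s \<and> s < r \<and> \<delta> \<le> \<P>(\<omega> in M. Z s \<omega> < 0)"
      using both_signs[of 1] by (simp only: mult_1 simp_thms)
    then obtain \<delta> where \<delta>: "0 < \<delta>" "\<forall>r>0. \<exists>s. 0 < s \<and> s < r \<and> \<delta> \<le> \<P>(\<omega> in M. Z s \<omega> < 0)"
      by (elim exE conjE)
    show ?thesis by (rule infimum_negative[OF \<delta>(1) \<delta>(2)[rule_format] assms])
  qed
  show "AE \<omega> in M. lo \<omega> t \<noteq> m"
  proof (cases "m = 0")
    case True
    show ?thesis using neg by eventually_elim (simp add: True)
  next
    case False
    then show ?thesis by (intro infimum_no_atom_off_0 char_Z_vanishes assms)
  qed
qed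

lemma supremum_facts:
  assumes t: "0 < t"
  shows "AE \<omega> in M. 0 < hi \<omega> t" "AE \<omega> in M. hi \<omega> t \<noteq> m"
proof -
  interpret neg: levy M "\<lambda>t \<omega>. - Z t \<omega>" by (rule levy_uminus) unfold_locales
  have char: "(\<lambda>n::nat. LINT \<omega>|M. iexp (real n * - Z t \<omega>)) \<longlonglongrightarrow> 0" if "0 < t" for t
  proof -
    have "(LINT \<omega>|M. iexp (real n * - Z t \<omega>)) = cnj (LINT \<omega>|M. iexp (real n * Z t \<omega>))" for n
    proof -
      have "(LINT \<omega>|M. iexp (real n * - Z t \<omega>)) = (LINT \<omega>|M. cnj (iexp (real n * Z t \<omega>)))"
        by (intro Bochner_Integration.integral_cong refl) (simp add: exp_cnj)
      also have "\<dots> = cnj (LINT \<omega>|M. iexp (real n * Z t \<omega>))" by (rule Bochner_Integration.integral_cnj)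
      finally show ?thesis .
    qed
    then have neq: "norm (LINT \<omega>|M. iexp (real n * - Z t \<omega>)) = norm (LINT \<omega>|M. iexp (real n * Z t \<omega>))" for n
      by (simp only: complex_mod_cnj)
    show ?thesis
      by (rule tendsto_norm_zero_cancel, subst neq) (rule tendsto_norm_zero[OF char_Z_vanishes[OF that]])
  qed
  have sup: "AE \<omega> in M. rinf (\<lambda>s. - Z s \<omega>) t < 0"
  proof -
    have "\<exists>\<delta>>0. \<forall>r>0. \<exists>s. 0 < s \<and> s < r \<and> \<delta> \<le> \<P>(\<omega> in M. - Z s \<omega> < 0)"
      using both_signs[of "- 1"] by (simp only: mult_minus1 simp_thms)
    then obtain \<delta> where \<delta>: "0 < \<delta>" "\<forall>r>0. \<exists>s. 0 < s \<and> s < r \<and> \<delta> \<le> \<P>(\<omega> in M. - Z s \<omega> < 0)"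
      by (elim exE conjE)
    show ?thesis by (rule neg.infimum_negative[OF \<delta>(1) \<delta>(2)[rule_format] t])
  qed
  then show pos: "AE \<omega> in M. 0 < hi \<omega> t" by (simp only: rsup_def neg_0_less_iff_less)
  show "AE \<omega> in M. hi \<omega> t \<noteq> m"
  proof (cases "m = 0")
    case True
    show ?thesis using pos by eventually_elim (simp add: True)
  next
    case False
    then have "- m \<noteq> 0" by simp
    have "AE \<omega> in M. rinf (\<lambda>s. - Z s \<omega>) t \<noteq> - m"
      by (rule neg.infimum_no_atom_off_0[OF char t \<open>- m \<noteq> 0\<close>])
    then show ?thesis by eventually_elim (simp add: rsup_def minus_equation_iff[of _ m] eq_commute)
  qed
qed

end

section \<open>The killed semigroup\<close>

lemma prod_indicator_tendsto:
  fixes z :: "real \<Rightarrow> real" and \<tau> :: "nat \<Rightarrow> nat \<Rightarrow> real"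
  assumes z: "cadlag z" and T: "0 \<le> T"
    and \<tau>: "\<And>n k. k \<le> N n \<Longrightarrow> \<tau> n k \<in> {0..T}"
    and dense: "\<And>u U. 0 \<le> u \<Longrightarrow> u \<le> T \<Longrightarrow> open U \<Longrightarrow> z u \<in> U \<Longrightarrow> \<forall>\<^sub>F n in sequentially. \<exists>k\<le>N n. z (\<tau> n k) \<in> U"
    and ne: "rinf z T \<noteq> l - x" "rsup z T \<noteq> R - x"
  shows "(\<lambda>n. \<Prod>k\<le>N n. indicator {l<..<R} (x + z (\<tau> n k)) :: real) \<longlonglongrightarrow>
    of_bool (l - x < rinf z T \<and> rsup z T < R - x)"
proof (cases "l - x < rinf z T \<and> rsup z T < R - x")
  case True
  have "x + z (\<tau> n k) \<in> {l<..<R}" if "k \<le> N n" for n k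
    using rinf_le[OF z, of "\<tau> n k" T] rsup_ge[OF z, of "\<tau> n k" T] \<tau>[OF that] True by auto
  then have "(\<Prod>k\<le>N n. indicator {l<..<R} (x + z (\<tau> n k)) :: real) = 1" for n
    by (intro prod.neutral) auto
  then show ?thesis using True by simp
next
  case False
  obtain u U where u: "0 \<le> u" "u \<le> T" "open U" "z u \<in> U" "\<And>y. y \<in> U \<Longrightarrow> x + y \<notin> {l<..<R}"
  proof (cases "rinf z T < l - x")
    case True
    obtain u where "0 \<le> u" "u \<le> T" "z u < l - x" using rinf_lessE[OF z T True] by blast
    then show ?thesis by (intro that[of u "{..<l - x}"]) auto
  next
    case F: False
    then have "R - x < rsup z T" using False ne by auto
    then obtain u where "0 \<le> u" "u \<le> T" "R - x < z u" using rsup_gtE[OF z T] by blast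
    then show ?thesis by (intro that[of u "{R - x<..}"]) auto
  qed
  have "\<forall>\<^sub>F n in sequentially. (\<Prod>k\<le>N n. indicator {l<..<R} (x + z (\<tau> n k)) :: real) = 0"
    using dense[OF u(1-4)]
  proof eventually_elim
    case (elim n)
    then obtain k where "k \<le> N n" "z (\<tau> n k) \<in> U" by blast
    then show ?case using u(5)[of "z (\<tau> n k)"] by (intro prod_zero bexI[of _ k]) auto
  qed
  then have "(\<lambda>n. \<Prod>k\<le>N n. indicator {l<..<R} (x + z (\<tau> n k)) :: real) \<longlonglongrightarrow> 0"
    by (rule tendsto_eventually)
  moreover have "of_bool (l - x < rinf z T \<and> rsup z T < R - x) = (0::real)" using False by simp
  ultimately show ?thesis by (simp only:)
qed

lemma exit_time_le:
  "0 < u \<Longrightarrow> x + Z u \<omega> \<notin> D \<Longrightarrow> exit_time Z D x \<omega> \<le> ereal u"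
  unfolding exit_time_def by (intro Inf_lower) auto

text \<open>
  Right-continuity rules out an exit time equal to \<open>t\<close> for a path that is still inside the open set
  at time \<open>t\<close>.
\<close>

lemma exit_time_greater_iff:
  assumes z: "cadlag (\<lambda>s. Z s \<omega>)" and t: "0 \<le> t" and D: "open D" and 0: "x + Z 0 \<omega> \<in> D"
  shows "ereal t < exit_time Z D x \<omega> \<longleftrightarrow> (\<forall>u\<in>{0..t}. x + Z u \<omega> \<in> D)"
proof
  assume gt: "ereal t < exit_time Z D x \<omega>"
  show "\<forall>u\<in>{0..t}. x + Z u \<omega> \<in> D"
  proof
    fix u assume u: "u \<in> {0..t}"
    show "x + Z u \<omega> \<in> D"
    proof (rule ccontr)
      assume out: "x + Z u \<omega> \<notin> D"
      then have "u \<noteq> 0" using 0 by auto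
      then have "exit_time Z D x \<omega> \<le> ereal u" using u out by (intro exit_time_le) auto
      also have "\<dots> \<le> ereal t" using u by simp
      finally show False using gt by simp
    qed
  qed
next
  assume stay: "\<forall>u\<in>{0..t}. x + Z u \<omega> \<in> D"
  have "open ((\<lambda>y. x + y) -` D)" by (intro open_vimage D continuous_intros)
  moreover have "Z t \<omega> \<in> (\<lambda>y. x + y) -` D" using stay t by auto
  ultimately obtain d where d: "0 < d" "\<And>v. t \<le> v \<Longrightarrow> v < t + d \<Longrightarrow> Z v \<omega> \<in> (\<lambda>y. x + y) -` D"
    using cadlag_right[OF z t] by blast
  have "ereal (t + d) \<le> exit_time Z D x \<omega>"
    unfolding exit_time_def
  proof (intro Inf_greatest)
    fix e assume "e \<in> ereal ` {t. t > 0 \<and> x + Z t \<omega> \<notin> D}"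
    then obtain v where v: "e = ereal v" "0 < v" "x + Z v \<omega> \<notin> D" by auto
    then have "\<not> v \<le> t" "\<not> (t \<le> v \<and> v < t + d)" using stay d(2)[of v] by auto
    then show "ereal (t + d) \<le> e" using v by auto
  qed
  moreover have "ereal t < ereal (t + d)" using d by simp
  ultimately show "ereal t < exit_time Z D x \<omega>" by (rule less_le_trans[rotated])
qed

context levy
begin

lemma AE_extrema_0: "AE \<omega> in M. lo \<omega> 0 = 0 \<and> hi \<omega> 0 = 0"
  using AE_cadlag AE_Z_0
proof eventually_elim
  case (elim \<omega>)
  then show ?case by (simp add: rsup_def rinf_eq_Inf cadlag_uminus)
qed

lemma AE_extrema_sign: "0 \<le> t \<Longrightarrow> AE \<omega> in M. lo \<omega> t \<le> 0 \<and> 0 \<le> hi \<omega> t"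
  using AE_cadlag AE_Z_0
proof eventually_elim
  case (elim \<omega>)
  then show ?case using rinf_le[of "\<lambda>s. Z s \<omega>" 0 t] rsup_ge[of "\<lambda>s. Z s \<omega>" 0 t] by auto
qed

lemma chainE_measurable:
  assumes [measurable]: "g \<in> borel_measurable borel" "D \<in> sets borel" and "\<And>k. k \<le> n \<Longrightarrow> 0 \<le> \<sigma> k"
  shows "chainE D \<sigma> n g \<in> borel_measurable borel"
proof -
  have Z: "Z (\<sigma> k) \<in> borel_measurable M" if "k \<le> n" for k using assms that by simp
  have [measurable]: "Z (\<sigma> n) \<in> borel_measurable M" by (rule Z) simp
  have [measurable]: "(\<lambda>p. \<Prod>k\<le>n. indicator D (fst p + Z (\<sigma> k) (snd p)) :: real) \<in> borel_measurable (borel \<Otimes>\<^sub>M M)"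
  proof (rule borel_measurable_prod)
    fix k assume "k \<in> {..n}"
    then have [measurable]: "Z (\<sigma> k) \<in> borel_measurable M" by (auto intro: Z)
    show "(\<lambda>p. indicator D (fst p + Z (\<sigma> k) (snd p)) :: real) \<in> borel_measurable (borel \<Otimes>\<^sub>M M)" by measurable
  qed
  have "(\<lambda>p. (\<Prod>k\<le>n. indicator D (fst p + Z (\<sigma> k) (snd p))) * g (fst p + Z (\<sigma> n) (snd p))) \<in> borel_measurable (borel \<Otimes>\<^sub>M M)"
    by measurable
  then show ?thesis
    unfolding chainE_def by (intro borel_measurable_lebesgue_integral) (simp add: case_prod_unfold)
qed

end

locale killed_stable_levy = stable_levy M Z \<alpha> b c a
  for M :: "'w measure" and Z :: "real \<Rightarrow> 'w \<Rightarrow> real" and \<alpha> b c a :: real +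
  fixes l R :: real
  assumes lR: "l < R"
begin

abbreviation "\<Omega> \<equiv> {l<..<R}"

text \<open>
  Up to a null set the event that the path started at \<open>x\<close> has not left \<open>\<Omega>\<close> by time \<open>t\<close>; in contrast
  to the latter it is measurable without completion.
\<close>

definition stay :: "real \<Rightarrow> real \<Rightarrow> 'w \<Rightarrow> bool" where
  "stay t x \<omega> \<longleftrightarrow> l - x < lo \<omega> t \<and> hi \<omega> t < R - x"

definition stayE :: "real \<Rightarrow> (real \<Rightarrow> real) \<Rightarrow> real \<Rightarrow> real" where
  "stayE t g x = (LINT \<omega>|M. of_bool (stay t x \<omega>) * g (x + Z t \<omega>))"

lemma stay_measurable [measurable]: "0 \<le> t \<Longrightarrow> Measurable.pred M (stay t x)"
  unfolding stay_def by measurable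

lemma AE_not_critical:
  assumes "0 \<le> t" "0 < t \<or> x \<in> \<Omega>"
  shows "AE \<omega> in M. lo \<omega> t \<noteq> l - x \<and> hi \<omega> t \<noteq> R - x"
proof (cases "t = 0")
  case True
  then have x: "x \<in> \<Omega>" using assms by auto
  show ?thesis using AE_extrema_0 by eventually_elim (use x True in auto)
next
  case False
  then have "0 < t" using assms by simp
  from infimum_facts(2)[OF this, of "l - x"] supremum_facts(2)[OF this, of "R - x"]
  show ?thesis by eventually_elim simp
qed

lemma AE_not_stay: assumes "0 \<le> t" "x \<notin> \<Omega>" shows "AE \<omega> in M. \<not> stay t x \<omega>"
  using AE_extrema_sign[OF assms(1)] by eventually_elim (use assms in \<open>auto simp: stay_def\<close>)

text \<open>
  For \<open>x = l\<close> and \<open>x = R\<close> this is regularity of the boundary: both extrema leave \<open>0\<close> at once.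
\<close>

lemma AE_exit_immediately: assumes x: "x \<notin> \<Omega>" shows "AE \<omega> in M. exit_time Z \<Omega> x \<omega> \<le> 0"
proof -
  have "AE \<omega> in M. lo \<omega> (inverse (real (Suc n))) < 0 \<and> 0 < hi \<omega> (inverse (real (Suc n)))" for n
  proof -
    have "0 < inverse (real (Suc n))" by simp
    from infimum_facts(1)[OF this] supremum_facts(1)[OF this] show ?thesis by (rule AE_conjI)
  qed
  then have "AE \<omega> in M. \<forall>n. lo \<omega> (inverse (real (Suc n))) < 0 \<and> 0 < hi \<omega> (inverse (real (Suc n)))"
    by (intro AE_all_countable[THEN iffD2] allI)
  then show ?thesis
    using AE_cadlag AE_Z_0
  proof eventually_elim
    case (elim \<omega>)
    have bound: "exit_time Z \<Omega> x \<omega> \<le> ereal (inverse (real (Suc n)))" for n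
    proof -
      let ?t = "inverse (real (Suc n))"
      have "\<exists>u. 0 \<le> u \<and> u \<le> ?t \<and> u \<noteq> 0 \<and> x + Z u \<omega> \<notin> \<Omega>"
      proof (cases "x \<le> l")
        case True
        obtain u where "0 \<le> u" "u \<le> ?t" "Z u \<omega> < 0"
          using rinf_lessE[OF elim(2), of ?t 0] elim(1) by auto
        then show ?thesis using True elim(3) by (intro exI[of _ u]) auto
      next
        case False
        then have "R \<le> x" using x by auto
        obtain u where "0 \<le> u" "u \<le> ?t" "0 < Z u \<omega>"
          using rsup_gtE[OF elim(2), of ?t 0] elim(1) by auto
        then show ?thesis using \<open>R \<le> x\<close> elim(3) by (intro exI[of _ u]) auto
      qed
      then obtain u where "0 \<le> u" "u \<noteq> 0" and u': "u \<le> ?t" "x + Z u \<omega> \<notin> \<Omega>" by (elim exE conjE)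
      then have "0 < u" by simp
      note u = this u'
      have "exit_time Z \<Omega> x \<omega> \<le> ereal u" using u(1,3) by (rule exit_time_le)
      also have "\<dots> \<le> ereal ?t" using u by simp
      finally show ?thesis .
    qed
    have "(\<lambda>n. ereal (inverse (real (Suc n)))) \<longlonglongrightarrow> ereal 0"
      unfolding lim_ereal by (rule LIMSEQ_inverse_real_of_nat)
    then show ?case using LIMSEQ_le_const[of _ "ereal 0" "exit_time Z \<Omega> x \<omega>"] bound by (auto simp: zero_ereal_def)
  qed
qed

text \<open>
  For \<open>x \<in> \<Omega>\<close> the two events differ only if an extremum hits the boundary exactly, as a left limit
  that is not attained; this is the null event of \<open>AE_not_critical\<close>.
\<close>

lemma AE_exit_iff_stay:
  assumes t: "0 \<le> t"
  shows "AE \<omega> in M. ereal t < exit_time Z \<Omega> x \<omega> \<longleftrightarrow> stay t x \<omega>"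
proof (cases "x \<in> \<Omega>")
  case True
  show ?thesis
    using AE_not_critical[OF t disjI2[OF True]] AE_cadlag AE_Z_0
  proof eventually_elim
    case (elim \<omega>)
    have "ereal t < exit_time Z \<Omega> x \<omega> \<longleftrightarrow> (\<forall>u\<in>{0..t}. x + Z u \<omega> \<in> \<Omega>)"
      by (rule exit_time_greater_iff) (use elim t True in auto)
    also have "\<dots> \<longleftrightarrow> stay t x \<omega>"
    proof
      assume *: "\<forall>u\<in>{0..t}. x + Z u \<omega> \<in> \<Omega>"
      have "l - x \<le> lo \<omega> t"
        using * by (intro rinf_greatest elim t) (force simp: algebra_simps)
      moreover have "- (R - x) \<le> rinf (\<lambda>s. - Z s \<omega>) t"
        using * by (intro rinf_greatest cadlag_uminus elim t) (force simp: algebra_simps)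
      ultimately show "stay t x \<omega>" using elim(1) by (auto simp: stay_def rsup_def)
    next
      assume *: "stay t x \<omega>"
      show "\<forall>u\<in>{0..t}. x + Z u \<omega> \<in> \<Omega>"
      proof
        fix u assume "u \<in> {0..t}"
        then show "x + Z u \<omega> \<in> \<Omega>"
          using rinf_le[OF elim(2), of u t] rsup_ge[OF elim(2), of u t] * by (auto simp: stay_def)
      qed
    qed
    finally show ?case .
  qed
next
  case False
  show ?thesis
    using AE_not_stay[OF t False] AE_exit_immediately[OF False]
  proof eventually_elim
    case (elim \<omega>)
    have "exit_time Z \<Omega> x \<omega> \<le> ereal t" by (rule order.trans[OF elim(2)]) (use t in simp)
    then show ?case using elim(1) by auto
  qed
qed

lemma killed_eq_stayE:
  assumes t: "0 \<le> t" and g [measurable]: "g \<in> borel_measurable borel"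
  shows "killed_semigroup M Z \<Omega> t g x = stayE t g x"
proof -
  have [measurable]: "Z t \<in> borel_measurable M" using t by simp
  let ?h = "\<lambda>\<omega>. of_bool (stay t x \<omega>) * g (x + Z t \<omega>)"
  have h: "?h \<in> borel_measurable M" using t by measurable
  have hZ: "(\<lambda>\<omega>. g (x + Z t \<omega>)) \<in> borel_measurable (completion M)"
    by (rule measurable_completion) measurable
  have "Measurable.pred (completion M) (\<lambda>\<omega>. \<not> (ereal t < exit_time Z \<Omega> x \<omega> \<longleftrightarrow> stay t x \<omega>))"
    using AE_exit_iff_stay[OF t, of x] by (intro sets_completion_AE) simp
  moreover have "Measurable.pred (completion M) (stay t x)"
    using t by (intro measurable_completion) simp
  ultimately have "Measurable.pred (completion M) (\<lambda>\<omega>. (\<not> (ereal t < exit_time Z \<Omega> x \<omega> \<longleftrightarrow> stay t x \<omega>)) \<noteq> stay t x \<omega>)"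
    by measurable
  also have "(\<lambda>\<omega>. (\<not> (ereal t < exit_time Z \<Omega> x \<omega> \<longleftrightarrow> stay t x \<omega>)) \<noteq> stay t x \<omega>) = (\<lambda>\<omega>. ereal t < exit_time Z \<Omega> x \<omega>)"
    by auto
  finally have ex: "Measurable.pred (completion M) (\<lambda>\<omega>. ereal t < exit_time Z \<Omega> x \<omega>)" .
  have "killed_semigroup M Z \<Omega> t g x = (LINT \<omega>|completion M. ?h \<omega>)"
    unfolding killed_semigroup_def
  proof (rule integral_cong_AE)
    show "(\<lambda>\<omega>. if ereal t < exit_time Z \<Omega> x \<omega> then g (x + Z t \<omega>) else 0) \<in> borel_measurable (completion M)"
      using ex hZ by measurable
    show "?h \<in> borel_measurable (completion M)" by (rule measurable_completion[OF h])
    show "AE \<omega> in completion M. (if ereal t < exit_time Z \<Omega> x \<omega> then g (x + Z t \<omega>) else 0) = ?h \<omega>"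
      using AE_completion[OF AE_exit_iff_stay[OF t, of x]] by eventually_elim auto
  qed
  also have "\<dots> = stayE t g x" unfolding stayE_def by (rule integral_completion[OF h])
  finally show ?thesis .
qed

lemma stayE_outside: assumes "0 \<le> t" "x \<notin> \<Omega>" "g \<in> borel_measurable borel" shows "stayE t g x = 0"
proof -
  have [measurable]: "Z t \<in> borel_measurable M" "g \<in> borel_measurable borel" using assms by auto
  have "stayE t g x = (LINT \<omega>|M. 0)"
    unfolding stayE_def
  proof (rule integral_cong_AE)
    show "AE \<omega> in M. of_bool (stay t x \<omega>) * g (x + Z t \<omega>) = 0"
      using AE_not_stay[OF assms(1,2)] by eventually_elim simp
  qed (use assms(1) in measurable)
  then show ?thesis by simp
qed

lemma stayE_bound: "(\<And>x. \<bar>g x\<bar> \<le> B) \<Longrightarrow> \<bar>stayE t g x\<bar> \<le> B"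
  unfolding stayE_def by (rule abs_integral_le) (auto simp: of_bool_def intro: order.trans[OF abs_ge_zero])

lemma stayE_0:
  assumes "g \<in> borel_measurable borel" "\<And>x. x \<notin> \<Omega> \<Longrightarrow> g x = 0"
  shows "stayE 0 g x = g x"
proof (cases "x \<in> \<Omega>")
  case True
  have [measurable]: "Z 0 \<in> borel_measurable M" "g \<in> borel_measurable borel" using assms by auto
  have "stayE 0 g x = (LINT \<omega>|M. g x)"
    unfolding stayE_def
  proof (rule integral_cong_AE)
    show "AE \<omega> in M. of_bool (stay 0 x \<omega>) * g (x + Z 0 \<omega>) = g x"
      using AE_extrema_0 AE_Z_0 by eventually_elim (use True in \<open>simp add: stay_def\<close>)
  qed measurable
  then show ?thesis by (simp add: prob_space)
qed (use stayE_outside assms in auto)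

text \<open>
  The indicator of \<open>stay t x\<close> is discontinuous in \<open>x\<close> only where \<open>l - x\<close> or \<open>R - x\<close> is the value of an
  extremum, and for fixed \<open>x\<close> this has probability \<open>0\<close>. This holds for every real \<open>x\<close>, the end points of \<open>\<Omega>\<close> included.
\<close>

lemma stayE_continuous:
  assumes t: "0 < t" and g: "continuous_on UNIV g" and B: "\<And>x. \<bar>g x\<bar> \<le> B"
  shows "continuous_on UNIV (stayE t g)"
  unfolding continuous_on_eq_continuous_at[OF open_UNIV] continuous_at_sequentially
proof (intro ballI allI impI)
  fix x :: real and X assume X: "X \<longlonglongrightarrow> x"
  have [measurable]: "Z t \<in> borel_measurable M" "g \<in> borel_measurable borel"
    using t g by (auto intro: borel_measurable_continuous_onI)
  have "(\<lambda>n. stayE t g (X n)) \<longlonglongrightarrow> stayE t g x"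
    unfolding stayE_def
  proof (rule integral_dominated_convergence[where w = "\<lambda>_. B"])
    show "AE \<omega> in M. (\<lambda>n. of_bool (stay t (X n) \<omega>) * g (X n + Z t \<omega>)) \<longlonglongrightarrow> of_bool (stay t x \<omega>) * g (x + Z t \<omega>)"
      using AE_not_critical[OF less_imp_le[OF t] disjI1[OF t], of x]
    proof eventually_elim
      case (elim \<omega>)
      have 1: "(\<lambda>n. lo \<omega> t - (l - X n)) \<longlonglongrightarrow> lo \<omega> t - (l - x)"
        and 2: "(\<lambda>n. R - X n - hi \<omega> t) \<longlonglongrightarrow> R - x - hi \<omega> t"
        by (intro tendsto_intros X)+
      have "\<forall>\<^sub>F n in sequentially. stay t (X n) \<omega> \<longleftrightarrow> stay t x \<omega>"
      proof (cases "stay t x \<omega>")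
        case True
        then have "0 < lo \<omega> t - (l - x)" "0 < R - x - hi \<omega> t" by (auto simp: stay_def)
        from order_tendstoD(1)[OF 1 this(1)] order_tendstoD(1)[OF 2 this(2)] show ?thesis
          by eventually_elim (use True in \<open>auto simp: stay_def\<close>)
      next
        case False
        then consider (low) "lo \<omega> t - (l - x) < 0" | (high) "R - x - hi \<omega> t < 0"
          using elim by (auto simp: stay_def)
        then show ?thesis
        proof cases
          case low
          from order_tendstoD(2)[OF 1 low] show ?thesis by eventually_elim (use False in \<open>auto simp: stay_def\<close>)
        next
          case high
          from order_tendstoD(2)[OF 2 high] show ?thesis by eventually_elim (use False in \<open>auto simp: stay_def\<close>)
        qed
      qed
      then have "(\<lambda>n. of_bool (stay t (X n) \<omega>) :: real) \<longlonglongrightarrow> of_bool (stay t x \<omega>)"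
        by (intro tendsto_eventually) (auto elim: eventually_mono)
      moreover have "(\<lambda>n. g (X n + Z t \<omega>)) \<longlonglongrightarrow> g (x + Z t \<omega>)"
      proof (rule isCont_tendsto_compose[of _ g])
        show "isCont g (x + Z t \<omega>)" using continuous_on_interior[OF g] by simp
        show "(\<lambda>n. X n + Z t \<omega>) \<longlonglongrightarrow> x + Z t \<omega>" by (intro tendsto_intros X)
      qed
      ultimately show ?case by (rule tendsto_mult)
    qed
    show "AE \<omega> in M. norm (of_bool (stay t (X n) \<omega>) * g (X n + Z t \<omega>)) \<le> B" for n
      using B order.trans[OF abs_ge_zero B] by (auto simp: of_bool_def)
  qed (use t in auto)
  then show "(stayE t g \<circ> X) \<longlonglongrightarrow> stayE t g x" by (simp add: o_def)
qed

text \<open>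
  Watching the path on finer and finer grids decides in the limit whether it stays in \<open>\<Omega>\<close>: a path
  that leaves \<open>\<Omega>\<close> leaves its closure as well, because the extrema have no atoms.
\<close>

lemma grid_expectation_tendsto:
  fixes \<tau> :: "nat \<Rightarrow> nat \<Rightarrow> real"
  assumes T: "0 < T" and x: "x \<in> \<Omega>"
    and \<tau>: "\<And>n k. k \<le> N n \<Longrightarrow> \<tau> n k \<in> {0..T}"
    and dense: "\<And>z u U. cadlag z \<Longrightarrow> 0 \<le> u \<Longrightarrow> u \<le> T \<Longrightarrow> open U \<Longrightarrow> z u \<in> U \<Longrightarrow>
      \<forall>\<^sub>F n in sequentially. \<exists>k\<le>N n. z (\<tau> n k) \<in> U"
    and h [measurable]: "\<And>n. h n \<in> borel_measurable borel" and B: "\<And>n y. \<bar>h n y\<bar> \<le> B"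
    and g [measurable]: "g \<in> borel_measurable borel" and lim: "\<And>y. (\<lambda>n. h n y) \<longlonglongrightarrow> g y"
  shows "(\<lambda>n. LINT \<omega>|M. (\<Prod>k\<le>N n. indicator \<Omega> (x + Z (\<tau> n k) \<omega>)) * h n (x + Z T \<omega>)) \<longlonglongrightarrow> stayE T g x"
  unfolding stayE_def
proof (rule integral_dominated_convergence[where w = "\<lambda>_. B"])
  have [measurable]: "Z T \<in> borel_measurable M" using T by simp
  show "AE \<omega> in M. (\<lambda>n. (\<Prod>k\<le>N n. indicator \<Omega> (x + Z (\<tau> n k) \<omega>)) * h n (x + Z T \<omega>))
      \<longlonglongrightarrow> of_bool (stay T x \<omega>) * g (x + Z T \<omega>)"
    using AE_cadlag AE_not_critical[OF less_imp_le[OF T] disjI1[OF T], of x]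
  proof eventually_elim
    case (elim \<omega>)
    have "(\<lambda>n. \<Prod>k\<le>N n. indicator \<Omega> (x + Z (\<tau> n k) \<omega>) :: real) \<longlonglongrightarrow> of_bool (stay T x \<omega>)"
      unfolding stay_def 
      by (rule prod_indicator_tendsto[where N = N and \<tau> = \<tau>]) (use elim T \<tau> dense[OF elim(1)] in auto)
    then show ?case by (intro tendsto_mult lim)
  qed
  show "AE \<omega> in M. norm ((\<Prod>k\<le>N n. indicator \<Omega> (x + Z (\<tau> n k) \<omega>)) * h n (x + Z T \<omega>)) \<le> B" for n
    unfolding real_norm_def abs_mult using mult_mono[OF prod_indicator_bound B] by (intro AE_I2) auto
  show "(\<lambda>\<omega>. (\<Prod>k\<le>N n. indicator \<Omega> (x + Z (\<tau> n k) \<omega>)) * h n (x + Z T \<omega>)) \<in> borel_measurable M" for n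
  proof (intro borel_measurable_times borel_measurable_prod)
    fix k assume "k \<in> {..N n}"
    then have [measurable]: "Z (\<tau> n k) \<in> borel_measurable M" using \<tau>[of k n] by simp
    show "(\<lambda>\<omega>. indicator \<Omega> (x + Z (\<tau> n k) \<omega>) :: real) \<in> borel_measurable M" by measurable
  qed measurable
qed (use T in auto)

lemma chainE_tendsto_stayE:
  assumes t: "0 < t" and g [measurable]: "g \<in> borel_measurable borel" and B: "\<And>x. \<bar>g x\<bar> \<le> B"
  shows "(\<lambda>n. chainE \<Omega> (\<lambda>k. real k * t / real n) n g x) \<longlonglongrightarrow> stayE t g x"
proof (cases "x \<in> \<Omega>")
  case True
  have "(\<lambda>n. LINT \<omega>|M. (\<Prod>k\<le>n. indicator \<Omega> (x + Z (real k * t / real n) \<omega>)) * g (x + Z t \<omega>)) \<longlonglongrightarrow> stayE t g x"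
    by (rule grid_expectation_tendsto[where N = "\<lambda>n. n" and \<tau> = "\<lambda>n k. real k * t / real n" and h = "\<lambda>n. g" and B = B])
      (use t True grid_mem grid_hits B in auto)
  moreover have "\<forall>\<^sub>F n in sequentially. (LINT \<omega>|M. (\<Prod>k\<le>n. indicator \<Omega> (x + Z (real k * t / real n) \<omega>)) * g (x + Z t \<omega>))
      = chainE \<Omega> (\<lambda>k. real k * t / real n) n g x"
    using eventually_gt_at_top[of 0] by eventually_elim (simp add: chainE_def)
  ultimately show ?thesis by (rule Lim_transform_eventually)
next
  case False
  have Zm: "Z (real k * t / real n) \<in> borel_measurable M" for k n using t by simp
  have "chainE \<Omega> (\<lambda>k. real k * t / real n) n g x = (LINT \<omega>|M. 0)" for n
    unfolding chainE_def
  proof (rule integral_cong_AE)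
    show "AE \<omega> in M. (\<Prod>k\<le>n. indicator \<Omega> (x + Z (real k * t / real n) \<omega>)) * g (x + Z (real n * t / real n) \<omega>) = 0"
      using AE_Z_0
    proof eventually_elim
      case (elim \<omega>)
      have "(\<Prod>k\<le>n. indicator \<Omega> (x + Z (real k * t / real n) \<omega>)) = (0::real)"
        by (rule prod_zero) (use elim False in \<open>auto intro!: bexI[of _ 0]\<close>)
      then show ?case by simp
    qed
  qed (use Zm in measurable)
  then show ?thesis using stayE_outside[of t x g] t False by simp
qed

definition two_grid :: "real \<Rightarrow> real \<Rightarrow> nat \<Rightarrow> nat \<Rightarrow> real" where
  "two_grid s t n k = (if k \<le> n then real k * s / real n else s + real (k - n) * t / real n)"

lemma two_grid:
  assumes "0 < s" "0 < t" "0 < n"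
  shows "strict_mono (two_grid s t n)" "two_grid s t n 0 = 0" "two_grid s t n n = s"
    "two_grid s t n (n + k) = s + real k * t / real n"
proof -
  show "strict_mono (two_grid s t n)"
    unfolding strict_mono_Suc_iff
  proof
    fix k
    show "two_grid s t n k < two_grid s t n (Suc k)"
      using assms by (cases "k = n") (auto simp: two_grid_def field_simps)
  qed
  show "two_grid s t n 0 = 0" "two_grid s t n n = s" using assms by (auto simp: two_grid_def)
  show "two_grid s t n (n + k) = s + real k * t / real n"
    using assms by (cases "k = 0") (auto simp: two_grid_def)
qed

lemma two_grid_mem:
  assumes "0 < s" "0 < t" "k \<le> n + n" shows "two_grid s t n k \<in> {0..s + t}"
proof (cases "k \<le> n")
  case True
  then show ?thesis using grid_mem[of s k n] assms by (auto simp: two_grid_def)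
next
  case False
  then show ?thesis using grid_mem[of t "k - n" n] assms by (auto simp: two_grid_def)
qed

lemma two_grid_hits:
  assumes z: "cadlag z" and s: "0 < s" and t: "0 < t"
    and u: "0 \<le> u" "u \<le> s + t" "open U" "z u \<in> U"
  shows "\<forall>\<^sub>F n in sequentially. \<exists>k\<le>n + n. z (two_grid s t n k) \<in> U"
proof (cases "u \<le> s")
  case True
  from grid_hits[OF z u(1) True u(3,4)] show ?thesis
  proof eventually_elim
    case (elim n)
    then obtain k where "k \<le> n" "z (real k * s / real n) \<in> U" by auto
    then show ?case by (intro exI[of _ k]) (auto simp: two_grid_def)
  qed
next
  case False
  have "\<forall>\<^sub>F n in sequentially. \<exists>k\<le>n. z (s + real k * t / real n) - z s \<in> (\<lambda>y. y + z s) -` U"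
  proof (rule grid_hits[OF cadlag_shift[OF z less_imp_le[OF s]], of "u - s" t])
    show "open ((\<lambda>y. y + z s) -` U)" by (intro open_vimage u continuous_intros)
  qed (use False u in auto)
  then show ?thesis using eventually_gt_at_top[of 0]
  proof eventually_elim
    case (elim n)
    then obtain k where "k \<le> n" "z (s + real k * t / real n) \<in> U" by auto
    then show ?case using two_grid(4)[OF s t elim(2)] by (intro exI[of _ "n + k"]) auto
  qed
qed

text \<open>
  Along the grid that divides \<open>{0..s}\<close> and \<open>{s..s + t}\<close> into \<open>n\<close> parts each, the semigroup law is
  the composition law of the chain.
\<close>

lemma stayE_plus:
  assumes s: "0 < s" and t: "0 < t" and g [measurable]: "g \<in> borel_measurable borel" and B: "\<And>x. \<bar>g x\<bar> \<le> B"
    and stayE_meas: "stayE t g \<in> borel_measurable borel"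
  shows "stayE (s + t) g x = stayE s (stayE t g) x"
proof (cases "x \<in> \<Omega>")
  case True
  have st: "0 < s + t" using s t by simp
  have B0: "0 \<le> B" using B[of 0] by linarith
  define h where "h n = chainE \<Omega> (\<lambda>k. real k * t / real n) n g" for n
  have h: "h n \<in> borel_measurable borel" for n
    unfolding h_def using t by (intro chainE_measurable) auto
  have hB: "\<bar>h n y\<bar> \<le> B" for n y unfolding h_def by (rule chainE_bound[OF B B0])
  have h_lim: "(\<lambda>n. h n y) \<longlonglongrightarrow> stayE t g y" for y
    unfolding h_def by (rule chainE_tendsto_stayE[OF t g B])
  have outer: "(\<lambda>n. LINT \<omega>|M. (\<Prod>k\<le>n + n. indicator \<Omega> (x + Z (two_grid s t n k) \<omega>)) * g (x + Z (s + t) \<omega>)) \<longlonglongrightarrow> stayE (s + t) g x"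
    by (rule grid_expectation_tendsto[where N = "\<lambda>n. n + n" and \<tau> = "two_grid s t" and h = "\<lambda>n. g" and B = B])
      (use st True two_grid_mem[OF s t] two_grid_hits[OF _ s t] B in auto)
  have inner: "(\<lambda>n. LINT \<omega>|M. (\<Prod>k\<le>n. indicator \<Omega> (x + Z (real k * s / real n) \<omega>)) * h n (x + Z s \<omega>)) \<longlonglongrightarrow> stayE s (stayE t g) x"
    by (rule grid_expectation_tendsto[where N = "\<lambda>n. n" and \<tau> = "\<lambda>n k. real k * s / real n" and h = h and B = B])
      (use s True grid_mem grid_hits h hB stayE_meas h_lim in auto)
  have eq: "\<forall>\<^sub>F n in sequentially. (LINT \<omega>|M. (\<Prod>k\<le>n. indicator \<Omega> (x + Z (real k * s / real n) \<omega>)) * h n (x + Z s \<omega>))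
     = (LINT \<omega>|M. (\<Prod>k\<le>n + n. indicator \<Omega> (x + Z (two_grid s t n k) \<omega>)) * g (x + Z (s + t) \<omega>))"
    using eventually_gt_at_top[of 0]
  proof eventually_elim
    case (elim n)
    note G = two_grid[OF s t elim]
    have "(LINT \<omega>|M. (\<Prod>k\<le>n + n. indicator \<Omega> (x + Z (two_grid s t n k) \<omega>)) * g (x + Z (s + t) \<omega>))
       = chainE \<Omega> (two_grid s t n) (n + n) g x"
      unfolding chainE_def G(4) using elim by simp
    also have "\<dots> = chainE \<Omega> (two_grid s t n) n (chainE \<Omega> (\<lambda>k. two_grid s t n (n + k) - two_grid s t n n) n g) x"
      by (rule chainE_append[OF G(1,2) g _ B]) simp
    also have "chainE \<Omega> (\<lambda>k. two_grid s t n (n + k) - two_grid s t n n) n g = h n"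
      unfolding h_def G(3) G(4) by simp
    also have "chainE \<Omega> (two_grid s t n) n (h n) x
        = (LINT \<omega>|M. (\<Prod>k\<le>n. indicator \<Omega> (x + Z (real k * s / real n) \<omega>)) * h n (x + Z s \<omega>))"
      unfolding chainE_def G(3)
      by (intro Bochner_Integration.integral_cong refl arg_cong2[where f = "(*)"] prod.cong) (auto simp: two_grid_def)
    finally show ?case by simp
  qed
  show ?thesis by (rule LIMSEQ_unique[OF outer Lim_transform_eventually[OF inner eq]])
next
  case False
  then show ?thesis using stayE_outside[of "s + t" x g] stayE_outside[of s x "stayE t g"] s t stayE_meas by simp
qed

lemma stayE_near:
  assumes f: "f \<in> C0 \<Omega>" and e: "0 < e"
  shows "\<forall>\<^sub>F t in at_right 0. \<forall>x. \<bar>stayE t (apply_bcontfun f) x - apply_bcontfun f x\<bar> \<le> e"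
proof -
  have f0: "apply_bcontfun f x = 0" if "x \<notin> \<Omega>" for x using f that unfolding C0_interval by auto
  have fU: "f \<in> C0 UNIV" using f C0_interval_subset_C0_UNIV by blast
  obtain d where d: "0 < d" "\<And>x y. \<bar>x - y\<bar> < d \<Longrightarrow> \<bar>apply_bcontfun f x - apply_bcontfun f y\<bar> < e / 2"
    using C0_uniformly_continuous[OF fU, of "e / 2"] e by auto
  note [measurable] = apply_bcontfun_measurable
  show ?thesis
    using expectation_near_start[OF d(1) e norm_ge_zero[of f]] eventually_at_right_less[of "0::real"]
  proof (rule eventually_elim2)
    fix t :: real
    assume near: "\<forall>F c. F \<in> borel_measurable M \<longrightarrow> (\<forall>\<omega>. \<bar>F \<omega>\<bar> \<le> norm f) \<longrightarrow> \<bar>c\<bar> \<le> norm f \<longrightarrow>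
      (AE \<omega> in M. - d < lo \<omega> t \<and> hi \<omega> t < d \<longrightarrow> \<bar>F \<omega> - c\<bar> \<le> e / 2) \<longrightarrow>
      \<bar>(LINT \<omega>|M. F \<omega>) - c\<bar> \<le> e" and t: "0 < t"
    have [measurable]: "Z t \<in> borel_measurable M" using t by simp
    show "\<forall>x. \<bar>stayE t (apply_bcontfun f) x - apply_bcontfun f x\<bar> \<le> e"
    proof
      fix x
      let ?F = "\<lambda>\<omega>. of_bool (stay t x \<omega>) * apply_bcontfun f (x + Z t \<omega>)"
      have Fm: "?F \<in> borel_measurable M" using less_imp_le[OF t] by measurable
      have Fb: "\<forall>\<omega>. \<bar>?F \<omega>\<bar> \<le> norm f" by (auto simp: of_bool_def abs_apply_bcontfun_le)
      have close: "AE \<omega> in M. - d < lo \<omega> t \<and> hi \<omega> t < d \<longrightarrow> \<bar>?F \<omega> - apply_bcontfun f x\<bar> \<le> e / 2"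
        using AE_cadlag
      proof eventually_elim
        case (elim \<omega>)
        have Zt: "lo \<omega> t \<le> Z t \<omega>" "Z t \<omega> \<le> hi \<omega> t"
          using rinf_le[OF elim, of t t] rsup_ge[OF elim, of t t] t by auto
        show ?case
        proof
          assume small: "- d < lo \<omega> t \<and> hi \<omega> t < d"
          show "\<bar>?F \<omega> - apply_bcontfun f x\<bar> \<le> e / 2"
          proof (cases "stay t x \<omega>")
            case True
            have "\<bar>Z t \<omega>\<bar> < d" using small Zt by linarith
            then show ?thesis using d(2)[of "x + Z t \<omega>" x] True by simp
          next
            case False
            have "\<bar>apply_bcontfun f x\<bar> < e / 2"
            proof (cases "x \<in> \<Omega>")
              case True
              then have "\<bar>x - l\<bar> < d \<or> \<bar>x - R\<bar> < d" using False small by (auto simp: stay_def)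
              then show ?thesis using d(2)[of x l] d(2)[of x R] f0[of l] f0[of R] by auto
            qed (use f0 e in auto)
            then show ?thesis using False by simp
          qed
        qed
      qed
      show "\<bar>stayE t (apply_bcontfun f) x - apply_bcontfun f x\<bar> \<le> e"
        unfolding stayE_def by (rule near[rule_format, OF Fm Fb[rule_format] abs_apply_bcontfun_le close])
    qed
  qed
qed

lemma feller_killed: "feller_semigroup \<Omega> (killed_semigroup M Z \<Omega>)"
proof
  show "subspace (C0 \<Omega>)" "closed (C0 \<Omega>)" by (fact subspace_C0_interval closed_C0_interval)+
  note [measurable] = apply_bcontfun_measurable
  note fm = apply_bcontfun_measurable and fb = abs_apply_bcontfun_le
  have f0: "apply_bcontfun f x = 0" if "f \<in> C0 \<Omega>" "x \<notin> \<Omega>" for f x using that unfolding C0_interval by auto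
  have K: "killed_semigroup M Z \<Omega> t (apply_bcontfun f) = stayE t (apply_bcontfun f)" if "0 \<le> t" for t and f :: "(real, real) bcontfun"
    by (rule ext) (rule killed_eq_stayE[OF that fm])
  have cont: "continuous_on UNIV (stayE t (apply_bcontfun f))" if "0 \<le> t" "f \<in> C0 \<Omega>" for t f
  proof (cases "t = 0")
    case True
    have "stayE 0 (apply_bcontfun f) = apply_bcontfun f" using stayE_0[OF fm f0[OF that(2)]] by auto
    then show ?thesis using True by simp
  next
    case False
    then show ?thesis using that by (intro stayE_continuous[OF _ _ fb]) auto
  qed
  have int: "integrable M (\<lambda>\<omega>. of_bool (stay t x \<omega>) * apply_bcontfun f (x + Z t \<omega>))" if t: "0 \<le> t" for t x and f :: "(real, real) bcontfun"
  proof (rule integrable_const_bound[of _ "norm f"])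
    have [measurable]: "Z t \<in> borel_measurable M" using t by simp
    show "(\<lambda>\<omega>. of_bool (stay t x \<omega>) * apply_bcontfun f (x + Z t \<omega>)) \<in> borel_measurable M" using t by measurable
  qed (auto simp: of_bool_def fb)
  fix t :: real and f :: "(real, real) bcontfun"
  show "continuous_on UNIV (killed_semigroup M Z \<Omega> t (apply_bcontfun f))" if "0 \<le> t" "f \<in> C0 \<Omega>"
    using cont[OF that] K[OF that(1)] by simp
  show bound: "\<bar>killed_semigroup M Z \<Omega> t (apply_bcontfun f) x\<bar> \<le> norm f" if "0 \<le> t" for x
    unfolding K[OF that] by (rule stayE_bound[OF fb])
  show "Bcontfun (killed_semigroup M Z \<Omega> t (apply_bcontfun f)) \<in> C0 \<Omega>" if t: "0 \<le> t" and f: "f \<in> C0 \<Omega>"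
  proof -
    have "apply_bcontfun (Bcontfun (stayE t (apply_bcontfun f))) = stayE t (apply_bcontfun f)"
      by (rule Bcontfun_inverse, rule bcontfun_normI[OF cont[OF t f], of "norm f"])
        (use stayE_bound[OF fb] in auto)
    then show ?thesis unfolding K[OF t] C0_interval using stayE_outside[OF t _ fm] by auto
  qed
  show "killed_semigroup M Z \<Omega> t (\<lambda>x. apply_bcontfun f x + apply_bcontfun g x) x =
      killed_semigroup M Z \<Omega> t (apply_bcontfun f) x + killed_semigroup M Z \<Omega> t (apply_bcontfun g) x" if t: "0 \<le> t" for g x
  proof -
    have "killed_semigroup M Z \<Omega> t (\<lambda>x. apply_bcontfun f x + apply_bcontfun g x) x = stayE t (\<lambda>x. apply_bcontfun f x + apply_bcontfun g x) x"
      by (rule killed_eq_stayE[OF t]) measurable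
    also have "\<dots> = stayE t (apply_bcontfun f) x + stayE t (apply_bcontfun g) x"
      unfolding stayE_def distrib_left by (rule Bochner_Integration.integral_add[OF int[OF t] int[OF t]])
    finally show ?thesis using K[OF t] by simp
  qed
  show "killed_semigroup M Z \<Omega> t (\<lambda>x. c * apply_bcontfun f x) x = c * killed_semigroup M Z \<Omega> t (apply_bcontfun f) x" if t: "0 \<le> t" for c x
  proof -
    have "killed_semigroup M Z \<Omega> t (\<lambda>x. c * apply_bcontfun f x) x = stayE t (\<lambda>x. c * apply_bcontfun f x) x"
      by (rule killed_eq_stayE[OF t]) measurable
    also have "\<dots> = c * stayE t (apply_bcontfun f) x"
      unfolding stayE_def mult.left_commute[of _ c] by (rule integral_mult_right_zero)
    finally show ?thesis using K[OF t] by simp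
  qed
  show "killed_semigroup M Z \<Omega> 0 (apply_bcontfun f) x = apply_bcontfun f x" if "f \<in> C0 \<Omega>" for x
    using stayE_0[OF fm f0[OF that]] K[of 0] by simp
  show "killed_semigroup M Z \<Omega> (s + t) (apply_bcontfun f) x = killed_semigroup M Z \<Omega> s (killed_semigroup M Z \<Omega> t (apply_bcontfun f)) x"
    if s: "0 < s" and t: "0 < t" and f: "f \<in> C0 \<Omega>" for s x
  proof -
    have m: "stayE t (apply_bcontfun f) \<in> borel_measurable borel"
      by (rule borel_measurable_continuous_onI[OF cont[OF less_imp_le[OF t] f]])
    show ?thesis
      using stayE_plus[OF s t fm fb m] s t by (simp add: K killed_eq_stayE[OF _ m])
  qed
  show "\<forall>\<^sub>F t in at_right 0. \<forall>x. \<bar>killed_semigroup M Z \<Omega> t (apply_bcontfun f) x - apply_bcontfun f x\<bar> \<le> e"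
    if "f \<in> C0 \<Omega>" "0 < e" for e
    using stayE_near[OF that] eventually_at_right_less[of "0::real"] by eventually_elim (simp add: K)
qed

end

section \<open>Well-posedness of the Dirichlet problem\<close>

theorem mainTheorem3:
  fixes M :: "'w measure" and Z :: "real \<Rightarrow> 'w \<Rightarrow> real" and \<alpha> a b c l R :: real
  assumes "1 < \<alpha>" and "\<alpha> < 2"
    and "b \<ge> 0" and "c \<ge> 0" and "b \<noteq> 0 \<or> c \<noteq> 0"
    and "stable_levy_process M Z \<alpha> a b c"
    and "l < R"
  shows
    "(\<forall>f\<in>dirichlet_dom M Z {l<..<R}. \<exists>u.
        (\<forall>t\<ge>0. \<forall>x. apply_bcontfun (u t) x
           = killed_semigroup M Z {l<..<R} t (apply_bcontfun f) x) \<and>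
        is_solution M Z {l<..<R} f u \<and>
        (\<forall>v. is_solution M Z {l<..<R} f v \<longrightarrow> (\<forall>t\<ge>0. v t = u t)))
   \<and> (\<forall>f\<in>C0 {l<..<R}. \<exists>u.
        (\<forall>t\<ge>0. \<forall>x. apply_bcontfun (u t) x
           = killed_semigroup M Z {l<..<R} t (apply_bcontfun f) x) \<and>
        is_mild_solution M Z {l<..<R} f u \<and>
        (\<forall>v. is_mild_solution M Z {l<..<R} f v \<longrightarrow> (\<forall>t\<ge>0. v t = u t)))
   \<and> (\<forall>f1\<in>dirichlet_dom M Z {l<..<R}. \<forall>f2\<in>dirichlet_dom M Z {l<..<R}. \<forall>u1 u2.
        is_solution M Z {l<..<R} f1 u1 \<longrightarrow> is_solution M Z {l<..<R} f2 u2 \<longrightarrow>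
        (\<forall>t\<ge>0. norm (u2 t - u1 t) \<le> norm (f2 - f1)))
   \<and> (\<forall>f1\<in>C0 {l<..<R}. \<forall>f2\<in>C0 {l<..<R}. \<forall>u1 u2.
        is_mild_solution M Z {l<..<R} f1 u1 \<longrightarrow> is_mild_solution M Z {l<..<R} f2 u2 \<longrightarrow>
        (\<forall>t\<ge>0. norm (u2 t - u1 t) \<le> norm (f2 - f1)))
   \<and> dirichlet_well_posed M Z {l<..<R}"
proof -
  interpret killed_stable_levy M Z \<alpha> b c a l R
    using assms by unfold_locales (auto simp: stable_levy_process_def)
  interpret D: feller_semigroup \<Omega> "killed_semigroup M Z \<Omega>" by (rule feller_killed)
  have dom: "f \<in> dirichlet_dom M Z \<Omega> \<longleftrightarrow> D.gen f (dirichlet_op M Z \<Omega> f)" for f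
    unfolding dirichlet_dom_def dirichlet_op_def by (rule D.generator_dom_iff)
  have genD: "f \<in> dirichlet_dom M Z \<Omega> \<and> dirichlet_op M Z \<Omega> f = g" if "D.gen f g" for f g
    using D.generator_eq[OF that] that dom[of f] by (simp add: dirichlet_op_def)
  have domV: "f \<in> C0 \<Omega>" if "f \<in> dirichlet_dom M Z \<Omega>" for f
    using that dom D.gen_in_V by blast
  have sol_orbit: "f \<in> dirichlet_dom M Z \<Omega> \<and> (\<forall>t\<ge>0. u t = D.P t f)" if u: "is_solution M Z \<Omega> f u" for f u
  proof -
    obtain u' where u': "\<forall>t\<ge>0. (u has_vector_derivative u' t) (at t within {0..})"
      "\<forall>t\<ge>0. u t \<in> dirichlet_dom M Z \<Omega> \<and> u' t = dirichlet_op M Z \<Omega> (u t)" and u0: "u 0 = f"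
      using u unfolding is_solution_def by (elim conjE exE)
    have "u t = D.P t (u 0)" if "0 \<le> t" for t
      by (rule D.solution_eq_orbit[of u u']) (use u' dom that in auto)
    then show ?thesis using u0 u'(2) by auto
  qed
  have orbit_sol: "is_solution M Z \<Omega> f (\<lambda>t. D.P t f)" if f: "f \<in> dirichlet_dom M Z \<Omega>" for f
  proof -
    let ?g = "dirichlet_op M Z \<Omega> f"
    have g: "D.gen f ?g" using f dom by blast
    note V = D.gen_in_V[OF g]
    show ?thesis
      unfolding is_solution_def
    proof (intro conjI allI impI exI[of _ "\<lambda>t. D.P t ?g"])
      show "continuous_on {0..} (\<lambda>t. D.P t ?g)" by (rule D.continuous_on_orbit[OF V(2)])
      show "D.P 0 f = f" by (rule D.S_0[OF V(1)])
      fix t :: real assume t: "0 \<le> t"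
      show "D.P t f \<in> C0 \<Omega>" by (rule D.S_in_V[OF t V(1)])
      show "((\<lambda>t. D.P t f) has_vector_derivative D.P t ?g) (at t within {0..})"
        by (rule D.has_vector_derivative_orbit[OF g t])
      show "D.P t f \<in> dirichlet_dom M Z \<Omega>" "D.P t ?g = dirichlet_op M Z \<Omega> (D.P t f)"
        using genD[OF D.gen_orbit[OF g t]] by auto
    qed
  qed
  have mild_orbit: "f \<in> C0 \<Omega> \<and> (\<forall>t\<ge>0. u t = D.P t f)" if u: "is_mild_solution M Z \<Omega> f u" for f u
  proof -
    have u': "\<forall>t\<ge>0. u t \<in> C0 \<Omega>" "continuous_on {0..} u"
      "\<forall>t\<ge>0. integral {0..t} u \<in> dirichlet_dom M Z \<Omega> \<and> u t = f + dirichlet_op M Z \<Omega> (integral {0..t} u)"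
      using u unfolding is_mild_solution_def by auto
    have "dirichlet_op M Z \<Omega> 0 = 0" using genD[OF D.gen_0] by blast
    then have "u 0 = f" using u'(3)[rule_format, of 0] by simp
    then have f: "f \<in> C0 \<Omega>" using u'(1) by auto
    have "D.gen (integral {0..t} u) (u t - f)" if "0 \<le> t" for t
    proof -
      have "D.gen (integral {0..t} u) (dirichlet_op M Z \<Omega> (integral {0..t} u))"
        using u'(3) that dom by blast
      moreover have "u t = f + dirichlet_op M Z \<Omega> (integral {0..t} u)" using u'(3) that by blast
      ultimately show ?thesis by (simp add: algebra_simps)
    qed
    then show ?thesis using D.mild_solution_eq_orbit[OF f u'(2)] f by blast
  qed
  have orbit_mild: "is_mild_solution M Z \<Omega> f (\<lambda>t. D.P t f)" if f: "f \<in> C0 \<Omega>" for f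
    unfolding is_mild_solution_def
  proof (intro conjI allI impI)
    show "continuous_on {0..} (\<lambda>t. D.P t f)" by (rule D.continuous_on_orbit[OF f])
    fix t :: real assume t: "0 \<le> t"
    show "D.P t f \<in> C0 \<Omega>" by (rule D.S_in_V[OF t f])
    show "integral {0..t} (\<lambda>t. D.P t f) \<in> dirichlet_dom M Z \<Omega>"
      "D.P t f = f + dirichlet_op M Z \<Omega> (integral {0..t} (\<lambda>t. D.P t f))"
      using genD[OF D.gen_integral_orbit[OF f t]] by auto
  qed
  have contract: "norm (D.P t g - D.P t f) \<le> norm (g - f)" if "0 \<le> t" "f \<in> C0 \<Omega>" "g \<in> C0 \<Omega>" for t f g
    using D.norm_S[of t "g - f"] D.S_diff[of t g f] D.V_diff[of g f] that by simp
  have sol_contract: "norm (v t - u t) \<le> norm (g - f)"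
    if "is_solution M Z \<Omega> f u" "is_solution M Z \<Omega> g v" "0 \<le> t" for f g u v t
    using sol_orbit[OF that(1)] sol_orbit[OF that(2)] contract[OF that(3)] domV that(3) by simp
  have mild_contract: "norm (v t - u t) \<le> norm (g - f)"
    if "is_mild_solution M Z \<Omega> f u" "is_mild_solution M Z \<Omega> g v" "0 \<le> t" for f g u v t
    using mild_orbit[OF that(1)] mild_orbit[OF that(2)] contract[OF that(3)] that(3) by simp
  have "dirichlet_well_posed M Z \<Omega>"
    unfolding dirichlet_well_posed_def
  proof (intro conjI ballI allI impI)
    show "\<exists>u. is_solution M Z \<Omega> f u" if "f \<in> dirichlet_dom M Z \<Omega>" for f
      by (intro exI[of _ "\<lambda>t. D.P t f"] orbit_sol that)
    show "\<exists>u. is_mild_solution M Z \<Omega> f u" if "f \<in> C0 \<Omega>" for f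
      by (intro exI[of _ "\<lambda>t. D.P t f"] orbit_mild that)
    show "v t = u t" if "is_solution M Z \<Omega> f u" "is_solution M Z \<Omega> f v" "0 \<le> t" for f u v t
      using sol_contract[OF that] by simp
    show "v t = u t" if "is_mild_solution M Z \<Omega> f u" "is_mild_solution M Z \<Omega> f v" "0 \<le> t" for f u v t
      using mild_contract[OF that] by simp
    show "\<exists>d>0. \<forall>g\<in>C0 \<Omega>. \<forall>v. is_mild_solution M Z \<Omega> g v \<longrightarrow> norm (g - f) < d \<longrightarrow> (\<forall>t\<ge>0. norm (v t - u t) < e)"
      if "is_mild_solution M Z \<Omega> f u" "0 < e" for f u e
      by (intro exI[of _ e] conjI that(2) ballI allI impI) (rule le_less_trans[OF mild_contract[OF that(1)]])
    show "\<exists>d>0. \<forall>g\<in>dirichlet_dom M Z \<Omega>. \<forall>v. is_solution M Z \<Omega> g v \<longrightarrow> norm (g - f) < d \<longrightarrow> (\<forall>t\<ge>0. norm (v t - u t) < e)"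
      if "is_solution M Z \<Omega> f u" "0 < e" for f u e
      by (intro exI[of _ e] conjI that(2) ballI allI impI) (rule le_less_trans[OF sol_contract[OF that(1)]])
  qed
  moreover have "\<exists>u. (\<forall>t\<ge>0. \<forall>x. apply_bcontfun (u t) x = killed_semigroup M Z \<Omega> t (apply_bcontfun f) x) \<and>
        is_solution M Z \<Omega> f u \<and> (\<forall>v. is_solution M Z \<Omega> f v \<longrightarrow> (\<forall>t\<ge>0. v t = u t))"
    if f: "f \<in> dirichlet_dom M Z \<Omega>" for f
  proof (intro exI[of _ "\<lambda>t. D.P t f"] conjI allI impI)
    show "apply_bcontfun (D.P t f) x = killed_semigroup M Z \<Omega> t (apply_bcontfun f) x" if "0 \<le> t" for t x
      by (rule D.apply_P[OF that domV[OF f]])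
    show "is_solution M Z \<Omega> f (\<lambda>t. D.P t f)" by (rule orbit_sol[OF f])
    show "v t = D.P t f" if "is_solution M Z \<Omega> f v" "0 \<le> t" for v t
      using sol_orbit[OF that(1)] that(2) by blast
  qed
  moreover have "\<exists>u. (\<forall>t\<ge>0. \<forall>x. apply_bcontfun (u t) x = killed_semigroup M Z \<Omega> t (apply_bcontfun f) x) \<and>
        is_mild_solution M Z \<Omega> f u \<and> (\<forall>v. is_mild_solution M Z \<Omega> f v \<longrightarrow> (\<forall>t\<ge>0. v t = u t))"
    if f: "f \<in> C0 \<Omega>" for f
  proof (intro exI[of _ "\<lambda>t. D.P t f"] conjI allI impI)
    show "apply_bcontfun (D.P t f) x = killed_semigroup M Z \<Omega> t (apply_bcontfun f) x" if "0 \<le> t" for t x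
      by (rule D.apply_P[OF that f])
    show "is_mild_solution M Z \<Omega> f (\<lambda>t. D.P t f)" by (rule orbit_mild[OF f])
    show "v t = D.P t f" if "is_mild_solution M Z \<Omega> f v" "0 \<le> t" for v t
      using mild_orbit[OF that(1)] that(2) by blast
  qed
  ultimately show ?thesis
    by (intro conjI ballI allI impI) (assumption | rule sol_contract mild_contract)+
qed

end
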